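(* Let $m=m(n)$ and $p=p(n)\in(0,1)$ satisfy $\ln n=o(m)$ and $mp^2\le 1$, and let $\mathcal{G}(n,m,p)$ be the random intersection graph defined in the context. Run algorithm HAM on $\mathcal{G}(n,m,p)$ with input parameter $d=nmp^2$. Then \[ \lim_{n\to\infty}\Pr\Big(\{\delta(\mathcal{G}(n,m,p))\ge 2\}\cap\{\text{HAM terminates unsuccessfully on }\mathcal{G}(n,m,p)\}\Big)=0, \] where $\delta(\cdot)$ denotes minimum degree.
   Context: Random intersection graph $\mathcal{G}(n,m,p)$: there is a vertex set $\mathcal{V}$ with $|\mathcal{V}|=n$ and an auxiliary feature set $\mathcal{W}$ with $|\mathcal{W}|=m=m(n)$. Independently for every pair $(v,w)\in\mathcal{V}\times\mathcal{W}$, the feature $w$ is put into the random set $\mathcal{W}(v)$ with probability $p$. Two distinct vertices $v,v'$ are joined by an edge iff $\mathcal{W}(v)\cap\mathcal{W}(v')\neq\emptyset$. Algorithm HAM is the algorithm of Bollobás, Fenner and Frieze ("An algorithm for finding Hamilton paths and cycles in random graphs", Combinatorica 1987) for finding a Hamilton cycle in a graph with minimum degree at least 2 whose vertex set is ordered $v_1<\dots<v_n$. It starts with the one-vertex path $(v_1)$ and proceeds in stages $k=1,2,\dots$: at stage $k$ it holds a path of length $k$ and tries to extend it (by adding a neighbour of an endpoint lying outside the path, or, if the endpoints are adjacent, by closing a cycle and reopening it to a longer path). If no extension is possible, it generates, in breadth-first manner, new paths with the same vertex set via Pósa rotations (for a path $(u_1,\dots,u_k)$ and an edge $\{u_k,u_i\}$,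 $2\le i\le k-2$, the rotated path is $(u_1,\dots,u_i,u_k,u_{k-1},\dots,u_{i+1})$, applied at either end), trying to extend each new path. The algorithm succeeds if it finds a Hamilton cycle; it terminates unsuccessfully at stage $k$ if it has explored without extension all paths obtainable from the stage-$k$ path by at most $2T+1$ rotations, where $T=T(n,d)$ is the parameter of that algorithm depending on $n$ and the input value $d$ (with $T=o(\ln n)$ when $d=\Omega(\ln n)$). *)

theory Defs
  imports "HOL-Probability.Probability" "HOL-Probability.Product_PMF" "HOL-Library.Landau_Symbols"
begin

section \<open>Random intersection graphs\<close>

text \<open>A graph on the ordered vertex set \<open>{1..n}\<close> is given by its edge set, a set of two-element
  sets. The feature set is \<open>{1..m}\<close>.\<close>

definition rig_edges :: "nat \<Rightarrow> nat \<Rightarrow> (nat \<times> nat \<Rightarrow> bool) \<Rightarrow> nat set set" where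
  "rig_edges n m \<omega> =
     (let W = (\<lambda>v. {w \<in> {1..m}. \<omega> (v, w)})
      in {{v, v'} | v v'. v \<in> {1..n} \<and> v' \<in> {1..n} \<and> v \<noteq> v' \<and> W v \<inter> W v' \<noteq> {}})"

definition rig :: "nat \<Rightarrow> nat \<Rightarrow> real \<Rightarrow> nat set set pmf" where
  "rig n m p =
     map_pmf (rig_edges n m) (Pi_pmf ({1..n} \<times> {1..m}) False (\<lambda>_. bernoulli_pmf p))"

definition degree :: "nat set set \<Rightarrow> nat \<Rightarrow> nat" where
  "degree E v = card {e \<in> E. v \<in> e}"

definition min_degree :: "nat \<Rightarrow> nat set set \<Rightarrow> nat" where
  "min_degree n E = Min (degree E ` {1..n})"


section \<open>Algorithm HAM\<close>

text \<open>A path is the nonempty list of its vertices; at stage \<open>k\<close> it has \<open>k\<close> vertices. Paths are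
  unoriented objects, so before anything is done with a path it is listed starting from its
  smaller endpoint. Ties are broken by the ordering of the vertices.\<close>

definition orient :: "nat list \<Rightarrow> nat list" where
  "orient P = (if hd P \<le> last P then P else rev P)"

definition outside_nbrs :: "nat set set \<Rightarrow> nat list \<Rightarrow> nat \<Rightarrow> nat set" where
  "outside_nbrs E P v = {u. {v, u} \<in> E \<and> u \<notin> set P}"

definition closable :: "nat set set \<Rightarrow> nat list \<Rightarrow> bool" where
  "closable E P \<longleftrightarrow> 3 \<le> length P \<and> {hd P, last P} \<in> E"

text \<open>For a closable path, the first vertex \<open>u\<close> along the path having a neighbour outside it gets
  its smallest such neighbour \<open>y\<close> attached, and the cycle is cut at \<open>u\<close> by removing the edge to
  the smaller of the two cycle neighbours of \<open>u\<close>.\<close>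

definition reopen :: "nat set set \<Rightarrow> nat list \<Rightarrow> nat list" where
  "reopen E P =
     (let i = (LEAST i. i < length P \<and> outside_nbrs E P (P ! i) \<noteq> {});
          C = rotate i P; u = hd C; y = Min (outside_nbrs E P u)
      in if last C < C ! 1 then y # C else y # u # rev (tl C))"

datatype attempt = Longer "nat list" | Ham_Cycle "nat list" | Stuck

definition try_extend :: "nat \<Rightarrow> nat set set \<Rightarrow> nat list \<Rightarrow> attempt" where
  "try_extend n E P =
     (let Q = orient P
      in if outside_nbrs E Q (hd Q) \<noteq> {} then Longer (Min (outside_nbrs E Q (hd Q)) # Q)
         else if outside_nbrs E Q (last Q) \<noteq> {} then Longer (Q @ [Min (outside_nbrs E Q (last Q))])
         else if closable E Q \<and> length Q = n then Ham_Cycle Q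
         else if closable E Q \<and> (\<exists>u \<in> set Q. outside_nbrs E Q u \<noteq> {}) then Longer (reopen E Q)
         else Stuck)"

text \<open>Rotations of \<open>(u\<^sub>1, \<dots>, u\<^sub>k)\<close> at the end \<open>u\<^sub>k\<close>, one for every edge \<open>{u\<^sub>k, u\<^sub>i}\<close> with
  \<open>2 \<le> i \<le> k - 2\<close>, in increasing order of the vertex \<open>u\<^sub>i = P ! (i - 1)\<close>. The result is
  \<open>(u\<^sub>1, \<dots>, u\<^sub>i, u\<^sub>k, \<dots>, u\<^sub>i\<^sub>+\<^sub>1)\<close>.\<close>

definition end_rotations :: "nat set set \<Rightarrow> nat list \<Rightarrow> nat list list" where
  "end_rotations E P =
     map (\<lambda>i. take i P @ rev (drop i P))
       (sort_key (\<lambda>i. P ! (i - 1))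
         (filter (\<lambda>i. {last P, P ! (i - 1)} \<in> E) [2..<length P - 1]))"

definition rotations :: "nat set set \<Rightarrow> nat list \<Rightarrow> nat list list" where
  "rotations E P = (let Q = orient P in end_rotations E (rev Q) @ end_rotations E Q)"

text \<open>The paths obtainable from \<open>P\<close> by exactly \<open>j\<close> rotations, and by at most \<open>D\<close> rotations, both in
  breadth-first order. A path occurs once for every way of generating it.\<close>

definition bfs_level :: "nat set set \<Rightarrow> nat list \<Rightarrow> nat \<Rightarrow> nat list list" where
  "bfs_level E P j = ((\<lambda>Qs. concat (map (rotations E) Qs)) ^^ j) [P]"

definition bfs_paths :: "nat set set \<Rightarrow> nat \<Rightarrow> nat list \<Rightarrow> nat list list" where
  "bfs_paths E D P = concat (map (bfs_level E P) [0..<D + 1])"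

definition ham_stage :: "nat \<Rightarrow> nat set set \<Rightarrow> nat \<Rightarrow> nat list \<Rightarrow> attempt" where
  "ham_stage n E D P =
     (case find (\<lambda>Q. try_extend n E Q \<noteq> Stuck) (bfs_paths E D P) of
        None \<Rightarrow> Stuck
      | Some Q \<Rightarrow> try_extend n E Q)"

text \<open>\<open>ham_path n E D k P\<close>: HAM with rotation depth \<open>D\<close> reaches stage \<open>k\<close>, holding the path \<open>P\<close>.\<close>

inductive ham_path :: "nat \<Rightarrow> nat set set \<Rightarrow> nat \<Rightarrow> nat \<Rightarrow> nat list \<Rightarrow> bool"
  for n :: nat and E :: "nat set set" and D :: nat where
  start: "ham_path n E D 1 [1]"
| step: "ham_path n E D k P \<Longrightarrow> ham_stage n E D P = Longer P' \<Longrightarrow> ham_path n E D (Suc k) P'"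

text \<open>The parameter \<open>T\<close> of Bollobas, Fenner and Frieze. For \<open>d > 1\<close> the denominator is at
  least \<open>1\<close>; for \<open>d \<le> 1\<close> the value is arbitrary.\<close>

definition ham_T :: "nat \<Rightarrow> real \<Rightarrow> nat" where
  "ham_T n d = nat \<lceil>ln (real n) / (ln d - ln (ln d))\<rceil> + 1"

definition ham_fails_at :: "nat \<Rightarrow> nat set set \<Rightarrow> real \<Rightarrow> nat \<Rightarrow> bool" where
  "ham_fails_at n E d k \<longleftrightarrow>
     (let D = 2 * ham_T n d + 1 in \<exists>P. ham_path n E D k P \<and> ham_stage n E D P = Stuck)"

definition ham_fails :: "nat \<Rightarrow> nat set set \<Rightarrow> real \<Rightarrow> bool" where
  "ham_fails n E d \<longleftrightarrow> (\<exists>k. ham_fails_at n E d k)"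

end

theory Submission
  imports Defs "HOL-Real_Asymp.Real_Asymp"
begin

text \<open>If the exponent \<open>m p (1 - (1 - p)^(n - 1))\<close> of the probability of being isolated is at most
  \<open>0.995 ln n\<close>, then by the second moment method there is an isolated vertex with high probability.

  Otherwise every incidence is deleted independently with the tiny probability
  \<open>q = sqrt (ln (ln n)) / (n ln n)\<close>. HAM uses only \<open>O(n T)\<close> edges and \<open>n q T\<close> tends to 0, so with high
  probability the run up to the failing stage is the same on the remaining graph \<open>H\<close>, and \<open>H\<close> still has
  minimum degree 2. With high probability \<open>H\<close> expands: a set \<open>S\<close> of vertices has at least
  \<open>c min (d |S|) n\<close> neighbours, apart from sets meeting a few exceptional vertices, which are pairwise
  at distance more than 4. By Posa's rotations a stuck path then has linearly many endpoints, each of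
  which belongs to linearly many pairs of endpoints reached within \<open>2 T\<close> rotations. Given \<open>H\<close>, the deleted
  incidences are independent, and they avoid all these pairs with probability
  \<open>exp (- Omega (n q ln n))\<close>, which tends to 0.

  Small sets expand since it is unlikely that two or more vertices at small mutual distances have few
  neighbours: having few neighbours is a decreasing event and closeness an increasing one, so Harris'
  inequality bounds the probability of both by the product.\<close>

section \<open>Stability of HAM under deletion of unused edges\<close>

text \<open>Failure is a property of the whole graph, so conditioning on it destroys the randomness
  that could close a cycle. The colouring argument regains it: the full configuration together with
  its thinned part has the same joint law as an independent pair, thinned part plus sprinkling.
  Edges with a common feature are dependent, hence incidences are coloured rather than edges. The
  deletion rate must fit a narrow window. With \<open>T\<close> of order ln n / ln ln n, saving the
  O(n T) used incidences needs n q = o(ln ln n / ln n), while the endpoint pairs need n q ln n to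
  tend to infinity; the square root takes the middle. The window exists only because a stage is
  certified by the rotations leading to the one path that is extended, not by all edges that the
  search inspects. Just above the threshold a given vertex has few neighbours with probability up to
  about n^(-0.97), too much for a union bound over single vertices. A cluster of b + 1 such vertices
  costs n^(-0.97 (b + 1)), and when degrees are small there are at most about n^(1 + 0.86 b)
  clusters; so isolated exceptions remain but clusters do not.\<close>

text \<open>Deleting edges outside a suitable set of at most \<open>k\<close> edges keeps a given occurrence of an element
  in the list \<open>F E\<close> and puts no new elements in front of it; hence the first non-stuck path of a
  breadth-first search does not change.\<close>

definition robust :: "nat \<Rightarrow> ('e set \<Rightarrow> 'a list) \<Rightarrow> 'e set \<Rightarrow> bool" where
  "robust k F E \<longleftrightarrow> (\<forall>H\<subseteq>E. set (F H) \<subseteq> set (F E)) \<and>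
     (\<forall>xs y ys. F E = xs @ y # ys \<longrightarrow>
        (\<exists>U\<subseteq>E. finite U \<and> card U \<le> k \<and>
           (\<forall>H. U \<subseteq> H \<longrightarrow> H \<subseteq> E \<longrightarrow> (\<exists>xs' ys'. F H = xs' @ y # ys' \<and> set xs' \<subseteq> set xs))))"

lemma robust_set_mono: "robust k F E \<Longrightarrow> H \<subseteq> E \<Longrightarrow> set (F H) \<subseteq> set (F E)"
  by (auto simp: robust_def)

lemma robust_split:
  assumes "robust k F E" "F E = xs @ y # ys"
  obtains U where "U \<subseteq> E" "finite U" "card U \<le> k"
    "\<And>H. U \<subseteq> H \<Longrightarrow> H \<subseteq> E \<Longrightarrow> \<exists>xs' ys'. F H = xs' @ y # ys' \<and> set xs' \<subseteq> set xs"
proof -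
  from assms(1) have "F E = xs @ y # ys \<longrightarrow> (\<exists>U\<subseteq>E. finite U \<and> card U \<le> k \<and>
           (\<forall>H. U \<subseteq> H \<longrightarrow> H \<subseteq> E \<longrightarrow> (\<exists>xs' ys'. F H = xs' @ y # ys' \<and> set xs' \<subseteq> set xs)))"
    unfolding robust_def by (elim conjE allE)
  with assms(2) obtain U where "U \<subseteq> E \<and> finite U \<and> card U \<le> k \<and>
           (\<forall>H. U \<subseteq> H \<longrightarrow> H \<subseteq> E \<longrightarrow> (\<exists>xs' ys'. F H = xs' @ y # ys' \<and> set xs' \<subseteq> set xs))"
    by (elim impE exE)
  then show ?thesis by (intro that[of U]) simp_all
qed

lemma robust_const: "robust k (\<lambda>_. L) E"
  unfolding robust_def
proof (intro conjI allI impI)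
  fix xs y ys assume "L = xs @ y # ys"
  then show "\<exists>U\<subseteq>E. finite U \<and> card U \<le> k \<and>
           (\<forall>H. U \<subseteq> H \<longrightarrow> H \<subseteq> E \<longrightarrow> (\<exists>xs' ys'. L = xs' @ y # ys' \<and> set xs' \<subseteq> set xs))"
    by (intro exI[of _ "{}"] conjI allI impI exI[of _ xs] exI[of _ ys]) simp_all
qed simp

lemma concat_map_eq_split:
  assumes "concat (map f L) = xs @ y # ys"
  shows "\<exists>L1 q L2 us vs. L = L1 @ q # L2 \<and> f q = us @ y # vs \<and> xs = concat (map f L1) @ us"
  using assms
proof (induction L arbitrary: xs)
  case (Cons a L)
  then have "f a @ concat (map f L) = xs @ y # ys" by simp
  then consider (left) us where "f a = xs @ y # us" | (right) us where "xs = f a @ us" "concat (map f L) = us @ y # ys"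
    by (auto simp: append_eq_append_conv2 append_eq_Cons_conv Cons_eq_append_conv)
  then show ?case
  proof cases
    case left
    then have "a # L = [] @ a # L \<and> f a = xs @ y # us \<and> xs = concat (map f []) @ xs" by simp
    then show ?thesis by blast
  next
    case right
    from Cons.IH[OF right(2)] obtain L1 q L2 us' vs where
      "L = L1 @ q # L2" "f q = us' @ y # vs" "us = concat (map f L1) @ us'" by blast
    then show ?thesis using right(1)
      by (intro exI[of _ "a # L1"] exI[of _ q] exI[of _ L2] exI[of _ us'] exI[of _ vs]) auto
  qed
qed simp

text \<open>The chosen occurrence of \<open>y\<close> lies in the block of one entry
  \<open>q\<close> of \<open>F E\<close>. Keeping the edges that preserve \<open>q\<close> and those
  that preserve \<open>y\<close> within its block is enough: the blocks in front can only lose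
  elements, by the monotonicity clause of \<open>robust\<close>.\<close>

lemma robust_concat_map:
  assumes F: "robust k F E" and f: "\<And>x. x \<in> set (F E) \<Longrightarrow> robust l (\<lambda>E. f E x) E"
  shows "robust (k + l) (\<lambda>E. concat (map (f E) (F E))) E"
  unfolding robust_def
proof (intro conjI allI impI)
  fix H assume "H \<subseteq> E"
  then show "set (concat (map (f H) (F H))) \<subseteq> set (concat (map (f E) (F E)))"
    using robust_set_mono[OF F] robust_set_mono[OF f] unfolding set_concat set_map image_image
    by (meson UN_mono subsetD)
next
  fix xs y ys assume "concat (map (f E) (F E)) = xs @ y # ys"
  then obtain L1 q L2 us vs where L: "F E = L1 @ q # L2" and q: "f E q = us @ y # vs"
    and xs: "xs = concat (map (f E) L1) @ us"
    using concat_map_eq_split by metis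
  have qin: "q \<in> set (F E)" using L by simp
  from robust_split[OF F L] obtain U where U: "U \<subseteq> E" "finite U" "card U \<le> k"
      "\<And>H. U \<subseteq> H \<Longrightarrow> H \<subseteq> E \<Longrightarrow> \<exists>xs' ys'. F H = xs' @ q # ys' \<and> set xs' \<subseteq> set L1" by blast
  from robust_split[OF f[OF qin] q] obtain U' where U': "U' \<subseteq> E" "finite U'" "card U' \<le> l"
      "\<And>H. U' \<subseteq> H \<Longrightarrow> H \<subseteq> E \<Longrightarrow> \<exists>xs' ys'. f H q = xs' @ y # ys' \<and> set xs' \<subseteq> set us" by blast
  let ?goal = "\<lambda>U. \<forall>H. U \<subseteq> H \<longrightarrow> H \<subseteq> E \<longrightarrow>
             (\<exists>xs' ys'. concat (map (f H) (F H)) = xs' @ y # ys' \<and> set xs' \<subseteq> set xs)"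
  have "?goal (U \<union> U')"
  proof (intro allI impI)
    fix H assume H: "U \<union> U' \<subseteq> H" "H \<subseteq> E"
    obtain xs1 ys1 where 1: "F H = xs1 @ q # ys1" "set xs1 \<subseteq> set L1" using U(4)[OF _ H(2)] H(1) by auto
    obtain xs2 ys2 where 2: "f H q = xs2 @ y # ys2" "set xs2 \<subseteq> set us" using U'(4)[OF _ H(2)] H(1) by auto
    have m: "set (f H x) \<subseteq> set (f E x)" if "x \<in> set xs1" for x
    proof (rule robust_set_mono[OF f H(2)])
      show "x \<in> set (F E)" using that 1(2) L by auto
    qed
    have "set (concat (map (f H) xs1)) \<subseteq> set (concat (map (f E) L1))"
      unfolding set_concat set_map image_image using 1(2) m by (rule UN_mono)
    then have "concat (map (f H) (F H)) = (concat (map (f H) xs1) @ xs2) @ y # (ys2 @ concat (map (f H) ys1)) \<and>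
        set (concat (map (f H) xs1) @ xs2) \<subseteq> set xs"
      unfolding 1(1) xs using 2 by auto
    then show "\<exists>xs' ys'. concat (map (f H) (F H)) = xs' @ y # ys' \<and> set xs' \<subseteq> set xs" by blast
  qed
  moreover have "card (U \<union> U') \<le> k + l" using U(3) U'(3) card_Un_le[of U U'] by linarith
  moreover have "U \<union> U' \<subseteq> E" "finite (U \<union> U')" using U(1,2) U'(1,2) by simp_all
  ultimately show "\<exists>U\<subseteq>E. finite U \<and> card U \<le> k + l \<and> ?goal U" by (intro exI[of _ "U \<union> U'"] conjI)
qed

text \<open>The budgets do not add, because an occurrence lies in one of the two lists. This is
  \<open>robust_concat_map\<close> over a list that does not depend on the graph and so costs
  0.\<close>

lemma robust_append:
  assumes "robust k F E" "robust k G E"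
  shows "robust k (\<lambda>E. F E @ G E) E"
proof -
  have "robust (0 + k) (\<lambda>E. concat (map (\<lambda>b. if b then F E else G E) [True, False])) E"
  proof (rule robust_concat_map[OF robust_const])
    fix b show "robust k (\<lambda>E. if b then F E else G E) E" using assms by (cases b) simp_all
  qed
  then show ?thesis by simp
qed

lemma filter_eq_append_ConsD:
  "filter P L = us @ i # vs \<Longrightarrow> \<exists>L1 L2. L = L1 @ i # L2 \<and> us = filter P L1 \<and> P i"
proof (induction L arbitrary: us)
  case (Cons a L)
  show ?case
  proof (cases "P a \<and> us = []")
    case True
    then show ?thesis using Cons.prems by (intro exI[of _ "[]"] exI[of _ L]) auto
  next
    case False
    then obtain us' where us': "filter P L = us' @ i # vs" "us = (if P a then a # us' else us')"
      using Cons.prems by (cases us) (auto split: if_splits)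
    from Cons.IH[OF us'(1)] obtain L1 L2 where "L = L1 @ i # L2" "us' = filter P L1" "P i" by blast
    then show ?thesis using us'(2) by (intro exI[of _ "a # L1"] exI[of _ L2]) auto
  qed
qed simp

lemma robust_map_filter:
  "robust 1 (\<lambda>E. map g (filter (\<lambda>i. e i \<in> E) L)) E"
  unfolding robust_def
proof (intro conjI allI impI)
  fix xs y ys assume "map g (filter (\<lambda>i. e i \<in> E) L) = xs @ y # ys"
  then obtain us i vs where us: "filter (\<lambda>i. e i \<in> E) L = us @ i # vs" "xs = map g us" "g i = y"
    by (auto simp: map_eq_append_conv map_eq_Cons_conv)
  obtain L1 L2 where L: "L = L1 @ i # L2" "us = filter (\<lambda>i. e i \<in> E) L1" "e i \<in> E"
    using filter_eq_append_ConsD[OF us(1)] by blast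
  show "\<exists>U\<subseteq>E. finite U \<and> card U \<le> 1 \<and>
           (\<forall>H. U \<subseteq> H \<longrightarrow> H \<subseteq> E \<longrightarrow>
             (\<exists>xs' ys'. map g (filter (\<lambda>i. e i \<in> H) L) = xs' @ y # ys' \<and> set xs' \<subseteq> set xs))"
    using L us
    by (intro exI[of _ "{e i}"] conjI allI impI exI[of _ "map g (filter (\<lambda>i. e i \<in> _) L1)"]
          exI[of _ "map g (filter (\<lambda>i. e i \<in> _) L2)"]) auto
qed auto

text \<open>Filtering commutes with sorting, and the sorted list of all indices does not depend on
  the edges. A given rotation then needs only the edge to its pivot.\<close>

lemma robust_end_rotations: "robust 1 (\<lambda>E. end_rotations E P) E"
proof -
  have "(\<lambda>E. end_rotations E P) = (\<lambda>E. map (\<lambda>i. take i P @ rev (drop i P))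
       (filter (\<lambda>i. {last P, P ! (i - 1)} \<in> E) (sort_key (\<lambda>i. P ! (i - 1)) [2..<length P - 1])))"
    by (simp add: end_rotations_def filter_sort)
  then show ?thesis by (simp only: robust_map_filter)
qed

lemma robust_rotations: "robust 1 (\<lambda>E. rotations E P) E"
  unfolding rotations_def Let_def by (intro robust_append robust_end_rotations)

lemma bfs_level_Suc: "bfs_level E P (Suc j) = concat (map (rotations E) (bfs_level E P j))"
  by (simp add: bfs_level_def)

text \<open>A path at depth \<open>j\<close> results from \<open>j\<close> rotations, each of which
  needs one edge; other edges inspected by the search need not survive.\<close>

lemma robust_bfs_level: "robust j (\<lambda>E. bfs_level E P j) E"
proof (induction j)
  case 0
  then show ?case using robust_const[of 0 "[P]" E] by (simp add: bfs_level_def)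
next
  case (Suc j)
  show ?case using robust_concat_map[OF Suc robust_rotations] by (simp add: bfs_level_Suc)
qed

lemma robust_mono:
  assumes "robust k F E" "k \<le> l"
  shows "robust l F E"
  unfolding robust_def
proof (intro conjI allI impI)
  fix xs y ys assume "F E = xs @ y # ys"
  from robust_split[OF assms(1) this] obtain U where "U \<subseteq> E" "finite U" "card U \<le> k"
    "\<And>H. U \<subseteq> H \<Longrightarrow> H \<subseteq> E \<Longrightarrow> \<exists>xs' ys'. F H = xs' @ y # ys' \<and> set xs' \<subseteq> set xs" by blast
  then show "\<exists>U\<subseteq>E. finite U \<and> card U \<le> l \<and>
           (\<forall>H. U \<subseteq> H \<longrightarrow> H \<subseteq> E \<longrightarrow> (\<exists>xs' ys'. F H = xs' @ y # ys' \<and> set xs' \<subseteq> set xs))"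
    using assms(2) by (intro exI[of _ U]) simp
qed (rule robust_set_mono[OF assms(1)])

text \<open>A path is found in a single level, so the cost is the depth \<open>D\<close> and not a
  sum over levels. This keeps the edges used by a whole run at O(n T).\<close>

lemma robust_bfs_paths: "robust D (\<lambda>E. bfs_paths E D P) E"
proof -
  have "robust (0 + D) (\<lambda>E. concat (map (\<lambda>j. bfs_level E P j) [0..<D + 1])) E"
    by (rule robust_concat_map[OF robust_const]) (auto intro: robust_mono[OF robust_bfs_level])
  then show ?thesis unfolding bfs_paths_def by simp
qed

section \<open>Extensions and stages when edges are deleted\<close>

definition graph_on :: "nat \<Rightarrow> nat set set \<Rightarrow> bool" where
  "graph_on n E \<longleftrightarrow> (\<forall>e\<in>E. \<exists>u v. e = {u, v} \<and> u \<noteq> v \<and> u \<in> {1..n} \<and> v \<in> {1..n})"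

lemma graph_onD: "graph_on n E \<Longrightarrow> {u, v} \<in> E \<Longrightarrow> u \<noteq> v \<and> u \<in> {1..n} \<and> v \<in> {1..n}"
  unfolding graph_on_def by (fastforce simp: doubleton_eq_iff)

lemma finite_outside_nbrs: "graph_on n E \<Longrightarrow> finite (outside_nbrs E P v)"
  by (rule finite_subset[of _ "{1..n}"]) (auto simp: outside_nbrs_def dest: graph_onD)

lemma outside_nbrs_mono: "H \<subseteq> E \<Longrightarrow> outside_nbrs H P v \<subseteq> outside_nbrs E P v"
  by (auto simp: outside_nbrs_def)

lemma try_extend_Stuck_iff:
  "try_extend n E P = Stuck \<longleftrightarrow>
     (let Q = orient P in outside_nbrs E Q (hd Q) = {} \<and> outside_nbrs E Q (last Q) = {} \<and>
        (closable E Q \<longrightarrow> length Q \<noteq> n \<and> (\<forall>u\<in>set Q. outside_nbrs E Q u = {})))"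
  by (auto simp: try_extend_def Let_def)

lemma try_extend_Stuck_mono:
  assumes "H \<subseteq> E" "try_extend n E P = Stuck"
  shows "try_extend n H P = Stuck"
proof -
  have "closable H Q \<Longrightarrow> closable E Q" for Q using assms(1) by (auto simp: closable_def)
  then show ?thesis
    using assms(2) outside_nbrs_mono[OF assms(1)] unfolding try_extend_Stuck_iff Let_def by blast
qed

lemma Min_outside_nbrs_eq:
  assumes "graph_on n E" "H \<subseteq> E" "outside_nbrs E P v \<noteq> {}" "{v, Min (outside_nbrs E P v)} \<in> H"
  shows "Min (outside_nbrs H P v) = Min (outside_nbrs E P v)" "outside_nbrs H P v \<noteq> {}"
proof -
  have fin: "finite (outside_nbrs E P v)" using assms(1) by (rule finite_outside_nbrs)
  have in1: "Min (outside_nbrs E P v) \<in> outside_nbrs E P v" using fin assms(3) by (rule Min_in)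
  then have in2: "Min (outside_nbrs E P v) \<in> outside_nbrs H P v" using assms(4) by (simp add: outside_nbrs_def)
  then show "outside_nbrs H P v \<noteq> {}" by blast
  show "Min (outside_nbrs H P v) = Min (outside_nbrs E P v)"
    by (rule Min_eqI) (use in2 fin outside_nbrs_mono[OF assms(2)] in \<open>auto intro: finite_subset Min_le\<close>)
qed

lemma reopen_index:
  assumes "\<exists>u\<in>set Q. outside_nbrs E Q u \<noteq> {}"
  defines "i \<equiv> LEAST i. i < length Q \<and> outside_nbrs E Q (Q ! i) \<noteq> {}"
  shows "i < length Q" "outside_nbrs E Q (Q ! i) \<noteq> {}" "\<And>j. j < i \<Longrightarrow> outside_nbrs E Q (Q ! j) = {}"
    "hd (rotate i Q) = Q ! i"
proof -
  from assms(1) have "\<exists>i. i < length Q \<and> outside_nbrs E Q (Q ! i) \<noteq> {}" by (metis in_set_conv_nth)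
  then have *: "i < length Q \<and> outside_nbrs E Q (Q ! i) \<noteq> {}" unfolding i_def by (rule LeastI_ex)
  then show 1: "i < length Q" "outside_nbrs E Q (Q ! i) \<noteq> {}" by auto
  show "outside_nbrs E Q (Q ! j) = {}" if "j < i" for j
    using not_less_Least[OF that[unfolded i_def]] 1(1) that by auto
  have "Q \<noteq> []" using 1(1) by auto
  then show "hd (rotate i Q) = Q ! i" using 1(1) by (simp add: hd_rotate_conv_nth)
qed

lemma reopen_eq:
  assumes "graph_on n E" "H \<subseteq> E" "\<exists>u\<in>set Q. outside_nbrs E Q u \<noteq> {}"
  defines "i \<equiv> LEAST i. i < length Q \<and> outside_nbrs E Q (Q ! i) \<noteq> {}"
  assumes e: "{Q ! i, Min (outside_nbrs E Q (Q ! i))} \<in> H"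
  shows "reopen H Q = reopen E Q" "\<exists>u\<in>set Q. outside_nbrs H Q u \<noteq> {}"
proof -
  note i = reopen_index[OF assms(3), folded i_def]
  note M = Min_outside_nbrs_eq[OF assms(1,2) i(2) e]
  have L: "(LEAST i. i < length Q \<and> outside_nbrs H Q (Q ! i) \<noteq> {}) = i"
  proof (rule Least_equality)
    fix j assume "j < length Q \<and> outside_nbrs H Q (Q ! j) \<noteq> {}"
    then have "outside_nbrs E Q (Q ! j) \<noteq> {}" using outside_nbrs_mono[OF assms(2), of Q "Q ! j"] by blast
    then show "i \<le> j" using i(3)[of j] not_le by blast
  qed (use i M in auto)
  show "\<exists>u\<in>set Q. outside_nbrs H Q u \<noteq> {}" using i(1) M(2) by (metis nth_mem)
  show "reopen H Q = reopen E Q"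
    unfolding reopen_def L i_def[symmetric] using i(4) M(1) by (simp add: Let_def)
qed

text \<open>The neighbourhood tests that fail in \<open>E\<close> report missing edges, so they also
  fail in a subgraph. Only the edge to the chosen outside neighbour must survive, and in addition
  the closing edge when a cycle is reopened.\<close>

lemma try_extend_robust:
  assumes G: "graph_on n E" and R: "try_extend n E P = Longer P'"
  shows "\<exists>U\<subseteq>E. finite U \<and> card U \<le> 2 \<and> (\<forall>H. U \<subseteq> H \<longrightarrow> H \<subseteq> E \<longrightarrow> try_extend n H P = Longer P')"
proof -
  define Q where "Q = orient P"
  have minin: "{v, Min (outside_nbrs E Q v)} \<in> E" if "outside_nbrs E Q v \<noteq> {}" for v
    using Min_in[OF finite_outside_nbrs[OF G] that] by (simp add: outside_nbrs_def)
  note te = try_extend_def[of n _ P, folded Q_def, unfolded Let_def]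
  consider (1) "outside_nbrs E Q (hd Q) \<noteq> {}"
    | (2) "outside_nbrs E Q (hd Q) = {}" "outside_nbrs E Q (last Q) \<noteq> {}"
    | (3) "outside_nbrs E Q (hd Q) = {}" "outside_nbrs E Q (last Q) = {}"
      "closable E Q" "length Q \<noteq> n" "\<exists>u\<in>set Q. outside_nbrs E Q u \<noteq> {}"
    using R by (auto simp: te split: if_splits)
  then show ?thesis
  proof cases
    case 1
    then have P': "P' = Min (outside_nbrs E Q (hd Q)) # Q" using R by (simp add: te)
    let ?U = "{{hd Q, Min (outside_nbrs E Q (hd Q))}}"
    have "try_extend n H P = Longer P'" if H: "?U \<subseteq> H" "H \<subseteq> E" for H
    proof -
      have "{hd Q, Min (outside_nbrs E Q (hd Q))} \<in> H" using H(1) by simp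
      from Min_outside_nbrs_eq[OF G H(2) 1 this] show ?thesis by (simp add: te P')
    qed
    moreover have "?U \<subseteq> E" "finite ?U" "card ?U \<le> 2" using minin[OF 1] by simp_all
    ultimately show ?thesis by (intro exI[of _ ?U]) simp
  next
    case 2
    then have P': "P' = Q @ [Min (outside_nbrs E Q (last Q))]" using R by (simp add: te)
    let ?U = "{{last Q, Min (outside_nbrs E Q (last Q))}}"
    have "try_extend n H P = Longer P'" if H: "?U \<subseteq> H" "H \<subseteq> E" for H
    proof -
      have "{last Q, Min (outside_nbrs E Q (last Q))} \<in> H" using H(1) by simp
      moreover have "outside_nbrs H Q (hd Q) = {}" using 2(1) outside_nbrs_mono[OF H(2)] by blast
      ultimately show ?thesis using Min_outside_nbrs_eq[OF G H(2) 2(2)] by (simp add: te P')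
    qed
    moreover have "?U \<subseteq> E" "finite ?U" "card ?U \<le> 2" using minin[OF 2(2)] by simp_all
    ultimately show ?thesis by (intro exI[of _ ?U]) simp
  next
    case 3
    then have P': "P' = reopen E Q" using R by (simp add: te)
    define i where "i = (LEAST i. i < length Q \<and> outside_nbrs E Q (Q ! i) \<noteq> {})"
    define U where "U = {{hd Q, last Q}, {Q ! i, Min (outside_nbrs E Q (Q ! i))}}"
    have "try_extend n H P = Longer P'" if H: "U \<subseteq> H" "H \<subseteq> E" for H
    proof -
      have "outside_nbrs H Q (hd Q) = {}" "outside_nbrs H Q (last Q) = {}"
        using 3(1,2) outside_nbrs_mono[OF H(2)] by blast+
      moreover have "closable H Q" using 3(3) H(1) by (auto simp: closable_def U_def)
      moreover have "reopen H Q = reopen E Q" "\<exists>u\<in>set Q. outside_nbrs H Q u \<noteq> {}"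
        using reopen_eq[OF G H(2) 3(5)] H(1) by (auto simp: U_def i_def)
      ultimately show ?thesis using 3(4) P' by (simp add: te)
    qed
    moreover have "U \<subseteq> E" using 3(3) minin[OF reopen_index(2)[OF 3(5)]] by (auto simp: U_def closable_def i_def)
    moreover have "finite U" "card U \<le> 2" by (auto simp: U_def card_insert_if)
    ultimately show ?thesis by (intro exI[of _ U]) simp
  qed
qed

lemma find_append_Cons: "\<forall>x\<in>set xs. \<not> P x \<Longrightarrow> P y \<Longrightarrow> find P (xs @ y # ys) = Some y"
  by (induction xs) auto

lemma find_eq_SomeD: "find P L = Some y \<Longrightarrow> \<exists>xs ys. L = xs @ y # ys \<and> P y \<and> (\<forall>x\<in>set xs. \<not> P x)"
proof (induction L)
  case (Cons a L)
  show ?case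
  proof (cases "P a")
    case True
    with Cons show ?thesis by (intro exI[of _ "[]"] exI[of _ L]) auto
  next
    case False
    with Cons obtain xs ys where "L = xs @ y # ys \<and> P y \<and> (\<forall>x\<in>set xs. \<not> P x)" by auto
    with False show ?thesis by (intro exI[of _ "a # xs"] exI[of _ ys]) auto
  qed
qed simp

text \<open>\<open>D\<close> edges keep the path \<open>Q\<close> that was extended in the search.
  Everything in front of it was already in front of it in \<open>E\<close>, hence stuck there and
  stuck in the subgraph, so \<open>find\<close> still stops at \<open>Q\<close>; two more edges
  preserve its extension.\<close>

lemma ham_stage_robust:
  assumes G: "graph_on n E" and R: "ham_stage n E D P = Longer P'"
  shows "\<exists>U\<subseteq>E. finite U \<and> card U \<le> D + 2 \<and> (\<forall>H. U \<subseteq> H \<longrightarrow> H \<subseteq> E \<longrightarrow> ham_stage n H D P = Longer P')"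
proof -
  from R obtain Q where Q: "find (\<lambda>Q. try_extend n E Q \<noteq> Stuck) (bfs_paths E D P) = Some Q"
      "try_extend n E Q = Longer P'"
    by (auto simp: ham_stage_def split: option.splits)
  from find_eq_SomeD[OF Q(1)] obtain xs ys where xs: "bfs_paths E D P = xs @ Q # ys"
      "\<forall>x\<in>set xs. try_extend n E x = Stuck" by auto
  from robust_split[OF robust_bfs_paths xs(1)] obtain U where U: "U \<subseteq> E" "finite U" "card U \<le> D"
    "\<And>H. U \<subseteq> H \<Longrightarrow> H \<subseteq> E \<Longrightarrow> \<exists>xs' ys'. bfs_paths H D P = xs' @ Q # ys' \<and> set xs' \<subseteq> set xs" by blast
  from try_extend_robust[OF G Q(2)] obtain U' where U': "U' \<subseteq> E" "finite U'" "card U' \<le> 2"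
    "\<And>H. U' \<subseteq> H \<Longrightarrow> H \<subseteq> E \<Longrightarrow> try_extend n H Q = Longer P'" by blast
  show ?thesis
  proof (intro exI[of _ "U \<union> U'"] conjI allI impI)
    show "card (U \<union> U') \<le> D + 2" using U(3) U'(3) card_Un_le[of U U'] by linarith
    fix H assume H: "U \<union> U' \<subseteq> H" "H \<subseteq> E"
    obtain xs' ys' where xs': "bfs_paths H D P = xs' @ Q # ys'" "set xs' \<subseteq> set xs" using U(4) H by blast
    have t: "try_extend n H Q = Longer P'" using U'(4) H by blast
    have "find (\<lambda>Q. try_extend n H Q \<noteq> Stuck) (bfs_paths H D P) = Some Q"
      unfolding xs'(1)
    proof (rule find_append_Cons)
      show "\<forall>x\<in>set xs'. \<not> try_extend n H x \<noteq> Stuck"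
        using xs'(2) xs(2) try_extend_Stuck_mono[OF H(2)] by blast
    qed (simp add: t)
    with t show "ham_stage n H D P = Longer P'" by (simp only: ham_stage_def option.case)
  qed (use U U' in auto)
qed

lemma ham_path_robust:
  assumes G: "graph_on n E" and "ham_path n E D k P"
  shows "\<exists>U\<subseteq>E. finite U \<and> card U \<le> k * (D + 2) \<and> (\<forall>H. U \<subseteq> H \<longrightarrow> H \<subseteq> E \<longrightarrow> ham_path n H D k P)"
  using assms(2)
proof (induction rule: ham_path.induct)
  case start
  show ?case by (intro exI[of _ "{}"] conjI allI impI ham_path.start) simp_all
next
  case (step k P P')
  then obtain U where U: "U \<subseteq> E" "finite U" "card U \<le> k * (D + 2)"
    "\<And>H. U \<subseteq> H \<Longrightarrow> H \<subseteq> E \<Longrightarrow> ham_path n H D k P" by blast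
  from ham_stage_robust[OF G step.hyps(2)] obtain U' where U': "U' \<subseteq> E" "finite U'" "card U' \<le> D + 2"
    "\<And>H. U' \<subseteq> H \<Longrightarrow> H \<subseteq> E \<Longrightarrow> ham_stage n H D P = Longer P'" by blast
  show ?case
  proof (intro exI[of _ "U \<union> U'"] conjI allI impI)
    show "card (U \<union> U') \<le> Suc k * (D + 2)" using U(3) U'(3) card_Un_le[of U U'] by simp
    fix H assume H: "U \<union> U' \<subseteq> H" "H \<subseteq> E"
    then have "ham_path n H D k P" "ham_stage n H D P = Longer P'" using U(4) U'(4) by blast+
    then show "ham_path n H D (Suc k) P'" by (rule ham_path.step)
  qed (use U(1,2) U'(1,2) in auto)
qed

section \<open>The run is deterministic\<close>

lemma ham_path_pos: "ham_path n E D k P \<Longrightarrow> k \<ge> 1"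
  by (induction rule: ham_path.induct) auto

lemma ham_path_Suc:
  assumes "ham_path n E D k P" "k \<noteq> 1"
  shows "\<exists>j Q. k = Suc j \<and> ham_path n E D j Q \<and> ham_stage n E D Q = Longer P"
  using assms by (cases rule: ham_path.cases) auto

lemma ham_path_1: "ham_path n E D k P \<Longrightarrow> k = 1 \<Longrightarrow> P = [1]"
proof (induction rule: ham_path.induct)
  case (step k P P')
  then show ?case using ham_path_pos[OF step.hyps(1)] by simp
qed simp

lemma ham_path_functional: "ham_path n E D k P \<Longrightarrow> ham_path n E D k P' \<Longrightarrow> P = P'"
proof (induction arbitrary: P' rule: ham_path.induct)
  case start
  then show ?case using ham_path_1[OF start] by simp
next
  case (step k P P1)
  have "Suc k \<noteq> 1" using ham_path_pos[OF step.hyps(1)] by simp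
  then obtain P2 where P2: "ham_path n E D k P2" "ham_stage n E D P2 = Longer P'"
    using ham_path_Suc[OF step.prems] by auto
  then have "P = P2" using step.IH by simp
  then show ?case using P2(2) step.hyps(2) by simp
qed

lemma ham_path_below:
  "ham_path n E D k P \<Longrightarrow> 1 \<le> j \<Longrightarrow> j < k \<Longrightarrow> \<exists>Q. ham_path n E D j Q \<and> ham_stage n E D Q \<noteq> Stuck"
proof (induction rule: ham_path.induct)
  case (step k P P1)
  show ?case
  proof (cases "j < k")
    case False
    then have "j = k" using step.prems by simp
    then show ?thesis using step.hyps by (intro exI[of _ P]) simp
  qed (use step in simp)
qed simp

text \<open>The failing stage is a function of the graph. Once the thinned graph is fixed, the
  failing path is fixed too, and no union bound over stages and paths is needed.\<close>

lemma ham_stuck_unique: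
  assumes "ham_path n E D k P" "ham_stage n E D P = Stuck" "ham_path n E D k' P'" "ham_stage n E D P' = Stuck"
  shows "P = P'"
proof -
  have no: False if "ham_path n E D i Q" "ham_stage n E D Q = Stuck" "ham_path n E D j R" "i < j" for i j Q R
  proof -
    from ham_path_below[OF that(3) ham_path_pos[OF that(1)] that(4)]
    obtain Q' where "ham_path n E D i Q'" "ham_stage n E D Q' \<noteq> Stuck" by blast
    then show False using ham_path_functional[OF that(1)] that(2) by auto
  qed
  have "k = k'"
    using no[OF assms(1,2,3)] no[OF assms(3,4,1)] by (meson linorder_neqE_nat)
  then show ?thesis using ham_path_functional[OF assms(1)] assms(3) by simp
qed

lemma ham_stage_Stuck_iff:
  "ham_stage n E D P = Stuck \<longleftrightarrow> (\<forall>Q\<in>set (bfs_paths E D P). try_extend n E Q = Stuck)"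
proof
  assume "ham_stage n E D P = Stuck"
  then have "find (\<lambda>Q. try_extend n E Q \<noteq> Stuck) (bfs_paths E D P) = None"
    by (auto simp: ham_stage_def split: option.splits dest!: find_eq_SomeD)
  then show "\<forall>Q\<in>set (bfs_paths E D P). try_extend n E Q = Stuck" by (auto simp: find_None_iff)
next
  assume "\<forall>Q\<in>set (bfs_paths E D P). try_extend n E Q = Stuck"
  then have "find (\<lambda>Q. try_extend n E Q \<noteq> Stuck) (bfs_paths E D P) = None" by (auto simp: find_None_iff)
  then show "ham_stage n E D P = Stuck" by (simp add: ham_stage_def)
qed

lemma bfs_paths_mono: "H \<subseteq> E \<Longrightarrow> set (bfs_paths H D P) \<subseteq> set (bfs_paths E D P)"
  using robust_set_mono[OF robust_bfs_paths] .

text \<open>A subgraph offers fewer rotations and fewer extensions. This transfers failure from the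
  full graph to the thinned one.\<close>

lemma ham_stage_Stuck_mono:
  assumes "H \<subseteq> E" "ham_stage n E D P = Stuck"
  shows "ham_stage n H D P = Stuck"
  using assms bfs_paths_mono[OF assms(1)] try_extend_Stuck_mono[OF assms(1)]
  unfolding ham_stage_Stuck_iff by blast

section \<open>Rotations\<close>

fun path_edges :: "nat list \<Rightarrow> nat set set" where
  "path_edges (x # y # zs) = insert {x, y} (path_edges (y # zs))"
| "path_edges _ = {}"

lemma path_edges_append:
  "xs \<noteq> [] \<Longrightarrow> ys \<noteq> [] \<Longrightarrow>
     path_edges (xs @ ys) = path_edges xs \<union> {{last xs, hd ys}} \<union> path_edges ys"
proof (induction xs rule: path_edges.induct)
  case ("2_2" v)
  then show ?case by (cases ys) auto
qed auto

lemma path_edges_rev: "path_edges (rev xs) = path_edges xs"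
proof (induction xs rule: path_edges.induct)
  case (1 x y zs)
  have "path_edges (rev (x # y # zs)) = path_edges (rev (y # zs) @ [x])" by simp
  also have "\<dots> = path_edges (rev (y # zs)) \<union> {{last (rev (y # zs)), x}}"
    by (subst path_edges_append) auto
  also have "last (rev (y # zs)) = y" by (simp add: last_rev)
  finally show ?case using 1 by (auto simp: insert_commute)
qed auto

lemma path_edges_subset: "e \<in> path_edges xs \<Longrightarrow> e \<subseteq> set xs"
  by (induction xs rule: path_edges.induct) auto

definition is_path :: "nat \<Rightarrow> nat set set \<Rightarrow> nat list \<Rightarrow> bool" where
  "is_path n E P \<longleftrightarrow> P \<noteq> [] \<and> distinct P \<and> set P \<subseteq> {1..n} \<and> path_edges P \<subseteq> E"

lemma path_neighbours_interior:
  assumes "distinct Q" "Q = as @ u # x # v # bs"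
  shows "{x, y} \<in> path_edges Q \<longleftrightarrow> y = u \<or> y = v"
proof -
  have "path_edges Q = path_edges (as @ [u]) \<union> {{u, x}, {x, v}} \<union> path_edges (v # bs)"
    using path_edges_append[of "as @ [u]" "x # v # bs"] assms(2) by auto
  moreover have "{x, y} \<notin> path_edges (as @ [u])" "{x, y} \<notin> path_edges (v # bs)"
    using path_edges_subset[of "{x, y}" "as @ [u]"] path_edges_subset[of "{x, y}" "v # bs"] assms by auto
  ultimately show ?thesis using assms by (auto simp: doubleton_eq_iff)
qed

lemma interior_split:
  assumes "x \<in> set Q" "x \<noteq> hd Q" "x \<noteq> last Q"
  obtains as u v bs where "Q = as @ u # x # v # bs"
proof -
  obtain as bs where Q: "Q = as @ x # bs" using assms(1) by (meson split_list)
  have "as \<noteq> []" using assms(2) Q by auto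
  then obtain as' u where as: "as = as' @ [u]" by (metis rev_exhaust)
  have "bs \<noteq> []" using assms(3) Q by auto
  then obtain v bs' where "bs = v # bs'" by (metis neq_Nil_conv)
  with Q as that show ?thesis by auto
qed

definition rot :: "nat set set \<Rightarrow> nat list \<Rightarrow> nat list \<Rightarrow> bool" where
  "rot E P P' \<longleftrightarrow> (\<exists>i. 2 \<le> i \<and> i < length P - 1 \<and> {last P, P ! (i - 1)} \<in> E \<and>
     P' = take i P @ rev (drop i P))"

lemma rot_iff: "rot E P P' \<longleftrightarrow> P' \<in> set (end_rotations E P)"
  by (auto simp: rot_def end_rotations_def)

lemma rot_split:
  assumes "rot E P P'"
  obtains A B where "P = A @ B" "P' = A @ rev B" "A \<noteq> []" "B \<noteq> []" "{last P, last A} \<in> E" "length A \<ge> 2"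
proof -
  from assms obtain i where i: "2 \<le> i" "i < length P - 1" "{last P, P ! (i - 1)} \<in> E"
     "P' = take i P @ rev (drop i P)" by (auto simp: rot_def)
  have "last (take i P) = P ! (i - 1)" using i by (subst last_conv_nth) auto
  then show ?thesis using i by (intro that[of "take i P" "drop i P"]) auto
qed

lemma rot_intro:
  assumes "P = as @ u # x # v # bs" "bs \<noteq> []" "{last P, x} \<in> E"
  shows "rot E P (as @ u # x # rev (v # bs))"
  unfolding rot_def
  by (intro exI[of _ "length as + 2"]) (use assms in \<open>auto simp: nth_append\<close>)

lemma rot_is_path:
  assumes "rot E P P'" "is_path n E P"
  shows "is_path n E P'" "set P' = set P" "hd P' = hd P"
proof -
  from rot_split[OF assms(1)] obtain A B where AB: "P = A @ B" "P' = A @ rev B" "A \<noteq> []" "B \<noteq> []"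
    "{last P, last A} \<in> E" by metis
  have "path_edges P' \<subseteq> E"
    using assms(2) AB path_edges_append[of A B] path_edges_append[of A "rev B"]
    by (auto simp: is_path_def path_edges_rev hd_rev insert_commute)
  then show "is_path n E P'" "set P' = set P" "hd P' = hd P"
    using assms(2) AB by (auto simp: is_path_def)
qed

text \<open>Only the last vertex is rotated and the first one stays fixed, which is the setting of
  Posa's lemma. HAM rotates at both ends; \<open>reach_bfs_level\<close> embeds these paths into its
  search.\<close>

fun reach :: "nat set set \<Rightarrow> nat list \<Rightarrow> nat \<Rightarrow> nat list set" where
  "reach E P 0 = {P}"
| "reach E P (Suc t) = reach E P t \<union> {Q'. \<exists>Q\<in>reach E P t. rot E Q Q'}"

definition ends :: "nat set set \<Rightarrow> nat list \<Rightarrow> nat \<Rightarrow> nat set" where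
  "ends E P t = last ` reach E P t"

lemma reach_mono: "s \<le> t \<Longrightarrow> reach E P s \<subseteq> reach E P t"
  by (induction t) (auto simp: le_Suc_eq)

lemma ends_mono: "s \<le> t \<Longrightarrow> ends E P s \<subseteq> ends E P t"
  unfolding ends_def using reach_mono by (intro image_mono)

lemma reach_is_path:
  assumes "is_path n E P" "Q \<in> reach E P t"
  shows "is_path n E Q \<and> set Q = set P \<and> hd Q = hd P"
  using assms(2)
proof (induction t arbitrary: Q)
  case (Suc t)
  show ?case
  proof (cases "Q \<in> reach E P t")
    case False
    then obtain R where "R \<in> reach E P t" "rot E R Q" using Suc.prems by auto
    then show ?thesis using Suc.IH[of R] rot_is_path[of E R Q n] by simp
  qed (rule Suc.IH)
qed (simp add: assms(1))

lemma ends_subset: "is_path n E P \<Longrightarrow> ends E P t \<subseteq> set P"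
proof
  fix x assume "is_path n E P" "x \<in> ends E P t"
  then obtain Q where Q: "Q \<in> reach E P t" "x = last Q" by (auto simp: ends_def)
  then show "x \<in> set P" using reach_is_path[OF \<open>is_path n E P\<close> Q(1)] last_in_set[of Q] by (auto simp: is_path_def)
qed

lemma rotations_of_rot:
  assumes "rot E Q Q'" "Q0 = Q \<or> Q0 = rev Q"
  shows "Q' \<in> set (rotations E Q0)"
proof -
  have "orient Q0 = Q \<or> rev (orient Q0) = Q" using assms(2) by (auto simp: orient_def)
  then show ?thesis using assms(1) by (auto simp: rotations_def Let_def rot_iff)
qed

lemma bfs_level_rot:
  assumes "Q \<in> set (bfs_level E P j) \<or> rev Q \<in> set (bfs_level E P j)" "rot E Q Q'"
  shows "Q' \<in> set (bfs_level E P (Suc j))"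
  using assms(1)
proof
  assume "Q \<in> set (bfs_level E P j)"
  then show ?thesis using rotations_of_rot[OF assms(2), of Q] by (auto simp: bfs_level_Suc)
next
  assume "rev Q \<in> set (bfs_level E P j)"
  then show ?thesis using rotations_of_rot[OF assms(2), of "rev Q"] by (auto simp: bfs_level_Suc)
qed

text \<open>HAM lists a path from its smaller endpoint, so it may meet the path reversed; as it
  rotates at both ends, the next rotation is available in either orientation.\<close>

lemma reach_bfs_level:
  assumes "P \<in> set (bfs_level E P0 j) \<or> rev P \<in> set (bfs_level E P0 j)" "Q \<in> reach E P t"
  shows "\<exists>i\<le>j + t. Q \<in> set (bfs_level E P0 i) \<or> rev Q \<in> set (bfs_level E P0 i)"
  using assms(2)
proof (induction t arbitrary: Q)
  case 0
  then show ?case using assms(1) by auto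
next
  case (Suc t)
  show ?case
  proof (cases "Q \<in> reach E P t")
    case True
    from Suc.IH[OF True] obtain i where "i \<le> j + t" "Q \<in> set (bfs_level E P0 i) \<or> rev Q \<in> set (bfs_level E P0 i)"
      by blast
    then show ?thesis by (intro exI[of _ i]) auto
  next
    case False
    then obtain R where R: "R \<in> reach E P t" "rot E R Q" using Suc.prems by auto
    from Suc.IH[OF R(1)] obtain i where "i \<le> j + t" "R \<in> set (bfs_level E P0 i) \<or> rev R \<in> set (bfs_level E P0 i)"
      by blast
    then show ?thesis using bfs_level_rot[OF _ R(2)] by (intro exI[of _ "Suc i"]) auto
  qed
qed

lemma bfs_level_bfs_paths: "i \<le> D \<Longrightarrow> Q \<in> set (bfs_level E P i) \<Longrightarrow> Q \<in> set (bfs_paths E D P)"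
  unfolding bfs_paths_def set_concat set_map by (rule UN_I[of "bfs_level E P i"]) (auto intro!: image_eqI[of _ _ i] simp del: upt_Suc)

text \<open>Rotating one end \<open>s\<close> times and then the other end \<open>t\<close> times
  fits into depth \<open>s + t\<close>. With \<open>s = t = T\<close> this explains why HAM searches
  to a depth of at least \<open>2 * T\<close>.\<close>

lemma reach_rev_bfs_paths:
  assumes "Q \<in> reach E P s" "R \<in> reach E (rev Q) t" "s + t \<le> D"
  shows "R \<in> set (bfs_paths E D P) \<or> rev R \<in> set (bfs_paths E D P)"
proof -
  have "P \<in> set (bfs_level E P 0)" by (simp add: bfs_level_def)
  with reach_bfs_level[OF _ assms(1), of P 0] obtain i where i: "i \<le> s"
    "Q \<in> set (bfs_level E P i) \<or> rev Q \<in> set (bfs_level E P i)" by auto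
  then have "rev Q \<in> set (bfs_level E P i) \<or> rev (rev Q) \<in> set (bfs_level E P i)" by auto
  from reach_bfs_level[OF this assms(2)] obtain l where "l \<le> i + t"
    "R \<in> set (bfs_level E P l) \<or> rev R \<in> set (bfs_level E P l)" by blast
  then show ?thesis using bfs_level_bfs_paths[of l D _ E P] i(1) assms(3) by auto
qed

lemma reach_bfs_paths:
  assumes "Q \<in> reach E P s" "s \<le> D"
  shows "Q \<in> set (bfs_paths E D P) \<or> rev Q \<in> set (bfs_paths E D P)"
  using reach_rev_bfs_paths[OF assms(1), of "rev Q" 0 D] assms(2) by auto

text \<open>A rotation deletes an edge at the new endpoint and adds one at the old endpoint.\<close>

lemma path_edges_reach:
  assumes "is_path n E P" "Q \<in> reach E P t" "e \<inter> ends E P t = {}"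
  shows "e \<in> path_edges Q \<longleftrightarrow> e \<in> path_edges P"
  using assms(2,3)
proof (induction t arbitrary: Q)
  case 0
  then show ?case by simp
next
  case (Suc t)
  have e: "e \<inter> ends E P t = {}" using Suc.prems(2) ends_mono[of t "Suc t" E P] by auto
  show ?case
  proof (cases "Q \<in> reach E P t")
    case True
    then show ?thesis using Suc.IH e by blast
  next
    case False
    then obtain R where R: "R \<in> reach E P t" "rot E R Q" using Suc.prems by auto
    from rot_split[OF R(2)] obtain A B where AB: "R = A @ B" "Q = A @ rev B" "A \<noteq> []" "B \<noteq> []" by metis
    have "last R \<in> ends E P (Suc t)" "last Q \<in> ends E P (Suc t)"
      using R(1) Suc.prems(1) by (auto simp: ends_def)
    then have "last B \<notin> e" "hd B \<notin> e" using Suc.prems(2) AB by (auto simp: last_rev)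
    then have "e \<in> path_edges Q \<longleftrightarrow> e \<in> path_edges R"
      using AB path_edges_append[of A B] path_edges_append[of A "rev B"]
      by (auto simp: path_edges_rev hd_rev)
    then show ?thesis using Suc.IH[OF R(1) e] by simp
  qed
qed

section \<open>Posa's lemma on the neighbours of endpoints\<close>

definition nbhd :: "nat set set \<Rightarrow> nat set \<Rightarrow> nat set" where
  "nbhd E S = {u. u \<notin> S \<and> (\<exists>v\<in>S. {v, u} \<in> E)}"

lemma nbhd_subset: "graph_on n E \<Longrightarrow> nbhd E S \<subseteq> {1..n}"
  unfolding nbhd_def by (auto dest: graph_onD)

lemma finite_nbhd: "graph_on n E \<Longrightarrow> finite (nbhd E S)"
  by (rule finite_subset[OF nbhd_subset]) auto

definition path_nbrs :: "nat list \<Rightarrow> nat set \<Rightarrow> nat set" where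
  "path_nbrs P X = {x. \<exists>y\<in>X. {x, y} \<in> path_edges P}"

lemma card_path_nbrs_single:
  assumes "distinct P"
  shows "finite {x. {x, y} \<in> path_edges P} \<and> card {x. {x, y} \<in> path_edges P} \<le> 2"
  using assms
proof (induction P rule: path_edges.induct)
  case (1 a b zs)
  let ?X = "{x. {x, y} \<in> path_edges (b # zs)}"
  show ?case
  proof (cases "y = a")
    case True
    have "{x, y} \<notin> path_edges (b # zs)" for x
      using path_edges_subset[of "{x, y}" "b # zs"] 1(2) True by auto
    then have "{x. {x, y} \<in> path_edges (a # b # zs)} = {b}" using True 1(2) by (auto simp: doubleton_eq_iff)
    then show ?thesis by simp
  next
    case F: False
    show ?thesis
    proof (cases "y = b")
      case True
      have "{x. {x, y} \<in> path_edges (b # zs)} \<subseteq> (if zs = [] then {} else {hd zs})"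
      proof (cases zs)
        case (Cons c zs')
        have "{x, y} \<notin> path_edges zs" for x
          using path_edges_subset[of "{x, y}" zs] 1(2) True by auto
        then show ?thesis using Cons True 1(2) by (auto simp: doubleton_eq_iff)
      qed simp
      then have "{x. {x, y} \<in> path_edges (a # b # zs)} \<subseteq> (if zs = [] then {a} else {a, hd zs})"
        using True F by (auto simp: doubleton_eq_iff split: if_splits)
      then have "{x. {x, y} \<in> path_edges (a # b # zs)} \<subseteq> {a, hd zs}" by (auto split: if_splits)
      moreover have "card {a, hd zs} \<le> 2" by (simp add: card_insert_if)
      ultimately show ?thesis
        using finite_subset[of "{x. {x, y} \<in> path_edges (a # b # zs)}" "{a, hd zs}"]
          card_mono[of "{a, hd zs}" "{x. {x, y} \<in> path_edges (a # b # zs)}"] by simp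
    next
      case False
      then have "{x. {x, y} \<in> path_edges (a # b # zs)} = ?X" using F by (auto simp: doubleton_eq_iff)
      then show ?thesis using 1 by simp
    qed
  qed
qed auto

lemma card_path_nbrs:
  assumes "distinct P" "finite X"
  shows "finite (path_nbrs P X)" "card (path_nbrs P X) \<le> 2 * card X"
proof -
  have eq: "path_nbrs P X = (\<Union>y\<in>X. {x. {x, y} \<in> path_edges P})" by (auto simp: path_nbrs_def)
  show "finite (path_nbrs P X)" unfolding eq by (rule finite_UN_I) (use assms card_path_nbrs_single in simp_all)
  have "card (path_nbrs P X) \<le> (\<Sum>y\<in>X. card {x. {x, y} \<in> path_edges P})"
    unfolding eq by (rule card_UN_le[OF assms(2)])
  also have "\<dots> \<le> (\<Sum>y\<in>X. 2)" by (rule sum_mono) (use assms card_path_nbrs_single in simp)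
  finally show "card (path_nbrs P X) \<le> 2 * card X" by simp
qed

text \<open>The consequence of being stuck that Posa's lemma needs, stated at the last vertex only;
  \<open>stuck_ends\<close> supplies it at both ends by reversal.\<close>

definition frozen :: "nat set set \<Rightarrow> nat list \<Rightarrow> bool" where
  "frozen E Q \<longleftrightarrow> outside_nbrs E Q (last Q) = {} \<and> {last Q, hd Q} \<notin> E"

text \<open>Let \<open>x\<close> be a neighbour of an endpoint and not an endpoint itself. Rotating
  at \<open>x\<close> cuts the edge from \<open>x\<close> to its successor \<open>v\<close> and
  makes \<open>v\<close> an endpoint. If \<open>{x, v}\<close> is an edge of \<open>P\<close>, this
  is the claim. If not, an edge of \<open>P\<close> at \<open>x\<close> has been exchanged before,
  and by \<open>path_edges_reach\<close> that happens only at endpoints.\<close>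

lemma posa:
  assumes G: "graph_on n E" and P: "is_path n E P"
    and fr: "\<And>Q. Q \<in> reach E P t \<Longrightarrow> frozen E Q" and C: "C \<subseteq> ends E P t"
  shows "nbhd E C \<subseteq> path_nbrs P (ends E P (Suc t)) \<union> ends E P t"
proof
  fix x assume x: "x \<in> nbhd E C"
  let ?S = "ends E P t" and ?S' = "ends E P (Suc t)"
  have mono: "?S \<subseteq> ?S'" by (rule ends_mono) simp
  show "x \<in> path_nbrs P ?S' \<union> ?S"
  proof (cases "x \<in> ?S")
    case xS: False
    from x C obtain Q where Q: "Q \<in> reach E P t" "{last Q, x} \<in> E" by (auto simp: nbhd_def ends_def)
    note Qp = reach_is_path[OF P Q(1)]
    note fQ = fr[OF Q(1), unfolded frozen_def outside_nbrs_def]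
    have xQ: "x \<in> set Q" using fQ Q(2) by auto
    have xh: "x \<noteq> hd Q" using fQ Q(2) by auto
    have xl: "x \<noteq> last Q" using xS Q(1) by (auto simp: ends_def)
    obtain as u v bs where Qs: "Q = as @ u # x # v # bs" using interior_split[OF xQ xh xl] by blast
    \<comment> \<open>If \<open>v\<close> is already the last vertex, its predecessor is not an
      admissible pivot; but then \<open>v\<close> is an endpoint anyway.\<close>
    have v: "v \<in> ?S'"
    proof (cases "bs = []")
      case True
      then have "v = last Q" using Qs by simp
      then show ?thesis using Q(1) mono by (auto simp: ends_def)
    next
      case False
      have "as @ u # x # rev (v # bs) \<in> reach E P (Suc t)" using rot_intro[OF Qs False Q(2)] Q(1) by auto
      moreover have "last (as @ u # x # rev (v # bs)) = v" by simp
      ultimately show ?thesis unfolding ends_def by (metis image_eqI)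
    qed
    show ?thesis
    proof (cases "{x, v} \<in> path_edges P")
      case True
      then show ?thesis using v by (auto simp: path_nbrs_def)
    next
      case nP: False
      have dQ: "distinct Q" using Qp by (simp add: is_path_def)
      note nQ = path_neighbours_interior[OF dQ Qs]
      have vS: "v \<in> ?S"
        using nP path_edges_reach[OF P Q(1), of "{x, v}"] nQ[of v] xS by auto
      have "P \<in> reach E P t" using reach_mono[of 0 t E P] by auto
      then have "x \<noteq> last P" using xS by (auto simp: ends_def)
      then obtain as' u' v' bs' where Ps: "P = as' @ u' # x # v' # bs'"
        using interior_split[of x P] xQ Qp xh by (metis (no_types, lifting))
      have dP: "distinct P" using P by (simp add: is_path_def)
      note nP' = path_neighbours_interior[OF dP Ps]
      \<comment> \<open>Otherwise both edges of \<open>P\<close> at \<open>x\<close> survive in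
        \<open>Q\<close>, so \<open>u'\<close> and \<open>v'\<close> are the two neighbours of
        \<open>x\<close> there, and one of them is the endpoint \<open>v\<close>.\<close>
      have "u' \<in> ?S \<or> v' \<in> ?S"
      proof (rule ccontr)
        assume no: "\<not> (u' \<in> ?S \<or> v' \<in> ?S)"
        then have "{x, u'} \<in> path_edges Q" "{x, v'} \<in> path_edges Q"
          using path_edges_reach[OF P Q(1), of "{x, u'}"] path_edges_reach[OF P Q(1), of "{x, v'}"] nP' xS by auto
        then have "u' \<in> {u, v}" "v' \<in> {u, v}" "u' \<noteq> v'" using nQ Ps dP by auto
        then show False using vS no by auto
      qed
      then show ?thesis using nP' mono by (auto simp: path_nbrs_def)
    qed
  qed simp
qed

lemma finite_ends: "is_path n E P \<Longrightarrow> finite (ends E P t)"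
  by (rule finite_subset[OF ends_subset]) auto

text \<open>Every endpoint has at most two neighbours on \<open>P\<close>, and the endpoints
  themselves are counted once more: 2 + 1 = 3.\<close>

lemma posa_card:
  assumes G: "graph_on n E" and P: "is_path n E P"
    and fr: "\<And>Q. Q \<in> reach E P t \<Longrightarrow> frozen E Q" and C: "C \<subseteq> ends E P t"
  shows "card (nbhd E C) \<le> 3 * card (ends E P (Suc t))"
proof -
  have d: "distinct P" using P by (simp add: is_path_def)
  note f = finite_ends[OF P]
  have "card (nbhd E C) \<le> card (path_nbrs P (ends E P (Suc t)) \<union> ends E P t)"
    using posa[OF assms] card_path_nbrs(1)[OF d f] f by (intro card_mono) auto
  also have "\<dots> \<le> card (path_nbrs P (ends E P (Suc t))) + card (ends E P t)" by (rule card_Un_le)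
  also have "\<dots> \<le> 2 * card (ends E P (Suc t)) + card (ends E P (Suc t))"
    using card_path_nbrs(2)[OF d f] card_mono[OF f ends_mono[of t "Suc t" E P]] by (intro add_mono) auto
  finally show ?thesis by simp
qed

section \<open>Distances\<close>

definition near :: "nat set set \<Rightarrow> nat \<Rightarrow> (nat \<times> nat) set" where
  "near E k = (Id \<union> {(x, y). {x, y} \<in> E}) ^^ k"

lemma near_1: "{x, y} \<in> E \<Longrightarrow> (x, y) \<in> near E 1"
  by (simp add: near_def)

lemma near_refl: "(x, x) \<in> near E k"
  unfolding near_def by (induction k) auto

lemma near_trans: "(x, y) \<in> near E j \<Longrightarrow> (y, z) \<in> near E k \<Longrightarrow> (x, z) \<in> near E (j + k)"
  unfolding near_def by (auto simp: relpow_add)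

lemma near_mono: "(x, y) \<in> near E j \<Longrightarrow> j \<le> k \<Longrightarrow> (x, y) \<in> near E k"
  using near_trans[of x y E j y "k - j"] near_refl by simp

lemma near_sym: "(x, y) \<in> near E k \<Longrightarrow> (y, x) \<in> near E k"
proof (induction k arbitrary: y)
  case (Suc k)
  then obtain z where z: "(x, z) \<in> near E k" "(z, y) \<in> near E 1" by (auto simp: near_def)
  then have "(y, z) \<in> near E 1" by (auto simp: near_def insert_commute)
  then show ?case using near_trans[OF _ Suc.IH[OF z(1)]] by fastforce
qed (simp add: near_def)

lemma near_edge_mono: "H \<subseteq> E \<Longrightarrow> near H k \<subseteq> near E k"
  unfolding near_def by (induction k) auto

text \<open>Distance 4 is twice the distance 2 by which a rotation can move an endpoint, see
  \<open>rot_near\<close>.\<close>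

definition scattered :: "nat set set \<Rightarrow> nat set \<Rightarrow> bool" where
  "scattered E X \<longleftrightarrow> (\<forall>x\<in>X. \<forall>y\<in>X. (x, y) \<in> near E 4 \<longrightarrow> x = y)"

text \<open>Choosing for each vertex of \<open>A\<close> a vertex of \<open>Y\<close> within
  distance 2 is injective: two vertices with the same choice would be within distance 4.\<close>

lemma scattered_card:
  assumes sc: "scattered E X" and fin: "finite Y"
    and "\<And>x. x \<in> A \<Longrightarrow> x \<in> X \<and> (\<exists>y\<in>Y. (x, y) \<in> near E 2)"
  shows "card A \<le> card Y"
proof -
  define f where "f x = (SOME y. y \<in> Y \<and> (x, y) \<in> near E 2)" for x
  have f: "f x \<in> Y \<and> (x, f x) \<in> near E 2" if "x \<in> A" for x
    unfolding f_def by (rule someI_ex) (use assms(3)[OF that] in blast)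
  have "inj_on f A"
  proof (rule inj_onI)
    fix x y assume xy: "x \<in> A" "y \<in> A" "f x = f y"
    have "(x, y) \<in> near E (2 + 2)" using f[OF xy(1)] f[OF xy(2)] xy(3) by (intro near_trans[of x "f x"]) (auto intro: near_sym)
    then show "x = y" using sc assms(3) xy by (simp add: scattered_def)
  qed
  then show ?thesis using f fin by (intro card_inj_on_le[of f]) auto
qed

text \<open>The new endpoint is next to the pivot on the path, and the pivot is adjacent to the old
  endpoint.\<close>

lemma rot_near:
  assumes "rot E Q Q'" "is_path n E Q"
  shows "(last Q', last Q) \<in> near E 2"
proof -
  from rot_split[OF assms(1)] obtain A B where AB: "Q = A @ B" "Q' = A @ rev B" "A \<noteq> []" "B \<noteq> []"
    "{last Q, last A} \<in> E" by metis
  have "{last A, hd B} \<in> E" using assms(2) AB path_edges_append[of A B] by (auto simp: is_path_def)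
  then have "(hd B, last A) \<in> near E 1" by (intro near_1) (simp add: insert_commute)
  moreover have "(last A, last Q) \<in> near E 1" by (intro near_1) (use AB in \<open>simp add: insert_commute\<close>)
  ultimately show ?thesis using near_trans[of "hd B" "last A" E 1 "last Q" 1] AB by (simp add: last_rev numeral_2_eq_2)
qed

text \<open>In the round in which \<open>x\<close> first becomes an endpoint it arises from a path
  with a different endpoint. This ties exceptional endpoints to earlier endpoints, so that they can
  be counted.\<close>

lemma ends_near:
  assumes P: "is_path n E P" and "x \<in> ends E P (Suc t)" "x \<noteq> last P"
  shows "\<exists>y\<in>ends E P t. y \<noteq> x \<and> (x, y) \<in> near E 2"
  using assms(2)
proof (induction t)
  case 0
  then obtain Q where Q: "rot E P Q" "last Q = x" using assms(3) by (auto simp: ends_def)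
  then show ?case using rot_near[OF Q(1) P] assms(3) by (auto simp: ends_def)
next
  case (Suc t)
  show ?case
  proof (cases "x \<in> ends E P (Suc t)")
    case True
    from Suc.IH[OF True] obtain y where y: "y \<in> ends E P t" "y \<noteq> x" "(x, y) \<in> near E 2" by blast
    then show ?thesis using subsetD[OF ends_mono[of t "Suc t" E P] y(1)] by (intro bexI[of _ y]) simp_all
  next
    case False
    then obtain Q R where Q: "R \<in> reach E P (Suc t)" "rot E R Q" "last Q = x"
      using Suc.prems by (auto simp: ends_def)
    have "last R \<in> ends E P (Suc t)" using Q(1) by (auto simp: ends_def)
    moreover have "(x, last R) \<in> near E 2" using rot_near[OF Q(2), of n] reach_is_path[OF P Q(1)] Q(3) by simp
    moreover have "last R \<noteq> x" using \<open>last R \<in> _\<close> False by metis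
    ultimately show ?thesis by (intro bexI[of _ "last R"]) simp_all
  qed
qed

section \<open>HAM keeps a path\<close>

lemma is_path_rev: "is_path n E (rev P) \<longleftrightarrow> is_path n E P"
  by (auto simp: is_path_def path_edges_rev)

lemma is_path_orient: "is_path n E (orient P) \<longleftrightarrow> is_path n E P"
  by (simp add: orient_def is_path_rev)

lemma set_orient [simp]: "set (orient P) = set P"
  by (simp add: orient_def)

lemma length_orient [simp]: "length (orient P) = length P"
  by (simp add: orient_def)

lemma orient_ends: "P \<noteq> [] \<Longrightarrow> {hd (orient P), last (orient P)} = {hd P, last P}"
  by (auto simp: orient_def hd_rev last_rev)

lemma rotations_is_path:
  assumes "is_path n E P" "Q \<in> set (rotations E P)"
  shows "is_path n E Q \<and> set Q = set P"
proof -
  from assms(2) have "rot E (rev (orient P)) Q \<or> rot E (orient P) Q"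
    by (auto simp: rotations_def Let_def rot_iff)
  then show ?thesis
    using rot_is_path[of E "rev (orient P)" Q n] rot_is_path[of E "orient P" Q n] assms(1)
    by (auto simp: is_path_rev is_path_orient)
qed

lemma bfs_paths_is_path:
  assumes "is_path n E P" "Q \<in> set (bfs_paths E D P)"
  shows "is_path n E Q \<and> set Q = set P"
proof -
  have "is_path n E Q \<and> set Q = set P" if "Q \<in> set (bfs_level E P j)" for j Q
    using that
  proof (induction j arbitrary: Q)
    case 0
    then show ?case using assms(1) by (simp add: bfs_level_def)
  next
    case (Suc j)
    then obtain R where "R \<in> set (bfs_level E P j)" "Q \<in> set (rotations E R)" by (auto simp: bfs_level_Suc)
    then show ?case using Suc.IH[of R] rotations_is_path[of n E R Q] by simp
  qed
  then show ?thesis using assms(2) by (auto simp: bfs_paths_def simp del: upt_Suc)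
qed

definition is_cycle :: "nat set set \<Rightarrow> nat list \<Rightarrow> bool" where
  "is_cycle E C \<longleftrightarrow> C \<noteq> [] \<and> path_edges C \<subseteq> E \<and> {last C, hd C} \<in> E"

lemma path_edges_Cons: "xs \<noteq> [] \<Longrightarrow> path_edges (x # xs) = insert {x, hd xs} (path_edges xs)"
  by (cases xs) auto

lemma is_cycle_rotate: "is_cycle E C \<Longrightarrow> is_cycle E (rotate i C)"
proof (induction i)
  case (Suc i)
  then have c: "is_cycle E (rotate i C)" by simp
  then obtain x xs where xs: "rotate i C = x # xs" unfolding is_cycle_def by (meson neq_Nil_conv)
  have "is_cycle E (xs @ [x])"
  proof (cases "xs = []")
    case False
    have "path_edges (xs @ [x]) = path_edges xs \<union> {{last xs, x}}"
      using path_edges_append[of xs "[x]"] False by simp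
    then show ?thesis using c xs False by (auto simp: is_cycle_def path_edges_Cons insert_commute)
  qed (use c xs in simp)
  then show ?case by (simp add: xs)
qed simp

text \<open>A closed path may be read as a cycle starting at any of its vertices; removing either
  cycle edge at \<open>u\<close> leaves a path that begins at \<open>u\<close>, to which the outside
  vertex is attached.\<close>

lemma reopen_is_path:
  assumes G: "graph_on n E" and P: "is_path n E P" and c: "closable E P"
    and out: "\<exists>u\<in>set P. outside_nbrs E P u \<noteq> {}"
  shows "is_path n E (reopen E P) \<and> length (reopen E P) = Suc (length P)"
proof -
  define i where "i = (LEAST i. i < length P \<and> outside_nbrs E P (P ! i) \<noteq> {})"
  define C where "C = rotate i P"
  define y where "y = Min (outside_nbrs E P (hd C))"
  note i = reopen_index[OF out, folded i_def C_def]
  have "y \<in> outside_nbrs E P (hd C)"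
    unfolding y_def using i(2,4) by (intro Min_in finite_outside_nbrs[OF G]) simp
  then have y: "{hd C, y} \<in> E" "y \<notin> set P" by (auto simp: outside_nbrs_def)
  have yn: "y \<in> {1..n}" using graph_onD[OF G y(1)] by simp
  have "is_cycle E P" using P c by (auto simp: is_path_def closable_def is_cycle_def insert_commute)
  then have cC: "is_cycle E C" unfolding C_def by (rule is_cycle_rotate)
  have sC: "set C = set P" "distinct C" "length C = length P" using P by (auto simp: C_def is_path_def)
  then have "3 \<le> length C" using c by (simp add: closable_def)
  then obtain u t where ut: "C = u # t" "t \<noteq> []" by (cases C; cases "tl C") auto
  have "path_edges (y # C) \<subseteq> E" using cC y(1) ut by (auto simp: is_cycle_def insert_commute)
  moreover have "path_edges (y # u # rev t) \<subseteq> E"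
    using cC y(1) ut by (auto simp: is_cycle_def insert_commute path_edges_Cons path_edges_rev hd_rev)
  moreover have "distinct (y # C)" "distinct (y # u # rev t)" using sC y(2) ut by auto
  moreover have "set (y # C) \<subseteq> {1..n}" "set (y # u # rev t) \<subseteq> {1..n}" using P yn sC ut by (auto simp: is_path_def)
  moreover have "reopen E P = y # C \<or> reopen E P = y # u # rev t"
    unfolding reopen_def Let_def i_def[symmetric] C_def[symmetric] y_def[symmetric] using ut by simp
  moreover have "length (y # C) = Suc (length P)" "length (y # u # rev t) = Suc (length P)" using sC(3) ut by auto
  ultimately show ?thesis unfolding is_path_def by auto
qed

lemma try_extend_is_path:
  assumes G: "graph_on n E" and P: "is_path n E P" and L: "try_extend n E P = Longer P'"
  shows "is_path n E P' \<and> length P' = Suc (length P)"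
proof -
  define Q where "Q = orient P"
  have Q: "is_path n E Q" "length Q = length P" using P by (simp_all add: Q_def is_path_orient)
  have minin: "Min (outside_nbrs E Q v) \<in> outside_nbrs E Q v" if "outside_nbrs E Q v \<noteq> {}" for v
    using that by (intro Min_in finite_outside_nbrs[OF G])
  have ext: "is_path n E (y # Q)" if "y \<in> outside_nbrs E Q (hd Q)" for y
    using that Q graph_onD[OF G, of "hd Q" y]
    by (auto simp: outside_nbrs_def is_path_def path_edges_Cons insert_commute)
  have ext': "is_path n E (Q @ [y])" if "y \<in> outside_nbrs E Q (last Q)" for y
    using that Q graph_onD[OF G, of "last Q" y] path_edges_append[of Q "[y]"]
    by (auto simp: outside_nbrs_def is_path_def)
  note te = L[unfolded try_extend_def Let_def, folded Q_def]
  show ?thesis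
  proof (cases "outside_nbrs E Q (hd Q) = {}")
    case False
    then show ?thesis using te ext[OF minin[OF False]] Q(2) by auto
  next
    case h: True
    show ?thesis
    proof (cases "outside_nbrs E Q (last Q) = {}")
      case False
      then show ?thesis using te h ext'[OF minin[OF False]] Q(2) by auto
    next
      case True
      then have "closable E Q" "\<exists>u\<in>set Q. outside_nbrs E Q u \<noteq> {}" "P' = reopen E Q"
        using te h by (auto split: if_splits)
      then show ?thesis using reopen_is_path[OF G Q(1)] Q(2) by simp
    qed
  qed
qed

lemma ham_path_is_path:
  assumes G: "graph_on n E" and "n \<ge> 1" "ham_path n E D k P"
  shows "is_path n E P \<and> length P = k"
  using assms(3)
proof (induction rule: ham_path.induct)
  case start
  then show ?case using assms(2) by (auto simp: is_path_def)
next
  case (step k P P')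
  from step.hyps(2) obtain Q where f: "find (\<lambda>Q. try_extend n E Q \<noteq> Stuck) (bfs_paths E D P) = Some Q"
    and t: "try_extend n E Q = Longer P'" by (auto simp: ham_stage_def split: option.splits)
  have Q: "Q \<in> set (bfs_paths E D P)" "try_extend n E Q = Longer P'" using find_eq_SomeD[OF f] t by auto
  have "is_path n E Q" "set Q = set P" using bfs_paths_is_path[OF _ Q(1)] step.IH by auto
  moreover have "length Q = length P"
    using calculation step.IH distinct_card[of Q] distinct_card[of P] by (simp add: is_path_def)
  ultimately show ?case using try_extend_is_path[OF G _ Q(2)] step.IH by simp
qed

lemma is_path_last: "is_path n E P \<Longrightarrow> last P \<in> {1..n}"
  using last_in_set[of P] by (auto simp only: is_path_def)

lemma is_path_length_le: "is_path n E P \<Longrightarrow> length P \<le> n"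
  using card_mono[of "{1..n}" "set P"] distinct_card[of P] by (simp add: is_path_def)

section \<open>Expanding graphs\<close>

text \<open>The vertices in \<open>X\<close> are exempt from expansion. The alternatives for
  \<open>s0\<close> are two ways to start the growth of endpoints: sets of every size from 1 on
  expand outside \<open>X\<close>, or only sets of size at least \<open>s0\<close> do, and then
  degree \<open>3 * s0\<close> yields \<open>s0\<close> endpoints after one rotation because
  \<open>posa_card\<close> loses a factor 3. The last condition makes the growth factor
  \<open>c * d / 6\<close> at least 2.\<close>

locale expander =
  fixes n :: nat and E :: "nat set set" and X :: "nat set" and s0 :: nat and c d :: real
  assumes graph: "graph_on n E"
    and deg2: "v \<in> {1..n} \<Longrightarrow> 2 \<le> card (nbhd E {v})"
    and scattered: "scattered E X"
    and expand: "C \<subseteq> {1..n} \<Longrightarrow> C \<inter> X = {} \<Longrightarrow> s0 \<le> card C \<Longrightarrow> real (card C) \<le> real n / 800 \<Longrightarrow>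
        c * min (d * real (card C)) (real n) < real (card (nbhd E C))"
    and s0: "s0 \<ge> 1" "s0 = 1 \<or> X = {} \<and> (\<forall>v\<in>{1..n}. 3 * s0 \<le> card (nbhd E {v}))"
    and big: "Y \<subseteq> {1..n} \<Longrightarrow> nbhd E Y = {} \<Longrightarrow> c / 12 * real n \<le> real (card Y) \<Longrightarrow> real n / 2 < real (card Y)"
    and c: "0 < c" "c \<le> 1 / 100" "12 \<le> c * d"
begin

lemma c_small: "c / 12 * real n \<le> real n / 800"
  using mult_right_mono[of "c / 12" "1 / 800" "real n"] c(2) by simp

lemma near_in_X: "x \<in> X \<Longrightarrow> (x, y) \<in> near E k \<Longrightarrow> k \<le> 4 \<Longrightarrow> y \<noteq> x \<Longrightarrow> y \<notin> X"
  using scattered near_mono[of x y E k 4] unfolding scattered_def by blast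

text \<open>The outer neighbours of the unexceptional part \<open>C\<close> of \<open>Y\<close> are
  exceptional vertices of \<open>Y\<close>. Each of those has an unexceptional neighbour in
  \<open>Y\<close>, so scattering allows at most \<open>card C\<close> of them, fewer than expansion
  demands.\<close>

lemma no_small_closed:
  assumes Y: "Y \<subseteq> {1..n}" "Y \<noteq> {}" "nbhd E Y = {}" "real (card Y) < c / 12 * real n"
  shows False
proof -
  have fY: "finite Y" using Y(1) finite_subset by auto
  define C where "C = Y - X"
  have closed: "u \<in> Y" if "v \<in> Y" "{v, u} \<in> E" for u v
    using Y(3) that by (auto simp: nbhd_def)
  have nb: "nbhd E {x} \<subseteq> Y" if "x \<in> Y" for x using closed that by (auto simp: nbhd_def)
  have bad: "card (Y \<inter> X) \<le> card C"
  proof (rule scattered_card[OF scattered])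
    fix x assume x: "x \<in> Y \<inter> X"
    then have "nbhd E {x} \<noteq> {}" using deg2[of x] Y(1) by auto
    then obtain u where u: "u \<in> nbhd E {x}" by blast
    then have e: "(x, u) \<in> near E 1" "u \<noteq> x" using near_1[of x u E] by (auto simp: nbhd_def)
    have "u \<notin> X" using near_in_X[OF _ e(1)] e(2) x by simp
    then show "x \<in> X \<and> (\<exists>y\<in>C. (x, y) \<in> near E 2)"
      using x nb u near_mono[OF e(1), of 2] by (auto simp: C_def)
  qed (simp add: C_def fY)
  have fC: "finite C" by (simp add: C_def fY)
  have "card Y = card C + card (Y \<inter> X)" unfolding C_def using card_Int_Diff[OF fY, of X] by simp
  moreover have "card Y > 0" using Y(2) fY by (simp add: card_gt_0_iff)
  ultimately have C1: "1 \<le> card C" using bad by linarith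
  \<comment> \<open>If \<open>s0\<close> is not 1, then \<open>X\<close> is empty and
    \<open>Y\<close> contains the whole neighbourhood of one of its vertices, that is at least
    \<open>3 * s0\<close> vertices.\<close>
  have "s0 \<le> card C"
  proof (cases "s0 = 1")
    case False
    then have X: "X = {}" "\<forall>v\<in>{1..n}. 3 * s0 \<le> card (nbhd E {v})" using s0 by auto
    obtain x where x: "x \<in> Y" using Y(2) by blast
    have "3 * s0 \<le> card (nbhd E {x})" using X(2) subsetD[OF Y(1) x] by blast
    then have "3 * s0 \<le> card Y" using card_mono[OF fY nb[OF x]] by simp
    then show ?thesis using X(1) by (simp add: C_def)
  qed (use C1 in simp)
  moreover have CY: "card C \<le> card Y" unfolding C_def using fY by (intro card_mono) auto
  moreover have "real (card C) \<le> real n / 800"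
  proof -
    have "c / 12 * real n \<le> real n / 800" by (rule c_small)
    then show ?thesis using CY Y(4) by linarith
  qed
  ultimately have "c * min (d * real (card C)) (real n) < real (card (nbhd E C))"
    using Y(1) by (intro expand) (auto simp: C_def)
  also have "nbhd E C \<subseteq> Y \<inter> X" using closed by (auto simp: nbhd_def C_def)
  then have "real (card (nbhd E C)) \<le> real (card C)" using card_mono[of "Y \<inter> X" "nbhd E C"] fY bad by (simp del: Int_subset_iff)
  finally have 1: "c * min (d * real (card C)) (real n) < real (card C)" .
  have "c * (d * real (card C)) \<ge> 12 * real (card C)" using mult_right_mono[OF c(3), of "real (card C)"] by (simp add: mult.assoc)
  moreover have "c * real n \<ge> real (card C)" using CY Y(4) c(1) by (simp add: field_simps)
  ultimately show False using 1 C1 by (auto simp: min_def split: if_splits)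
qed

text \<open>A nonempty closed set and a nonempty complement would each contain more than half of the
  vertices.\<close>

lemma connected:
  assumes Y: "Y \<subseteq> {1..n}" "Y \<noteq> {}" "nbhd E Y = {}"
  shows "Y = {1..n}"
proof (rule ccontr)
  assume ne: "Y \<noteq> {1..n}"
  define Z where "Z = {1..n} - Y"
  have Z: "Z \<subseteq> {1..n}" "Z \<noteq> {}" using ne Y(1) by (auto simp: Z_def)
  have "nbhd E Z = {}"
  proof (rule ccontr)
    assume "nbhd E Z \<noteq> {}"
    then obtain u v where uv: "u \<notin> Z" "v \<in> Z" "{v, u} \<in> E" by (auto simp: nbhd_def)
    then have "u \<in> Y" using graph_onD[OF graph uv(3)] by (auto simp: Z_def)
    then have "v \<in> nbhd E Y" using uv by (auto simp: nbhd_def Z_def insert_commute)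
    then show False using Y(3) by simp
  qed
  note Z = Z this
  have big': "real n / 2 < real (card W)" if "W \<subseteq> {1..n}" "W \<noteq> {}" "nbhd E W = {}" for W
    using big[OF that(1,3)] no_small_closed[OF that] by (meson not_le)
  have "card Z = n - card Y" unfolding Z_def using Y(1) by (subst card_Diff_subset) (auto intro: finite_subset)
  moreover have "card Y \<le> n" using card_mono[OF _ Y(1)] by simp
  ultimately show False using big'[OF Y] big'[OF Z] by simp
qed

text \<open>Two graphs occur because expansion is known for the thinned graph \<open>E\<close>,
  while stuckness is also used in the graph \<open>F\<close> with incidences restored. Were the ends
  adjacent in \<open>F\<close>, the cycle would have no outside neighbours and would be spanning by
  connectivity of \<open>E\<close>, so HAM would have succeeded.\<close>

lemma stuck_ends:
  assumes F: "E \<subseteq> F" "graph_on n F" and Q: "is_path n E Q" and st: "try_extend n F Q = Stuck"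
  shows "{hd Q, last Q} \<notin> F" "frozen E Q" "frozen E (rev Q)" "hd Q \<noteq> last Q"
proof -
  define Q' where "Q' = orient Q"
  have ne: "Q \<noteq> []" using Q by (simp add: is_path_def)
  have out: "outside_nbrs F Q' v = outside_nbrs F Q v" for v by (simp add: outside_nbrs_def Q'_def)
  have ends: "{hd Q', last Q'} = {hd Q, last Q}" unfolding Q'_def by (rule orient_ends[OF ne])
  note st' = st[unfolded try_extend_Stuck_iff Let_def, folded Q'_def, unfolded out]
  have o: "outside_nbrs F Q (hd Q) = {}" "outside_nbrs F Q (last Q) = {}"
    using st' ends by (auto simp: doubleton_eq_iff)
  have oE: "outside_nbrs E Q (hd Q) = {}" "outside_nbrs E Q (last Q) = {}"
    using o outside_nbrs_mono[OF F(1)] by blast+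
  \<comment> \<open>\<open>closable\<close> requires three vertices; they are there since the two
    neighbours of the last vertex lie on the path.\<close>
  have len: "3 \<le> length Q"
  proof -
    have "last Q \<in> {1..n}" using Q by (rule is_path_last)
    then have "2 \<le> card (nbhd E {last Q})" by (rule deg2)
    also have "nbhd E {last Q} \<subseteq> set Q - {last Q}" using oE(2) by (auto simp: nbhd_def outside_nbrs_def)
    then have "card (nbhd E {last Q}) \<le> card (set Q - {last Q})" by (intro card_mono) auto
    also have "\<dots> = length Q - 1" using Q ne by (simp add: is_path_def distinct_card)
    finally show ?thesis by simp
  qed
  show "hd Q \<noteq> last Q"
    using ne len Q nth_eq_iff_index_eq[of Q 0 "length Q - 1"] by (auto simp: is_path_def hd_conv_nth last_conv_nth)
  show ends_F: "{hd Q, last Q} \<notin> F"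
  proof
    assume "{hd Q, last Q} \<in> F"
    then have "closable F Q'" using ends len by (simp add: closable_def Q'_def)
    then have l: "length Q \<noteq> n" and "\<forall>u\<in>set Q. outside_nbrs F Q u = {}" using st' by (auto simp: Q'_def)
    then have "nbhd E (set Q) = {}" using F(1) unfolding nbhd_def outside_nbrs_def by fast
    then have "set Q = {1..n}" using connected[of "set Q"] Q by (auto simp: is_path_def)
    then show False using l distinct_card[of Q] Q by (simp add: is_path_def)
  qed
  show "frozen E Q" "frozen E (rev Q)"
    using oE ends_F F(1) ne by (auto simp: frozen_def outside_nbrs_def hd_rev last_rev insert_commute)
qed

section \<open>Growth of the set of endpoints\<close>

context
  fixes P :: "nat list"
  assumes P: "is_path n E P"
begin

lemma finite_good_ends: "finite (ends E P t - X)"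
  using finite_ends[OF P] by simp

text \<open>An exceptional endpoint other than \<open>last P\<close> is within distance 2 of an
  earlier endpoint, which cannot be exceptional as well; scattering makes this assignment injective.
  The summand 1 accounts for \<open>last P\<close>.\<close>

lemma card_bad_ends: "card (ends E P (Suc t) \<inter> X) \<le> card (ends E P t - X) + 1"
proof -
  have "card (ends E P (Suc t) \<inter> X - {last P}) \<le> card (ends E P t - X)"
  proof (rule scattered_card[OF scattered finite_good_ends])
    fix x assume x: "x \<in> ends E P (Suc t) \<inter> X - {last P}"
    then obtain y where y: "y \<in> ends E P t" "y \<noteq> x" "(x, y) \<in> near E 2" using ends_near[OF P, of x t] by auto
    have "y \<notin> X" using near_in_X[OF _ y(3)] x y(2) by simp
    then show "x \<in> X \<and> (\<exists>y\<in>ends E P t - X. (x, y) \<in> near E 2)" using x y by auto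
  qed
  moreover have "card (ends E P (Suc t) \<inter> X) \<le> card (ends E P (Suc t) \<inter> X - {last P}) + 1"
    using diff_card_le_card_Diff[of "{last P}" "ends E P (Suc t) \<inter> X"] by simp
  ultimately show ?thesis by linarith
qed

text \<open>With \<open>s0 = 1\<close> one unexceptional endpoint is needed. If
  \<open>last P\<close> is exceptional, any proper rotation produces another endpoint within
  distance 2 of it, and scattering makes that one unexceptional.\<close>

lemma first_rotation:
  assumes fr: "\<And>Q. Q \<in> reach E P 1 \<Longrightarrow> frozen E Q"
  shows "s0 \<le> card (ends E P 1 - X)"
proof (cases "s0 = 1")
  case False
  then have X: "X = {}" "\<forall>v\<in>{1..n}. 3 * s0 \<le> card (nbhd E {v})" using s0 by auto
  have "last P \<in> {1..n}" using P by (rule is_path_last)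
  then have "3 * s0 \<le> card (nbhd E {last P})" using X by blast
  also have "\<dots> \<le> 3 * card (ends E P (Suc 0))"
    by (rule posa_card[OF graph P]) (use fr in \<open>auto simp: ends_def\<close>)
  finally show ?thesis using X(1) by simp
next
  case True
  have "ends E P 1 - X \<noteq> {}"
  proof (cases "last P \<in> X")
    case False
    then show ?thesis by (auto simp: ends_def)
  next
    case lX: True
    have ne: "P \<noteq> []" "distinct P" using P by (auto simp: is_path_def)
    have frP: "frozen E P" by (rule fr) simp
    have "last P \<in> {1..n}" using P by (rule is_path_last)
    then have c2: "2 \<le> card (nbhd E {last P})" by (rule deg2)
    \<comment> \<open>The path predecessor of the last vertex is not an admissible pivot; minimum
      degree 2 provides another neighbour.\<close>
    have "\<not> nbhd E {last P} \<subseteq> {last (butlast P)}"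
    proof
      assume "nbhd E {last P} \<subseteq> {last (butlast P)}"
      then have "card (nbhd E {last P}) \<le> card {last (butlast P)}" by (intro card_mono) simp_all
      then show False using c2 by simp
    qed
    then obtain x where x: "x \<in> nbhd E {last P}" "x \<noteq> last (butlast P)" by blast
    then have xE: "{last P, x} \<in> E" "x \<noteq> last P" by (auto simp: nbhd_def)
    have "x \<in> set P" "x \<noteq> hd P" using frP xE by (auto simp: frozen_def outside_nbrs_def)
    then obtain as u v bs where Ps: "P = as @ u # x # v # bs" using interior_split[of x P] xE(2) by blast
    have bs: "bs \<noteq> []"
    proof
      assume "bs = []"
      then have "butlast P = as @ [u, x]" using Ps by (simp add: butlast_append)
      then show False using x(2) by simp
    qed
    define P' where "P' = as @ u # x # rev (v # bs)"
    have r: "rot E P P'" unfolding P'_def by (rule rot_intro[OF Ps bs xE(1)])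
    have lP': "last P' = v" by (simp add: P'_def)
    have "v \<noteq> last P" using ne(2) Ps bs by auto
    moreover have "(last P, v) \<in> near E 2" using near_sym[OF rot_near[OF r P]] lP' by simp
    ultimately have "v \<notin> X" using near_in_X[OF lX, of v 2] by simp
    moreover have "v \<in> ends E P 1" unfolding ends_def using r lP' by (auto intro!: image_eqI[of _ _ P'])
    ultimately show ?thesis by blast
  qed
  then show ?thesis using True finite_good_ends[of 1] by (simp add: Suc_le_eq card_gt_0_iff)
qed

text \<open>By \<open>posa_card\<close> and \<open>card_bad_ends\<close> the neighbourhood has at
  most \<open>3 * card C' + 3 * (card C + 1)\<close> elements, where \<open>C\<close> and
  \<open>C'\<close> are the unexceptional endpoints before and after. The terms with
  \<open>card C\<close> are at most \<open>6 * card C\<close>, which is at most half of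
  \<open>c * d * card C\<close>; the remaining half, divided by 3, is the growth factor.\<close>

lemma ends_step:
  assumes fr: "\<And>Q. Q \<in> reach E P t \<Longrightarrow> frozen E Q" and s: "s0 \<le> card (ends E P t - X)"
  shows "min (c * d / 6 * real (card (ends E P t - X))) (c / 12 * real n) \<le> real (card (ends E P (Suc t) - X))"
    and "s0 \<le> card (ends E P (Suc t) - X)"
proof -
  let ?C = "ends E P t - X" and ?C' = "ends E P (Suc t) - X"
  have mono: "card ?C \<le> card ?C'"
    by (rule card_mono[OF finite_good_ends]) (use ends_mono[of t "Suc t" E P] in auto)
  then show "s0 \<le> card ?C'" using s by simp
  show "min (c * d / 6 * real (card ?C)) (c / 12 * real n) \<le> real (card ?C')"
  proof (cases "c / 12 * real n \<le> real (card ?C)")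
    case True
    then show ?thesis using mono by linarith
  next
    case False
    have C1: "1 \<le> card ?C" using s s0(1) by simp
    have le: "real (card ?C) \<le> real n / 800"
    proof -
      have "c / 12 * real n \<le> real n / 800" by (rule c_small)
      then show ?thesis using False by linarith
    qed
    have sub: "?C \<subseteq> {1..n}" using ends_subset[OF P, of t] P by (auto simp: is_path_def)
    have "c * min (d * real (card ?C)) (real n) < real (card (nbhd E ?C))"
      using expand[OF sub _ s le] by blast
    also have "card (nbhd E ?C) \<le> 3 * card (ends E P (Suc t))"
      by (rule posa_card[OF graph P fr]) auto
    also have "card (ends E P (Suc t)) = card ?C' + card (ends E P (Suc t) \<inter> X)"
      using card_Int_Diff[OF finite_ends[OF P], of "Suc t" X] by simp
    also have "card (ends E P (Suc t) \<inter> X) \<le> card ?C + 1" by (rule card_bad_ends)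
    finally have *: "c * min (d * real (card ?C)) (real n) < 3 * real (card ?C') + 3 * real (card ?C) + 3"
      by simp
    have cd: "c * d * real (card ?C) \<ge> 12 * real (card ?C)" using mult_right_mono[OF c(3), of "real (card ?C)"] by simp
    show ?thesis
    proof (cases "d * real (card ?C) \<le> real n")
      case True
      then have "c * d * real (card ?C) < 3 * real (card ?C') + 3 * real (card ?C) + 3" using * by (simp add: min_def)
      moreover have "3 * real (card ?C) + 3 \<le> 6 * real (card ?C)" using C1 by simp
      ultimately have "c * d * real (card ?C) \<le> 6 * real (card ?C')" using cd by linarith
      then have "c * d / 6 * real (card ?C) \<le> real (card ?C')" by simp
      then show ?thesis by simp
    next
      case F: False
      then have "c * real n < 3 * real (card ?C') + 3 * real (card ?C) + 3" using * by (simp add: min_def)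
      moreover have "3 * real (card ?C) + 3 \<le> 6 * real (card ?C)" using C1 by simp
      ultimately have "c / 12 * real n \<le> real (card ?C')" using False by simp
      then show ?thesis by simp
    qed
  qed
qed

lemma ends_growth:
  assumes fr: "\<And>Q. Q \<in> reach E P (Suc t) \<Longrightarrow> frozen E Q"
  shows "min ((c * d / 6) ^ t) (c / 12 * real n) \<le> real (card (ends E P (Suc t) - X)) \<and>
    s0 \<le> card (ends E P (Suc t) - X)"
  using assms
proof (induction t)
  case 0
  then have "s0 \<le> card (ends E P (Suc 0) - X)" using first_rotation by simp
  then show ?case using s0(1) by simp
next
  case (Suc t)
  have fr': "frozen E Q" if "Q \<in> reach E P (Suc t)" for Q
    using Suc.prems subsetD[OF reach_mono[of "Suc t" "Suc (Suc t)" E P] that] by simp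
  then have IH: "min ((c * d / 6) ^ t) (c / 12 * real n) \<le> real (card (ends E P (Suc t) - X))"
    "s0 \<le> card (ends E P (Suc t) - X)" using Suc.IH by blast+
  have cd: "c * d / 6 \<ge> 1" using c(3) by simp
  note st = ends_step[OF fr' IH(2)]
  have "min ((c * d / 6) ^ Suc t) (c / 12 * real n) \<le> min (c * d / 6 * real (card (ends E P (Suc t) - X))) (c / 12 * real n)"
  proof (cases "(c * d / 6) ^ t \<le> c / 12 * real n")
    case True
    then have "(c * d / 6) ^ t \<le> real (card (ends E P (Suc t) - X))" using IH(1) by simp
    then have "c * d / 6 * (c * d / 6) ^ t \<le> c * d / 6 * real (card (ends E P (Suc t) - X))"
      using cd by (intro mult_left_mono) auto
    then show ?thesis by auto
  next
    case False
    then have "c / 12 * real n \<le> real (card (ends E P (Suc t) - X))" using IH(1) by simp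
    also have "\<dots> \<le> c * d / 6 * real (card (ends E P (Suc t) - X))"
      using mult_right_mono[OF cd, of "real (card (ends E P (Suc t) - X))"] by simp
    finally show ?thesis by auto
  qed
  then show ?case using st by linarith
qed

text \<open>The first rotation only secures a start; the other \<open>T - 1\<close> rounds each
  multiply by \<open>c * d / 6\<close> until the cap \<open>c / 12 * n\<close> is reached.\<close>

lemma ends_large:
  assumes fr: "\<And>Q. Q \<in> reach E P T \<Longrightarrow> frozen E Q" and T: "T \<ge> 1" "real n \<le> (c * d / 6) ^ (T - 1)"
  shows "c / 12 * real n \<le> real (card (ends E P T))"
proof -
  obtain t where t: "T = Suc t" using T(1) by (cases T) auto
  have "c / 12 * real n \<le> real n" using c mult_right_mono[of "c / 12" 1 "real n"] by simp
  then have "c / 12 * real n \<le> min ((c * d / 6) ^ t) (c / 12 * real n)" using T(2) t by simp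
  also have "\<dots> \<le> real (card (ends E P T - X))" using ends_growth[of t] fr t by simp
  also have "\<dots> \<le> real (card (ends E P T))" using finite_ends[OF P] by (simp add: card_mono)
  finally show ?thesis .
qed

end

text \<open>A path ending in \<open>a\<close> is reversed, so that \<open>a\<close> becomes the
  fixed first vertex, and the other end is rotated another \<open>T\<close> times. All these paths
  are within depth \<open>2 * T\<close> and therefore stuck.\<close>

lemma stuck_pairs:
  assumes P: "is_path n E P" and st: "\<And>Q. Q \<in> set (bfs_paths E D P) \<Longrightarrow> try_extend n E Q = Stuck"
    and T: "T \<ge> 1" "real n \<le> (c * d / 6) ^ (T - 1)" "2 * T \<le> D"
  shows "\<exists>A\<subseteq>{1..n}. c / 12 * real n \<le> real (card A) \<and>
    (\<forall>a\<in>A. \<exists>B\<subseteq>{1..n}. c / 12 * real n \<le> real (card B) \<and>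
       (\<forall>b\<in>B. \<exists>Q\<in>set (bfs_paths E D P). {hd Q, last Q} = {a, b}))"
proof -
  have fr: "frozen E R" if "R \<in> set (bfs_paths E D P) \<or> rev R \<in> set (bfs_paths E D P)" for R
    using that
  proof
    assume R: "R \<in> set (bfs_paths E D P)"
    show ?thesis using bfs_paths_is_path[OF P R] st[OF R] by (intro stuck_ends(2)[OF order_refl graph]) auto
  next
    assume R: "rev R \<in> set (bfs_paths E D P)"
    show ?thesis using bfs_paths_is_path[OF P R] st[OF R] stuck_ends(3)[OF order_refl graph, of "rev R"] by simp
  qed
  have 1: "c / 12 * real n \<le> real (card (ends E P T))"
    by (rule ends_large[OF P _ T(1,2)]) (use fr reach_bfs_paths[of _ E P T D] T(3) in auto)
  show ?thesis
  proof (rule exI[of _ "ends E P T"], intro conjI ballI 1)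
    show "ends E P T \<subseteq> {1..n}" using ends_subset[OF P] P by (auto simp: is_path_def)
    fix a assume "a \<in> ends E P T"
    then obtain Q where Q: "Q \<in> reach E P T" "a = last Q" by (auto simp: ends_def)
    have rQ: "is_path n E (rev Q)" using reach_is_path[OF P Q(1)] by (simp add: is_path_rev)
    have bfs: "R \<in> set (bfs_paths E D P) \<or> rev R \<in> set (bfs_paths E D P)" if "R \<in> reach E (rev Q) T" for R
      using reach_rev_bfs_paths[OF Q(1) that] T(3) by simp
    show "\<exists>B\<subseteq>{1..n}. c / 12 * real n \<le> real (card B) \<and>
       (\<forall>b\<in>B. \<exists>Q\<in>set (bfs_paths E D P). {hd Q, last Q} = {a, b})"
    proof (rule exI[of _ "ends E (rev Q) T"], intro conjI ballI)
      show "ends E (rev Q) T \<subseteq> {1..n}" using ends_subset[OF rQ] rQ by (auto simp: is_path_def)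
      show "c / 12 * real n \<le> real (card (ends E (rev Q) T))"
        by (rule ends_large[OF rQ _ T(1,2)]) (use fr bfs in blast)
      fix b assume "b \<in> ends E (rev Q) T"
      then obtain R where R: "R \<in> reach E (rev Q) T" "b = last R" by (auto simp: ends_def)
      have "hd R = a" "R \<noteq> []" using reach_is_path[OF rQ R(1)] Q(2) rQ by (auto simp: is_path_def hd_rev)
      then show "\<exists>Q\<in>set (bfs_paths E D P). {hd Q, last Q} = {a, b}"
      proof -
        have "{hd R, last R} = {a, b}" "{hd (rev R), last (rev R)} = {a, b}"
          using \<open>hd R = a\<close> R(2) \<open>R \<noteq> []\<close> by (auto simp: hd_rev last_rev)
        then show ?thesis using bfs[OF R(1)] by blast
      qed
    qed
  qed
qed

end

section \<open>Random incidences\<close>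

definition incidences :: "nat \<Rightarrow> nat \<Rightarrow> real \<Rightarrow> (nat \<times> nat \<Rightarrow> bool) pmf" where
  "incidences n m p = Pi_pmf ({1..n} \<times> {1..m}) False (\<lambda>_. bernoulli_pmf p)"

definition feature_column :: "nat \<Rightarrow> real \<Rightarrow> (nat \<Rightarrow> bool) pmf" where
  "feature_column n p = Pi_pmf {1..n} False (\<lambda>_. bernoulli_pmf p)"

lemma rig_eq: "rig n m p = map_pmf (rig_edges n m) (incidences n m p)"
  by (simp add: rig_def incidences_def)

lemma rig_edges_iff:
  "{u, v} \<in> rig_edges n m \<omega> \<longleftrightarrow>
     u \<noteq> v \<and> u \<in> {1..n} \<and> v \<in> {1..n} \<and> (\<exists>w\<in>{1..m}. \<omega> (u, w) \<and> \<omega> (v, w))"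
proof
  assume "{u, v} \<in> rig_edges n m \<omega>"
  then show "u \<noteq> v \<and> u \<in> {1..n} \<and> v \<in> {1..n} \<and> (\<exists>w\<in>{1..m}. \<omega> (u, w) \<and> \<omega> (v, w))"
    unfolding rig_edges_def Let_def by (auto simp: doubleton_eq_iff)
next
  assume "u \<noteq> v \<and> u \<in> {1..n} \<and> v \<in> {1..n} \<and> (\<exists>w\<in>{1..m}. \<omega> (u, w) \<and> \<omega> (v, w))"
  then show "{u, v} \<in> rig_edges n m \<omega>"
    unfolding rig_edges_def Let_def by (intro CollectI exI[of _ u] exI[of _ v]) auto
qed

lemma graph_on_rig_edges: "graph_on n (rig_edges n m \<omega>)"
  unfolding rig_edges_def graph_on_def Let_def by blast

lemma rig_edges_mono: "(\<And>x. \<omega> x \<Longrightarrow> \<omega>' x) \<Longrightarrow> rig_edges n m \<omega> \<subseteq> rig_edges n m \<omega>'"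
  unfolding rig_edges_def Let_def by blast

lemma finite_set_Pi_bool: "finite A \<Longrightarrow> finite (set_pmf (Pi_pmf A d (f :: _ \<Rightarrow> bool pmf)))"
  by (rule finite_subset[OF set_Pi_pmf_subset']) auto

lemma finite_incidences: "finite (set_pmf (incidences n m p))"
  unfolding incidences_def by (rule finite_set_Pi_bool) simp

lemma finite_column: "finite (set_pmf (feature_column n p))"
  unfolding feature_column_def by (rule finite_set_Pi_bool) simp

lemma integrable_incidences [simp]: "integrable (measure_pmf (incidences n m p)) (f :: _ \<Rightarrow> real)"
  by (rule integrable_measure_pmf_finite[OF finite_incidences])

lemma integrable_column [simp]: "integrable (measure_pmf (feature_column n p)) (f :: _ \<Rightarrow> real)"
  by (rule integrable_measure_pmf_finite[OF finite_column])

text \<open>Edges arise feature by feature, so many events are conjunctions over features; viewing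
  the incidences as independent columns turns their probabilities into products.\<close>

lemma incidences_columns:
  "incidences n m p =
     map_pmf (\<lambda>c (v, w). c w v) (Pi_pmf {1..m} (\<lambda>_. False) (\<lambda>_. feature_column n p))"
proof (rule pmf_eqI)
  fix \<omega> :: "nat \<times> nat \<Rightarrow> bool"
  let ?f = "\<lambda>c (v, w). c w v :: bool" and ?c = "\<lambda>w v. \<omega> (v, w)"
  have inj: "inj ?f" by (intro injI ext) (metis case_prod_conv)
  have "pmf (map_pmf ?f (Pi_pmf {1..m} (\<lambda>_. False) (\<lambda>_. feature_column n p))) \<omega> =
      pmf (map_pmf ?f (Pi_pmf {1..m} (\<lambda>_. False) (\<lambda>_. feature_column n p))) (?f ?c)"
    by (rule arg_cong[where f = "pmf _"]) auto
  also have "\<dots> = pmf (Pi_pmf {1..m} (\<lambda>_. False) (\<lambda>_. feature_column n p)) ?c" by (rule pmf_map_inj'[OF inj])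
  also have "\<dots> = pmf (incidences n m p) \<omega>"
  proof (cases "\<forall>x. x \<notin> {1..n} \<times> {1..m} \<longrightarrow> \<not> \<omega> x")
    case True
    have "pmf (Pi_pmf {1..m} (\<lambda>_. False) (\<lambda>_. feature_column n p)) ?c =
        (\<Prod>w\<in>{1..m}. \<Prod>v\<in>{1..n}. pmf (bernoulli_pmf p) (\<omega> (v, w)))"
      unfolding feature_column_def
    proof (subst pmf_Pi')
      show "(\<lambda>v. \<omega> (v, w)) = (\<lambda>_. False)" if "w \<notin> {1..m}" for w using that True by (auto simp: fun_eq_iff)
      show "(\<Prod>w\<in>{1..m}. pmf (Pi_pmf {1..n} False (\<lambda>_. bernoulli_pmf p)) (\<lambda>v. \<omega> (v, w))) =
          (\<Prod>w\<in>{1..m}. \<Prod>v\<in>{1..n}. pmf (bernoulli_pmf p) (\<omega> (v, w)))"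
        by (intro prod.cong refl pmf_Pi') (use True in auto)
    qed auto
    also have "\<dots> = (\<Prod>v\<in>{1..n}. \<Prod>w\<in>{1..m}. pmf (bernoulli_pmf p) (\<omega> (v, w)))" by (rule prod.swap)
    also have "\<dots> = (\<Prod>x\<in>{1..n} \<times> {1..m}. pmf (bernoulli_pmf p) (\<omega> x))"
      by (simp add: prod.cartesian_product case_prod_unfold)
    also have "\<dots> = pmf (incidences n m p) \<omega>"
      unfolding incidences_def by (rule pmf_Pi'[symmetric]) (use True in \<open>simp, blast\<close>)
    finally show ?thesis .
  next
    case False
    then obtain v w where vw: "(v, w) \<notin> {1..n} \<times> {1..m}" "\<omega> (v, w)" by auto
    have "pmf (incidences n m p) \<omega> = 0"
      unfolding incidences_def by (rule pmf_Pi_outside) (use vw in auto)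
    moreover have "pmf (Pi_pmf {1..m} (\<lambda>_. False) (\<lambda>_. feature_column n p)) ?c = 0"
    proof (cases "w \<in> {1..m}")
      case True
      then have "pmf (feature_column n p) (?c w) = 0"
        unfolding feature_column_def by (intro pmf_Pi_outside) (use vw in auto)
      then have "(\<Prod>w\<in>{1..m}. pmf (feature_column n p) (?c w)) = 0" using True by (intro prod_zero) auto
      then show ?thesis by (auto simp: pmf_Pi)
    next
      case False
      then show ?thesis by (intro pmf_Pi_outside) (use vw in \<open>auto simp: fun_eq_iff\<close>)
    qed
    ultimately show ?thesis by simp
  qed
  finally show "pmf (incidences n m p) \<omega> = pmf (map_pmf ?f (Pi_pmf {1..m} (\<lambda>_. False) (\<lambda>_. feature_column n p))) \<omega>"
    by simp
qed

lemma prob_columns: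
  "measure_pmf.prob (incidences n m p) {\<omega>. \<forall>w\<in>{1..m}. (\<lambda>v. \<omega> (v, w)) \<in> G w} =
     (\<Prod>w\<in>{1..m}. measure_pmf.prob (feature_column n p) (G w))"
proof -
  have "measure_pmf.prob (incidences n m p) {\<omega>. \<forall>w\<in>{1..m}. (\<lambda>v. \<omega> (v, w)) \<in> G w} =
      measure_pmf.prob (Pi_pmf {1..m} (\<lambda>_. False) (\<lambda>_. feature_column n p)) (Pi {1..m} G)"
    unfolding incidences_columns measure_map_pmf by (rule arg_cong[where f = "measure_pmf.prob _"]) (auto simp: Pi_def)
  then show ?thesis by (simp add: measure_Pi_pmf_Pi)
qed

lemma expectation_columns:
  assumes "\<And>w c. h w c \<ge> (0 :: real)"
  shows "measure_pmf.expectation (incidences n m p) (\<lambda>\<omega>. \<Prod>w\<in>{1..m}. h w (\<lambda>v. \<omega> (v, w))) =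
     (\<Prod>w\<in>{1..m}. measure_pmf.expectation (feature_column n p) (h w))"
  unfolding incidences_columns integral_map_pmf using assms
  by (simp add: expectation_prod_Pi_pmf)

lemma expectation_column:
  assumes "\<And>v b. f v b \<ge> (0 :: real)" "0 \<le> p" "p \<le> 1"
  shows "measure_pmf.expectation (feature_column n p) (\<lambda>c. \<Prod>v\<in>{1..n}. f v (c v)) =
     (\<Prod>v\<in>{1..n}. p * f v True + (1 - p) * f v False)"
  unfolding feature_column_def using assms
  by (subst expectation_prod_Pi_pmf) (auto intro!: integrable_measure_pmf_finite prod.cong simp: mult.commute)

section \<open>Missing edges between two sets of vertices\<close>

lemma prob_column_avoid:
  assumes "S \<subseteq> {1..n}" "0 \<le> p" "p \<le> 1"
  shows "measure_pmf.prob (feature_column n p) {c. \<forall>v\<in>S. \<not> c v} = (1 - p) ^ card S"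
proof -
  have "measure_pmf.prob (feature_column n p) {c. \<forall>v\<in>S. \<not> c v} =
      measure_pmf.prob (feature_column n p) (Pi {1..n} (\<lambda>v. if v \<in> S then {False} else UNIV))"
    by (rule arg_cong[where f = "measure_pmf.prob _"]) (use assms(1) in \<open>auto simp: Pi_def split: if_splits\<close>)
  also have "\<dots> = (\<Prod>v\<in>{1..n}. measure_pmf.prob (bernoulli_pmf p) (if v \<in> S then {False} else UNIV))"
    unfolding feature_column_def by (rule measure_Pi_pmf_Pi) simp
  also have "\<dots> = (\<Prod>v\<in>{1..n}. if v \<in> S then 1 - p else 1)"
    using assms(2,3) by (intro prod.cong) (auto simp: measure_pmf_single)
  also have "\<dots> = (1 - p) ^ card S"
    using assms(1) by (subst prod.If_cases) (auto simp: Int_absorb1)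
  finally show ?thesis .
qed

text \<open>Inclusion and exclusion gives \<open>a * (1 + b * (1 - a))\<close> for the powers
  \<open>a\<close> and \<open>b\<close> below. Then \<open>a\<close> is bounded by an exponential
  and \<open>1 - a\<close> by Bernoulli's inequality, so that the two exponents combine.\<close>

lemma prob_column_avoid_either:
  assumes S: "S \<subseteq> {1..n}" and R: "R \<subseteq> {1..n}" and "S \<inter> R = {}" "card S \<le> card R" and p: "0 \<le> p" "p \<le> 1"
  shows "measure_pmf.prob (feature_column n p) {c. (\<forall>v\<in>S. \<not> c v) \<or> (\<forall>v\<in>R. \<not> c v)}
    \<le> exp (- (p * real (card S) * (1 - (1 - p) ^ (card R - card S))))"
proof -
  define s r where "s = card S" and "r = card R"
  define a where "a = (1 - p) ^ s"
  define b where "b = (1 - p) ^ (r - s)"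
  have fin: "finite S" "finite R" using S R finite_subset by auto
  have U: "{c. (\<forall>v\<in>S. \<not> c v) \<or> (\<forall>v\<in>R. \<not> c v)} = {c. \<forall>v\<in>S. \<not> c v} \<union> {c. \<forall>v\<in>R. \<not> c v}" by auto
  have I: "{c. \<forall>v\<in>S. \<not> c v} \<inter> {c. \<forall>v\<in>R. \<not> c v} = {c. \<forall>v\<in>S \<union> R. \<not> c v}" by auto
  have "measure_pmf.prob (feature_column n p) {c. (\<forall>v\<in>S. \<not> c v) \<or> (\<forall>v\<in>R. \<not> c v)} =
    (1 - p) ^ s + (1 - p) ^ r - (1 - p) ^ (s + r)"
    unfolding U using S R assms(3) fin
    by (subst measure_Un3) (auto simp: I prob_column_avoid[OF _ p] s_def r_def card_Un_disjoint measure_pmf.fmeasurable_eq_sets)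
  also have "(1 - p) ^ r = a * b" unfolding a_def b_def using assms(4) by (simp add: s_def r_def flip: power_add)
  also have "(1 - p) ^ s + a * b - (1 - p) ^ (s + r) = a * (1 + b * (1 - a))"
    using \<open>(1 - p) ^ r = a * b\<close> by (simp add: power_add a_def[symmetric] algebra_simps)
  also have "\<dots> \<le> exp (- (p * real s)) * exp (b * (p * real s))"
  proof (rule mult_mono)
    have "a \<le> exp (-p) ^ s" unfolding a_def using exp_ge_add_one_self[of "-p"] p by (intro power_mono) auto
    then show "a \<le> exp (- (p * real s))" by (simp add: mult.commute flip: exp_of_nat_mult)
    have "1 - p * real s \<le> a" unfolding a_def using Bernoulli_inequality[of "-p" s] p by (simp add: mult.commute)
    then have "b * (1 - a) \<le> b * (p * real s)" using p by (intro mult_left_mono) (auto simp: b_def)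
    then show "1 + b * (1 - a) \<le> exp (b * (p * real s))" using exp_ge_add_one_self[of "b * (p * real s)"] by linarith
    show "0 \<le> 1 + b * (1 - a)" using p by (auto simp: a_def b_def power_le_one)
  qed simp
  also have "\<dots> = exp (- (p * real s * (1 - b)))" by (simp add: algebra_simps flip: exp_add)
  finally show ?thesis by (simp add: s_def r_def b_def)
qed

text \<open>Without an edge between \<open>S\<close> and \<open>R\<close>, every feature misses one
  of the two sets; features are independent.\<close>

lemma prob_no_edge:
  assumes S: "S \<subseteq> {1..n}" and R: "R \<subseteq> {1..n}" and dj: "S \<inter> R = {}" "card S \<le> card R" and p: "0 \<le> p" "p \<le> 1"
  shows "measure_pmf.prob (incidences n m p) {\<omega>. nbhd (rig_edges n m \<omega>) S \<inter> R = {}}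
    \<le> exp (- (real m * p * real (card S) * (1 - (1 - p) ^ (card R - card S))))"
proof -
  let ?G = "{c. (\<forall>v\<in>S. \<not> c v) \<or> (\<forall>v\<in>R. \<not> c v)}"
  have "measure_pmf.prob (incidences n m p) {\<omega>. nbhd (rig_edges n m \<omega>) S \<inter> R = {}} \<le>
      measure_pmf.prob (incidences n m p) {\<omega>. \<forall>w\<in>{1..m}. (\<lambda>v. \<omega> (v, w)) \<in> ?G}"
  proof (rule measure_pmf.finite_measure_mono)
    show "{\<omega>. nbhd (rig_edges n m \<omega>) S \<inter> R = {}} \<subseteq> {\<omega>. \<forall>w\<in>{1..m}. (\<lambda>v. \<omega> (v, w)) \<in> ?G}"
    proof (intro subsetI CollectI ballI, rule ccontr)
      fix \<omega> w assume h: "\<omega> \<in> {\<omega>. nbhd (rig_edges n m \<omega>) S \<inter> R = {}}" "w \<in> {1..m}"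
        "\<not> ((\<forall>v\<in>S. \<not> \<omega> (v, w)) \<or> (\<forall>v\<in>R. \<not> \<omega> (v, w)))"
      then obtain v u where vu: "v \<in> S" "\<omega> (v, w)" "u \<in> R" "\<omega> (u, w)" by blast
      then have "{v, u} \<in> rig_edges n m \<omega>" using S R dj(1) h(2) unfolding rig_edges_iff by blast
      then have "u \<in> nbhd (rig_edges n m \<omega>) S \<inter> R" using vu dj(1) unfolding nbhd_def by blast
      moreover have "nbhd (rig_edges n m \<omega>) S \<inter> R = {}" using h(1) by (rule CollectD)
      ultimately show False by blast
    qed
  qed simp
  also have "\<dots> = (\<Prod>w\<in>{1..m}. measure_pmf.prob (feature_column n p) ?G)" by (rule prob_columns)
  also have "\<dots> \<le> (\<Prod>w\<in>{1..m}. exp (- (p * real (card S) * (1 - (1 - p) ^ (card R - card S)))))"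
    by (rule prod_mono) (use prob_column_avoid_either[OF S R dj p] in simp)
  also have "\<dots> = exp (- (real m * p * real (card S) * (1 - (1 - p) ^ (card R - card S))))"
    by (simp add: mult.assoc flip: exp_of_nat_mult)
  finally show ?thesis .
qed

text \<open>Both coefficients are products over \<open>i < r\<close>, and the quotients
  \<open>(b - i) / (a - i)\<close> are bounded by their value at \<open>i = r\<close>.\<close>

lemma binomial_ratio_le:
  assumes "r < a" "a \<le> b"
  shows "real (b choose r) \<le> real (a choose r) * (real (b - r) / real (a - r)) ^ r"
proof -
  have le: "r \<le> a" "r \<le> b" using assms by auto
  have "real (b choose r) = (\<Prod>i = 0..<r. real (b - i) / real (r - i))"
    by (rule binomial_altdef_of_nat[OF le(2)])
  also have "\<dots> \<le> (\<Prod>i = 0..<r. (real (a - i) / real (r - i)) * (real (b - r) / real (a - r)))"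
  proof (rule prod_mono, intro conjI)
    fix i assume i: "i \<in> {0..<r}"
    have "real (b - i) * real (a - r) \<le> real (a - i) * real (b - r)"
    proof -
      have "(real b - i) * (real a - r) \<le> (real a - i) * (real b - r)"
        using assms i mult_right_mono[of "real i" "real r" "real b - real a"] by (simp add: algebra_simps)
      then show ?thesis using assms i by (simp add: of_nat_diff)
    qed
    then have "real (b - i) \<le> real (a - i) * (real (b - r) / real (a - r))"
      using assms by (simp add: field_simps)
    then have "real (b - i) / real (r - i) \<le> real (a - i) * (real (b - r) / real (a - r)) / real (r - i)"
      by (rule divide_right_mono) simp
    then show "real (b - i) / real (r - i) \<le> real (a - i) / real (r - i) * (real (b - r) / real (a - r))"
      by (simp only: times_divide_eq_left)
  qed simp
  also have "\<dots> = (\<Prod>i = 0..<r. real (a - i) / real (r - i)) * (real (b - r) / real (a - r)) ^ r"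
    by (simp only: prod.distrib prod_constant card_atLeastLessThan diff_zero)
  also have "(\<Prod>i = 0..<r. real (a - i) / real (r - i)) = real (a choose r)"
    by (rule binomial_altdef_of_nat[OF le(1), symmetric])
  finally show ?thesis .
qed

text \<open>If \<open>S\<close> has at most \<open>x\<close> neighbours, then a uniformly random \<open>r\<close>-subset of the remaining
  vertices misses them with a not too small probability; averaging over these subsets avoids a
  union bound over the possible neighbourhoods.\<close>

lemma prob_small_nbhd:
  assumes S: "S \<subseteq> {1..n}" and r: "card S \<le> r" "card S + x + r < n" and p: "0 \<le> p" "p \<le> 1"
  shows "measure_pmf.prob (incidences n m p) {\<omega>. card (nbhd (rig_edges n m \<omega>) S) \<le> x}
    \<le> exp (real r * real x / (real n - real (card S) - real x - real r)
         - real m * p * real (card S) * (1 - (1 - p) ^ (r - card S)))"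
proof -
  define s where "s = card S"
  define A where "A = {1..n} - S"
  define M where "M = incidences n m p"
  define N where "N \<omega> = nbhd (rig_edges n m \<omega>) S" for \<omega>
  define \<R> where "\<R> = {R. R \<subseteq> A \<and> card R = r}"
  define F where "F = {\<omega>. card (N \<omega>) \<le> x}"
  define e where "e = exp (- (real m * p * real s * (1 - (1 - p) ^ (r - s))))"
  have fS: "finite S" using S finite_subset by auto
  have cA: "card A = n - s" unfolding A_def s_def using S fS by (subst card_Diff_subset) auto
  have fA: "finite A" by (simp add: A_def)
  have fR: "finite \<R>" unfolding \<R>_def using fA by simp
  have cR: "card \<R> = (n - s) choose r" unfolding \<R>_def using n_subsets[OF fA, of r] cA by simp
  have NA: "N \<omega> \<subseteq> A" for \<omega> using nbhd_subset[OF graph_on_rig_edges, of n m \<omega> S] by (auto simp: N_def A_def nbhd_def)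
  have fN: "finite (N \<omega>)" for \<omega> using NA fA finite_subset by metis
  have count: "real ((n - s - x) choose r) * indicator F \<omega> \<le> (\<Sum>R\<in>\<R>. indicator {\<omega>. N \<omega> \<inter> R = {}} \<omega>)" for \<omega>
  proof (cases "\<omega> \<in> F")
    case True
    have "{R. R \<subseteq> A - N \<omega> \<and> card R = r} \<subseteq> {R \<in> \<R>. N \<omega> \<inter> R = {}}" by (auto simp: \<R>_def)
    then have "card {R. R \<subseteq> A - N \<omega> \<and> card R = r} \<le> card {R \<in> \<R>. N \<omega> \<inter> R = {}}"
      by (rule card_mono[rotated]) (use fR in simp)
    moreover have "card {R. R \<subseteq> A - N \<omega> \<and> card R = r} = (n - s - card (N \<omega>)) choose r"
      using n_subsets[of "A - N \<omega>" r] fA cA card_Diff_subset[OF fN NA] by simp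
    moreover have "((n - s - x) choose r) \<le> ((n - s - card (N \<omega>)) choose r)"
      using True by (intro binomial_right_mono) (auto simp: F_def)
    moreover have "(\<Sum>R\<in>\<R>. indicator {\<omega>. N \<omega> \<inter> R = {}} \<omega> :: real) = real (card {R \<in> \<R>. N \<omega> \<inter> R = {}})"
      using fR by (simp add: indicator_def sum.If_cases Int_def)
    ultimately show ?thesis using True by simp
  qed (simp add: sum_nonneg)
  have "real ((n - s - x) choose r) * measure_pmf.prob M F =
      measure_pmf.expectation M (\<lambda>\<omega>. real ((n - s - x) choose r) * indicator F \<omega>)" by simp
  also have "\<dots> \<le> measure_pmf.expectation M (\<lambda>\<omega>. \<Sum>R\<in>\<R>. indicator {\<omega>. N \<omega> \<inter> R = {}} \<omega>)"
    unfolding M_def by (rule integral_mono) (use count in auto)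
  also have "\<dots> = (\<Sum>R\<in>\<R>. measure_pmf.prob M {\<omega>. N \<omega> \<inter> R = {}})"
    unfolding M_def by (subst Bochner_Integration.integral_sum) auto
  also have "\<dots> \<le> (\<Sum>R\<in>\<R>. e)"
  proof (rule sum_mono)
    fix R assume "R \<in> \<R>"
    then have "R \<subseteq> {1..n}" "S \<inter> R = {}" "card R = r" by (auto simp: \<R>_def A_def)
    then show "measure_pmf.prob M {\<omega>. N \<omega> \<inter> R = {}} \<le> e"
      using prob_no_edge[OF S _ _ _ p, of R m] r(1) by (simp add: M_def N_def e_def s_def)
  qed
  also have "\<dots> = real ((n - s) choose r) * e" using cR by simp
  also have "\<dots> \<le> real ((n - s - x) choose r) * (real (n - s - r) / real (n - s - x - r)) ^ r * e"
    by (intro mult_right_mono binomial_ratio_le) (use r in \<open>auto simp: s_def e_def\<close>)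
  finally have "real ((n - s - x) choose r) * measure_pmf.prob M F \<le>
      real ((n - s - x) choose r) * ((real (n - s - r) / real (n - s - x - r)) ^ r * e)"
    by (simp only: mult.assoc)
  moreover have "0 < real ((n - s - x) choose r)" using r by (simp add: s_def zero_less_binomial_iff)
  ultimately have "measure_pmf.prob M F \<le> (real (n - s - r) / real (n - s - x - r)) ^ r * e"
    by (simp only: mult_le_cancel_left_pos)
  also have "\<dots> \<le> exp (real x / (real n - real s - real x - real r)) ^ r * e"
  proof (intro mult_right_mono power_mono)
    have "real (n - s - r) / real (n - s - x - r) = 1 + real x / (real n - real s - real x - real r)"
      using r by (simp add: s_def of_nat_diff field_simps)
    then show "real (n - s - r) / real (n - s - x - r) \<le> exp (real x / (real n - real s - real x - real r))"
      using exp_ge_add_one_self by simp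
  qed (auto simp: e_def)
  also have "\<dots> = exp (real r * real x / (real n - real s - real x - real r)
         - real m * p * real s * (1 - (1 - p) ^ (r - s)))"
    by (simp add: e_def mult_exp_exp flip: exp_of_nat_mult)
  finally show ?thesis by (simp add: M_def F_def N_def s_def)
qed

text \<open>An exponential moment bound: the neighbours of \<open>v\<close> are covered by the
  features of \<open>v\<close>, so \<open>z\<close> to the power of the degree is at most a product
  over features, whose expectation factorises.\<close>

lemma prob_large_degree:
  assumes v: "v \<in> {1..n}" and p: "0 \<le> p" "p \<le> 1"
  shows "measure_pmf.prob (incidences n m p) {\<omega>. \<Delta> \<le> real (card (nbhd (rig_edges n m \<omega>) {v}))}
    \<le> exp (2 * real n * real m * p\<^sup>2 - \<Delta> / (2 * (1 + real n * p)))"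
proof -
  define \<mu> where "\<mu> = real n * p"
  \<comment> \<open>The tilt is chosen with \<open>\<mu> * y <= 1\<close>, so that
    \<open>exp (\<mu> * y)\<close> is at most \<open>1 + 2 * \<mu> * y\<close>; a fixed tilt would
    be exponentially expensive for large \<open>\<mu>\<close>.\<close>
  define y where "y = 1 / (1 + \<mu>)"
  define z where "z = 1 + y"
  define M where "M = incidences n m p"
  define h where "h c = (if c v then \<Prod>u\<in>{1..n}. if u \<noteq> v \<and> c u then z else 1 else 1 :: real)" for c
  have \<mu>: "\<mu> \<ge> 0" using p by (simp add: \<mu>_def)
  have y: "0 < y" "y \<le> 1" using \<mu> by (auto simp: y_def)
  have z1: "z \<ge> 1" using y by (simp add: z_def)
  have h0: "h c \<ge> 0" for c unfolding h_def using z1 by (auto intro!: prod_nonneg)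
  have z_exp: "exp (y / 2) \<le> z"
    using exp_bound_half[of "y / 2"] y exp_bound_lemma[of "y/2"] by (simp add: z_def)
  have deg: "z ^ card (nbhd (rig_edges n m \<omega>) {v}) \<le> (\<Prod>w\<in>{1..m}. h (\<lambda>v. \<omega> (v, w)))" for \<omega>
  proof -
    define Y where "Y w = (if \<omega> (v, w) then {u\<in>{1..n}. u \<noteq> v \<and> \<omega> (u, w)} else {})" for w
    have "nbhd (rig_edges n m \<omega>) {v} \<subseteq> (\<Union>w\<in>{1..m}. Y w)"
      unfolding nbhd_def Y_def by (auto simp: rig_edges_iff)
    then have "card (nbhd (rig_edges n m \<omega>) {v}) \<le> card (\<Union>w\<in>{1..m}. Y w)"
      by (intro card_mono) (auto simp: Y_def)
    also have "\<dots> \<le> (\<Sum>w\<in>{1..m}. card (Y w))" by (intro card_UN_le) simp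
    finally have "z ^ card (nbhd (rig_edges n m \<omega>) {v}) \<le> z ^ (\<Sum>w\<in>{1..m}. card (Y w))"
      using z1 by (intro power_increasing)
    also have "\<dots> = (\<Prod>w\<in>{1..m}. z ^ card (Y w))" by (simp add: power_sum)
    also have "\<dots> = (\<Prod>w\<in>{1..m}. h (\<lambda>v. \<omega> (v, w)))"
    proof (rule prod.cong[OF refl])
      fix w
      have "(\<Prod>u\<in>{1..n}. if u \<noteq> v \<and> \<omega> (u, w) then z else 1) = z ^ card {u\<in>{1..n}. u \<noteq> v \<and> \<omega> (u, w)}"
        by (subst prod.If_cases) (auto simp: Int_def)
      then show "z ^ card (Y w) = h (\<lambda>v. \<omega> (v, w))" by (simp add: h_def Y_def)
    qed
    finally show ?thesis .
  qed
  have col: "measure_pmf.expectation (feature_column n p) h \<le> exp (2 * p * \<mu>)"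
  proof -
    \<comment> \<open>Splitting by the value of \<open>c v\<close> writes \<open>h\<close> as a sum
      of two products over vertices, to each of which \<open>expectation_column\<close>
      applies.\<close>
    have "h c = (\<Prod>u\<in>{1..n}. if u = v then (if c u then 0 else 1) else 1) +
        (\<Prod>u\<in>{1..n}. if u = v then (if c u then 1 else 0) else (if c u then z else 1))" for c
    proof (cases "c v")
      case True
      then show ?thesis using v by (auto simp: h_def intro!: prod.cong)
    next
      case False
      then have "(\<Prod>u\<in>{1..n}. if u = v then (if c u then 1 else 0) else (if c u then z else 1 :: real)) = 0"
        using v by (intro prod_zero) auto
      moreover have "(\<Prod>u\<in>{1..n}. if u = v then (if c u then 0 else 1) else 1 :: real) = 1"
        using False by (intro prod.neutral) auto
      ultimately show ?thesis using False by (simp add: h_def)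
    qed
    then have "measure_pmf.expectation (feature_column n p) h = measure_pmf.expectation (feature_column n p) (\<lambda>c.
        (\<Prod>u\<in>{1..n}. if u = v then (if c u then 0 else 1) else 1) +
        (\<Prod>u\<in>{1..n}. if u = v then (if c u then 1 else 0) else (if c u then z else 1)))"
      by (intro arg_cong[where f = "measure_pmf.expectation _"] ext)
    also have "\<dots> =
      measure_pmf.expectation (feature_column n p) (\<lambda>c. \<Prod>u\<in>{1..n}. if u = v then (if c u then 0 else 1) else 1) +
      measure_pmf.expectation (feature_column n p) (\<lambda>c. \<Prod>u\<in>{1..n}. if u = v then (if c u then 1 else 0) else (if c u then z else 1))"
      by (rule Bochner_Integration.integral_add) (rule integrable_column)+
    also have "measure_pmf.expectation (feature_column n p) (\<lambda>c. \<Prod>u\<in>{1..n}. if u = v then (if c u then 0 else 1) else 1) =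
        (\<Prod>u\<in>{1..n}. p * (if u = v then (if True then 0 else 1) else 1) + (1 - p) * (if u = v then (if False then 0 else 1) else 1))"
      by (rule expectation_column[where f = "\<lambda>u b. if u = v then (if b then 0 else 1) else 1"]) (use p in auto)
    also have "\<dots> = (\<Prod>u\<in>{1..n}. if u = v then 1 - p else 1)" by (rule prod.cong) auto
    also have "\<dots> = 1 - p" using v by (simp add: prod.If_cases)
    also have "measure_pmf.expectation (feature_column n p) (\<lambda>c. \<Prod>u\<in>{1..n}. if u = v then (if c u then 1 else 0) else (if c u then z else 1)) =
        (\<Prod>u\<in>{1..n}. if u = v then p else 1 + p * y)"
      by (subst expectation_column[where f = "\<lambda>u b. if u = v then (if b then 1 else 0) else (if b then z else 1)"])
        (use p z1 in \<open>auto intro!: prod.cong simp: z_def algebra_simps\<close>)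
    also have "\<dots> = p * (1 + p * y) ^ (n - 1)"
    proof -
      have "{1..n} \<inter> {u. u = v} = {v}" "{1..n} \<inter> - {u. u = v} = {1..n} - {v}" using v by auto
      then show ?thesis using v by (subst prod.If_cases) auto
    qed
    finally have E: "measure_pmf.expectation (feature_column n p) h = 1 - p + p * (1 + p * y) ^ (n - 1)" .
    have "(1 + p * y) ^ (n - 1) \<le> (1 + p * y) ^ n" using p y by (intro power_increasing) auto
    also have "\<dots> \<le> exp (p * y) ^ n" using p y exp_ge_add_one_self[of "p * y"] by (intro power_mono) auto
    also have "\<dots> = exp (\<mu> * y)" by (simp add: \<mu>_def algebra_simps flip: exp_of_nat_mult)
    also have "\<dots> \<le> 1 + 2 * (\<mu> * y)"
      using exp_bound[of "\<mu> * y"] \<mu> y mult_left_mono[of "\<mu> * y" 1 "\<mu> * y"]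
      by (simp add: y_def power2_eq_square divide_le_eq_1 add_nonneg_eq_0_iff)
    also have "\<dots> \<le> 1 + 2 * \<mu>" using \<mu> y mult_left_mono[of y 1 \<mu>] by simp
    finally have "measure_pmf.expectation (feature_column n p) h \<le> 1 - p + p * (1 + 2 * \<mu>)"
      unfolding E using p by (intro add_left_mono mult_left_mono) auto
    also have "\<dots> \<le> exp (2 * p * \<mu>)" using exp_ge_add_one_self[of "2 * p * \<mu>"] by (simp add: algebra_simps)
    finally show ?thesis .
  qed
  have "exp (\<Delta> * y / 2) * measure_pmf.prob M {\<omega>. \<Delta> \<le> real (card (nbhd (rig_edges n m \<omega>) {v}))} =
     measure_pmf.expectation M (\<lambda>\<omega>. exp (\<Delta> * y / 2) * indicator {\<omega>. \<Delta> \<le> real (card (nbhd (rig_edges n m \<omega>) {v}))} \<omega>)"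
    by simp
  also have "\<dots> \<le> measure_pmf.expectation M (\<lambda>\<omega>. \<Prod>w\<in>{1..m}. h (\<lambda>v. \<omega> (v, w)))"
    unfolding M_def
  proof (rule integral_mono)
    fix \<omega>
    show "exp (\<Delta> * y / 2) * indicator {\<omega>. \<Delta> \<le> real (card (nbhd (rig_edges n m \<omega>) {v}))} \<omega> \<le> (\<Prod>w\<in>{1..m}. h (\<lambda>v. \<omega> (v, w)))"
    proof (cases "\<Delta> \<le> real (card (nbhd (rig_edges n m \<omega>) {v}))")
      case True
      then have "\<Delta> * y / 2 \<le> real (card (nbhd (rig_edges n m \<omega>) {v})) * (y / 2)" using y by (simp add: mult_right_mono)
      then have "exp (\<Delta> * y / 2) \<le> exp (y / 2) ^ card (nbhd (rig_edges n m \<omega>) {v})"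
        by (simp flip: exp_of_nat_mult)
      also have "\<dots> \<le> z ^ card (nbhd (rig_edges n m \<omega>) {v})" using z_exp by (intro power_mono) auto
      also note deg
      finally show ?thesis using True by simp
    qed (simp add: h0 prod_nonneg)
  qed simp_all
  also have "\<dots> = (\<Prod>w\<in>{1..m}. measure_pmf.expectation (feature_column n p) h)"
    unfolding M_def by (rule expectation_columns) (rule h0)
  also have "\<dots> \<le> (\<Prod>w\<in>{1..m}. exp (2 * p * \<mu>))"
    by (rule prod_mono) (use col h0 in \<open>auto intro!: Bochner_Integration.integral_nonneg\<close>)
  also have "\<dots> = exp (2 * real n * real m * p\<^sup>2)"
    by (simp add: \<mu>_def power2_eq_square algebra_simps flip: exp_of_nat_mult)
  finally have "measure_pmf.prob M {\<omega>. \<Delta> \<le> real (card (nbhd (rig_edges n m \<omega>) {v}))} \<le>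
      exp (2 * real n * real m * p\<^sup>2) / exp (\<Delta> * y / 2)" by (simp add: field_simps)
  also have "\<dots> = exp (2 * real n * real m * p\<^sup>2 - \<Delta> / (2 * (1 + real n * p)))"
    by (simp add: exp_diff y_def \<mu>_def)
  finally show ?thesis by (simp add: M_def)
qed

text \<open>The map sending \<open>k\<close> to \<open>1 - q ^ k\<close> is concave and vanishes at
  0, so its quotient by \<open>k\<close> decreases.\<close>

lemma geometric_concave:
  fixes q :: real
  assumes "0 \<le> q" "q \<le> 1" "r \<le> n"
  shows "real r * (1 - q ^ n) \<le> real n * (1 - q ^ r)"
  using assms(3)
proof (induction n rule: dec_induct)
  case (step k)
  have "real r * q ^ k * (1 - q) \<le> real r * q ^ r * (1 - q)"
    using assms(1,2) step.hyps by (intro mult_right_mono mult_left_mono power_decreasing) auto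
  also have "real r * q ^ r * (1 - q) \<le> 1 - q ^ r"
  proof (induction r)
    case (Suc r)
    have "q * (real r * q ^ r * (1 - q)) \<le> q * (1 - q ^ r)" using Suc assms(1) by (rule mult_left_mono)
    moreover have "q ^ Suc r * (1 - q) \<le> 1 * (1 - q)"
      using assms by (intro mult_right_mono power_le_one) auto
    ultimately show ?case by (simp add: algebra_simps)
  qed simp
  finally show ?case using step.IH by (simp add: algebra_simps)
qed simp

lemma one_minus_power_ge:
  fixes p :: real
  assumes "0 \<le> p" "p \<le> 1" "t \<le> p * real k" "0 \<le> t"
  shows "t / (1 + t) \<le> 1 - (1 - p) ^ k" "1 - exp (- t) \<le> 1 - (1 - p) ^ k"
proof -
  have "(1 - p) ^ k \<le> exp (-p) ^ k" using exp_ge_add_one_self[of "-p"] assms by (intro power_mono) auto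
  also have "\<dots> = exp (- (p * real k))" by (simp add: mult.commute flip: exp_of_nat_mult)
  also have "\<dots> \<le> exp (- t)" using assms by simp
  finally show 1: "1 - exp (- t) \<le> 1 - (1 - p) ^ k" by simp
  have "exp (- t) \<le> 1 / (1 + t)"
    using exp_ge_add_one_self[of t] assms by (simp add: exp_minus field_simps)
  moreover have "t / (1 + t) = 1 - 1 / (1 + t)" using assms by (simp add: field_simps)
  ultimately show "t / (1 + t) \<le> 1 - (1 - p) ^ k" using 1 by linarith
qed

text \<open>\<open>intensity\<close> is the exponent of the probability that a given vertex is isolated.\<close>

definition intensity :: "nat \<Rightarrow> nat \<Rightarrow> real \<Rightarrow> real" where
  "intensity n m p = real m * p * (1 - (1 - p) ^ (n - 1))"

text \<open>The input value \<open>d\<close> of HAM; it is an upper bound for the expected degree of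
  a vertex.\<close>

definition eff_degree :: "nat \<Rightarrow> nat \<Rightarrow> real \<Rightarrow> real" where
  "eff_degree n m p = real n * real m * p\<^sup>2"

text \<open>Up to the size of \<open>S\<close>, \<open>r\<close> is the size of the random test set
  in \<open>prob_small_nbhd\<close>. It must reach nearly all of the intensity, yet the averaging
  cost, proportional to \<open>r * d / n\<close>, must stay comparable to the intensity. If
  \<open>n * p\<close> is at most 10, then \<open>d\<close> and the intensity are comparable and
  almost all vertices are taken; otherwise about \<open>5 / p\<close> vertices suffice, because
  \<open>exp (-5)\<close> is at most 1/100.\<close>

lemma sample_size:
  assumes p: "0 < p" "p < 1" and n: "n \<ge> 5000"
  shows "\<exists>r. real r \<le> 99 / 100 * real n + 1 \<and>
    99 / 100 * intensity n m p \<le> real m * p * (1 - (1 - p) ^ r) \<and>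
    real r * eff_degree n m p \<le> 22 * real n * intensity n m p"
proof (cases "real n * p \<le> 10")
  case True
  define r where "r = nat \<lceil>99 / 100 * real n\<rceil>"
  have r: "99 / 100 * real n \<le> real r" "real r \<le> 99 / 100 * real n + 1" unfolding r_def by linarith+
  have rn: "r \<le> n" using r(2) n by linarith
  have "99 / 100 * (1 - (1 - p) ^ (n - 1)) \<le> 99 / 100 * (1 - (1 - p) ^ n)"
    using p by (intro mult_left_mono diff_left_mono power_decreasing) auto
  also have "\<dots> \<le> 1 - (1 - p) ^ r"
  proof -
    have "99 / 100 * real n * (1 - (1 - p) ^ n) \<le> real r * (1 - (1 - p) ^ n)"
      using p by (intro mult_right_mono[OF r(1)]) (simp add: power_le_one)
    also have "\<dots> \<le> real n * (1 - (1 - p) ^ r)" using geometric_concave[of "1 - p" r n] p rn by simp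
    finally have "real n * (99 / 100 * (1 - (1 - p) ^ n)) \<le> real n * (1 - (1 - p) ^ r)" by (simp only: mult_ac)
    moreover have "0 < real n" using n by simp
    ultimately show ?thesis by (simp only: mult_le_cancel_left_pos)
  qed
  finally have 1: "99 / 100 * (1 - (1 - p) ^ (n - 1)) \<le> 1 - (1 - p) ^ r" .
  define t where "t = real n * p / 2"
  have t: "0 \<le> t" "t \<le> 5" using True p by (auto simp: t_def)
  have "t \<le> p * real (n - 1)" using p n by (simp add: t_def of_nat_diff field_simps)
  then have "t / (1 + t) \<le> 1 - (1 - p) ^ (n - 1)" using one_minus_power_ge(1)[of p t "n - 1"] p t by simp
  moreover have "t / 11 \<le> t / (1 + t)" using t by (intro divide_left_mono) auto
  ultimately have "t / 11 \<le> 1 - (1 - p) ^ (n - 1)" by linarith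
  then have "real n * p \<le> 22 * (1 - (1 - p) ^ (n - 1))" by (simp add: t_def)
  then have "real m * p * (real n * p) \<le> real m * p * (22 * (1 - (1 - p) ^ (n - 1)))"
    using p by (intro mult_left_mono) auto
  then have d: "eff_degree n m p \<le> 22 * intensity n m p"
    by (simp add: eff_degree_def intensity_def power2_eq_square algebra_simps)
  have "real r * eff_degree n m p \<le> real n * eff_degree n m p"
    using rn p by (intro mult_right_mono) (auto simp: eff_degree_def)
  also have "\<dots> \<le> real n * (22 * intensity n m p)" using d by (intro mult_left_mono) auto
  finally have 2: "real r * eff_degree n m p \<le> 22 * real n * intensity n m p" by simp
  have "99 / 100 * intensity n m p = real m * p * (99 / 100 * (1 - (1 - p) ^ (n - 1)))"
    by (simp add: intensity_def)
  then have "99 / 100 * intensity n m p \<le> real m * p * (1 - (1 - p) ^ r)"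
    using mult_left_mono[OF 1, of "real m * p"] p by simp
  then show ?thesis using r(2) 2 by blast
next
  case False
  define r where "r = nat \<lceil>5 / p\<rceil>"
  have "0 \<le> 5 / p" using p by simp
  then have r: "5 / p \<le> real r" "real r \<le> 5 / p + 1" unfolding r_def by linarith+
  have "5 / p \<le> real n / 2" using False p by (simp add: field_simps)
  then have rn: "real r \<le> 99 / 100 * real n + 1" using r(2) by linarith
  have e5: "exp (-5 :: real) \<le> 1 / 100"
  proof -
    have "(100 :: real) \<le> (1 + 5/8 + (5/8)\<^sup>2 / 2) ^ 8" by (simp add: power_divide power2_eq_square)
    also have "\<dots> \<le> exp (5/8) ^ 8" by (intro power_mono exp_lower_Taylor_quadratic) auto
    also have "\<dots> = exp (5 :: real)" by (simp flip: exp_of_nat_mult)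
    finally have "100 \<le> exp (5 :: real)" .
    then show ?thesis by (simp add: exp_minus field_simps)
  qed
  have "5 \<le> p * real r" using r(1) p by (simp add: field_simps)
  then have 1: "99 / 100 \<le> 1 - (1 - p) ^ r" using one_minus_power_ge(2)[of p 5 r] p e5 by linarith
  have "5 \<le> p * real (n - 1)" using False p n
  proof -
    have "p * real (n - 1) \<ge> p * (real n / 2)" using n p by (intro mult_left_mono) auto
    moreover have "5 \<le> p * (real n / 2)" using False by (simp add: mult.commute)
    ultimately show ?thesis by (rule order_trans[rotated])
  qed
  then have 2: "99 / 100 \<le> 1 - (1 - p) ^ (n - 1)" using one_minus_power_ge(2)[of p 5 "n - 1"] p e5 by linarith
  have le1: "1 - (1 - p) ^ (n - 1) \<le> 1" using p by simp
  have "99 / 100 * intensity n m p \<le> real m * p * (99 / 100)"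
    using mult_left_mono[OF le1, of "real m * p"] p by (simp add: intensity_def algebra_simps)
  also have "\<dots> \<le> real m * p * (1 - (1 - p) ^ r)" using 1 p by (intro mult_left_mono) auto
  finally have 3: "99 / 100 * intensity n m p \<le> real m * p * (1 - (1 - p) ^ r)" .
  have "real r * p \<le> 6" 
  proof -
    have "real r * p \<le> (5 / p + 1) * p" using r(2) p by (intro mult_right_mono) auto
    also have "\<dots> = 5 + p" using p by (simp add: distrib_right)
    finally show ?thesis using p by simp
  qed
  then have "real r * p * (real n * (real m * p)) \<le> 6 * (real n * (real m * p))"
    using p by (intro mult_right_mono) auto
  also have "\<dots> \<le> 22 * (real n * (real m * p * (99 / 100)))" using p by simp
  also have "\<dots> \<le> 22 * (real n * intensity n m p)"
    using 2 p unfolding intensity_def by (intro mult_left_mono) auto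
  finally have "real r * eff_degree n m p \<le> 22 * real n * intensity n m p"
    by (simp add: eff_degree_def power2_eq_square algebra_simps)
  then show ?thesis using rn 3 by blast
qed

text \<open>The negation of the expansion condition of \<open>expander\<close> for
  \<open>c = 1 / 10 ^ 6\<close>, as an event that is decreasing in the edges.\<close>

definition sparse_nbhd :: "nat \<Rightarrow> real \<Rightarrow> nat set set \<Rightarrow> nat set \<Rightarrow> bool" where
  "sparse_nbhd n d E S \<longleftrightarrow> real (card (nbhd E S)) \<le> 1 / 10 ^ 6 * min (d * real (card S)) (real n)"

text \<open>The exponent loses 1/100 in passing to the test set of \<open>sample_size\<close> and
  another 1/100 to the averaging cost in \<open>prob_small_nbhd\<close>, which is small owing to the
  factor \<open>1 / 10 ^ 6\<close>.\<close>

lemma prob_sparse: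
  assumes p: "0 < p" "p < 1" and n: "n \<ge> 5000" and \<rho>: "1 \<le> intensity n m p"
    and S: "S \<subseteq> {1..n}" "real (card S) \<le> real n / 800"
  shows "measure_pmf.prob (incidences n m p) {\<omega>. sparse_nbhd n (eff_degree n m p) (rig_edges n m \<omega>) S}
    \<le> exp (- (98 / 100 * intensity n m p * real (card S)))"
proof -
  define s \<rho> d where "s = real (card S)" and "\<rho> = intensity n m p" and "d = eff_degree n m p"
  have d0: "0 \<le> d" using p by (simp add: d_def eff_degree_def)
  have s0: "0 \<le> s" by (simp add: s_def)
  obtain r where r: "real r \<le> 99 / 100 * real n + 1"
    "99 / 100 * \<rho> \<le> real m * p * (1 - (1 - p) ^ r)" "real r * d \<le> 22 * real n * \<rho>"
    using sample_size[OF p n, of m] by (auto simp: \<rho>_def d_def)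
  define B where "B = 1 / 10 ^ 6 * min (d * s) (real n)"
  define x where "x = nat \<lfloor>B\<rfloor>"
  have B0: "0 \<le> B" using d0 s0 by (simp add: B_def)
  have xB: "real x \<le> B" using B0 by (simp add: x_def)
  have x1: "real x \<le> d * s / 10 ^ 6" "real x \<le> real n / 10 ^ 6"
    using xB by (auto simp: B_def min_def split: if_splits)
  \<comment> \<open>The test set is enlarged by \<open>card S\<close>, since
    \<open>prob_small_nbhd\<close> has \<open>r - card S\<close> in the exponent.\<close>
  define R where "R = card S + r"
  have sn: "s \<le> real n / 800" using S(2) by (simp add: s_def)
  \<comment> \<open>The test set leaves about n/100 vertices; the bound \<open>n / 800\<close> on
    \<open>card S\<close>, which is subtracted twice, preserves half of them.\<close>
  have den: "real n / 200 \<le> real n - s - real x - real R"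
    using r(1) x1(2) sn n by (simp add: R_def s_def)
  have Rn: "card S + x + R < n"
  proof -
    have "real (card S + x + R) < real n" using den n by (simp add: s_def)
    then show ?thesis by linarith
  qed
  have ev: "{\<omega>. sparse_nbhd n (eff_degree n m p) (rig_edges n m \<omega>) S} = {\<omega>. card (nbhd (rig_edges n m \<omega>) S) \<le> x}"
    using B0 by (auto simp: sparse_nbhd_def x_def B_def s_def d_def le_nat_iff le_floor_iff)
  have "measure_pmf.prob (incidences n m p) {\<omega>. card (nbhd (rig_edges n m \<omega>) S) \<le> x} \<le>
     exp (real R * real x / (real n - real (card S) - real x - real R)
         - real m * p * real (card S) * (1 - (1 - p) ^ (R - card S)))"
    by (rule prob_small_nbhd) (use S Rn p in \<open>auto simp: R_def\<close>)
  also have "\<dots> \<le> exp (- (98 / 100 * \<rho> * s))"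
  proof -
    have "real R * real x / (real n - s - real x - real R) \<le> real R * real x / (real n / 200)"
      using den n by (intro divide_left_mono) auto
    also have "\<dots> = 200 * (s * real x + real r * real x) / real n" by (simp add: R_def s_def algebra_simps)
    also have "\<dots> \<le> 200 * (s * (real n / 10 ^ 6) + 22 * real n * \<rho> * s / 10 ^ 6) / real n"
    proof -
      have "real r * real x \<le> real r * (d * s / 10 ^ 6)" using x1 by (intro mult_left_mono) auto
      also have "\<dots> \<le> 22 * real n * \<rho> * s / 10 ^ 6" using mult_right_mono[OF r(3) s0] by (simp add: mult_ac)
      finally have rx: "real r * real x \<le> 22 * real n * \<rho> * s / 10 ^ 6" .
      have sx: "s * real x \<le> s * (real n / 10 ^ 6)" using x1 s0 by (intro mult_left_mono) auto
      have "200 * (s * real x + real r * real x) \<le> 200 * (s * (real n / 10 ^ 6) + 22 * real n * \<rho> * s / 10 ^ 6)"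
        by (rule mult_left_mono[OF add_mono[OF sx rx]]) simp
      then show ?thesis by (rule divide_right_mono) simp
    qed
    also have "\<dots> = 200 * s / 10 ^ 6 + 4400 * (\<rho> * s) / 10 ^ 6" using n by (simp add: field_simps)
    also have "\<dots> \<le> 1 / 100 * (\<rho> * s)" using mult_right_mono[OF \<rho>[folded \<rho>_def] s0] s0 by simp
    also have "1 / 100 * (\<rho> * s) = 1 / 100 * \<rho> * s" by simp
    finally have 1: "real R * real x / (real n - s - real x - real R) \<le> 1 / 100 * \<rho> * s" .
    have "99 / 100 * \<rho> * s \<le> real m * p * (1 - (1 - p) ^ r) * s" using r(2) s0 by (rule mult_right_mono)
    also have "\<dots> = real m * p * s * (1 - (1 - p) ^ (R - card S))" by (simp add: R_def)
    finally have 2: "99 / 100 * \<rho> * s \<le> real m * p * s * (1 - (1 - p) ^ (R - card S))" .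
    have "a - b \<le> - (98 / 100 * \<rho> * s)" if "a \<le> 1 / 100 * \<rho> * s" "99 / 100 * \<rho> * s \<le> b" for a b
      using that by simp
    from this[OF 1 2] show ?thesis by (simp only: exp_le_cancel_iff s_def)
  qed
  finally show ?thesis unfolding ev by (simp add: s_def \<rho>_def)
qed

text \<open>The exponent has to be of order \<open>m * n * p\<close> to beat 2^n choices of
  \<open>U\<close>, even if \<open>m\<close> is much smaller than \<open>n\<close>. If the expected
  number of members of \<open>U\<close> per feature is bounded, an exponential tilt of 1 is enough;
  if it is large, a tilt \<open>\<theta>\<close> proportional to it is needed, because the number of
  features met cannot exceed \<open>m\<close>.\<close>

lemma prob_few_features:
  assumes p: "0 < p" "p < 1" and n: "n \<ge> 1" and \<gamma>: "0 < \<gamma>" "\<gamma> \<le> 1"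
    and U: "U \<subseteq> {1..n}" "\<gamma> * real n \<le> real (card U)"
  shows "measure_pmf.prob (incidences n m p)
      {\<omega>. real (card {w\<in>{1..m}. \<exists>u\<in>U. \<omega> (u, w)}) \<le> \<gamma> / 36 * real m * min 1 (real n * p)}
    \<le> exp (- (\<gamma> / 36 * real m * (real n * p)))"
proof -
  define \<mu> where "\<mu> = real n * p"
  define J where "J = \<gamma> / 36 * real m * min 1 \<mu>"
  define M where "M = incidences n m p"
  define N where "N \<omega> = card {w\<in>{1..m}. \<exists>u\<in>U. \<omega> (u, w)}" for \<omega> :: "nat \<times> nat \<Rightarrow> bool"
  define a where "a = (1 - p) ^ card U"
  have \<mu>: "\<mu> > 0" using p n by (simp add: \<mu>_def)
  have a: "0 \<le> a" "a \<le> 1" using p by (auto simp: a_def power_le_one)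
  have pu: "\<gamma> * \<mu> \<le> p * real (card U)" using mult_left_mono[OF U(2), of p] p by (simp add: \<mu>_def algebra_simps)
  note ge = one_minus_power_ge[of p "\<gamma> * \<mu>" "card U", folded a_def]
  have gen: "measure_pmf.prob M {\<omega>. real (N \<omega>) \<le> J} \<le> exp (\<theta> * J) * (exp (- \<theta>) + (1 - exp (- \<theta>)) * a) ^ m"
    if \<theta>: "\<theta> \<ge> 0" for \<theta>
  proof -
    define h where "h c = (if \<exists>u\<in>U. c u then exp (- \<theta>) else 1)" for c :: "nat \<Rightarrow> bool"
    have h0: "h c \<ge> 0" for c by (simp add: h_def)
    have prodh: "(\<Prod>w\<in>{1..m}. h (\<lambda>v. \<omega> (v, w))) = exp (- (\<theta> * real (N \<omega>)))" for \<omega>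
    proof -
      have "(\<Prod>w\<in>{1..m}. h (\<lambda>v. \<omega> (v, w))) = exp (- \<theta>) ^ N \<omega>"
        unfolding h_def N_def by (subst prod.If_cases) (auto simp: Int_def)
      then show ?thesis by (simp add: mult.commute flip: exp_of_nat_mult)
    qed
    have "h = (\<lambda>c. exp (- \<theta>) + (1 - exp (- \<theta>)) * indicator {c. \<forall>u\<in>U. \<not> c u} c)"
      by (auto simp: h_def fun_eq_iff)
    then have "measure_pmf.expectation (feature_column n p) h =
      measure_pmf.expectation (feature_column n p) (\<lambda>c. exp (- \<theta>) + (1 - exp (- \<theta>)) * indicator {c. \<forall>u\<in>U. \<not> c u} c)" by simp
    also have "\<dots> = exp (- \<theta>) + (1 - exp (- \<theta>)) * a"
      using prob_column_avoid[OF U(1), of p] p by (subst Bochner_Integration.integral_add) (auto simp: a_def)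
    finally have Eh: "measure_pmf.expectation (feature_column n p) h = exp (- \<theta>) + (1 - exp (- \<theta>)) * a" .
    have "measure_pmf.prob M {\<omega>. real (N \<omega>) \<le> J} * exp (- (\<theta> * J)) =
      measure_pmf.expectation M (\<lambda>\<omega>. indicator {\<omega>. real (N \<omega>) \<le> J} \<omega> * exp (- (\<theta> * J)))" by simp
    also have "\<dots> \<le> measure_pmf.expectation M (\<lambda>\<omega>. \<Prod>w\<in>{1..m}. h (\<lambda>v. \<omega> (v, w)))"
      unfolding M_def
    proof (rule integral_mono)
      fix \<omega> show "indicator {\<omega>. real (N \<omega>) \<le> J} \<omega> * exp (- (\<theta> * J)) \<le> (\<Prod>w\<in>{1..m}. h (\<lambda>v. \<omega> (v, w)))"
        unfolding prodh using \<theta> by (auto simp: indicator_def mult_left_mono)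
    qed simp_all
    also have "\<dots> = (\<Prod>w\<in>{1..m}. measure_pmf.expectation (feature_column n p) h)"
      unfolding M_def by (rule expectation_columns) (rule h0)
    finally show ?thesis by (simp add: Eh exp_minus field_simps)
  qed
  have "measure_pmf.prob M {\<omega>. real (N \<omega>) \<le> J} \<le> exp (- (\<gamma> / 36 * real m * \<mu>))"
  proof (cases "\<gamma> * \<mu> \<le> 8")
    case True
    have "1/2 \<le> 1 - exp (- 1 :: real)"
      using exp_ge_add_one_self[of 1] by (simp add: exp_minus field_simps)
    then have "(1 - a) / 2 \<le> (1 - exp (- 1)) * (1 - a)"
      using mult_right_mono[of "1/2" "1 - exp (-1)" "1 - a"] a by simp
    then have "exp (- 1) + (1 - exp (- 1)) * a \<le> 1 - (1 - a) / 2" by (simp add: algebra_simps)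
    also have "\<dots> \<le> 1 - \<gamma> * \<mu> / 18"
    proof -
      have "0 < \<gamma> * \<mu>" using \<gamma> \<mu> by simp
      then have "\<gamma> * \<mu> / 9 \<le> \<gamma> * \<mu> / (1 + \<gamma> * \<mu>)" using True by (intro divide_left_mono) auto
      moreover have "\<gamma> * \<mu> / (1 + \<gamma> * \<mu>) \<le> 1 - a" by (rule ge(1)) (use pu p \<gamma> \<mu> in simp_all)
      ultimately have "\<gamma> * \<mu> / 9 \<le> 1 - a" by (rule order_trans)
      then show ?thesis by simp
    qed
    also have "\<dots> \<le> exp (- (\<gamma> * \<mu> / 18))" using exp_ge_add_one_self[of "- (\<gamma> * \<mu> / 18)"] by simp
    finally have "(exp (- 1) + (1 - exp (- 1)) * a) ^ m \<le> exp (- (\<gamma> * \<mu> / 18)) ^ m"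
      using a by (intro power_mono) auto
    then have "exp (1 * J) * (exp (- 1) + (1 - exp (- 1)) * a) ^ m \<le> exp (1 * J) * exp (- (\<gamma> * \<mu> / 18)) ^ m"
      by (intro mult_left_mono) auto
    also have "\<dots> = exp (J - \<gamma> * \<mu> / 18 * real m)"
      by (simp add: mult_exp_exp mult.commute flip: exp_of_nat_mult)
    also have "\<dots> \<le> exp (- (\<gamma> / 36 * real m * \<mu>))"
    proof -
      have "J \<le> \<gamma> / 36 * real m * \<mu>" unfolding J_def using \<gamma> by (intro mult_left_mono) auto
      then show ?thesis by (simp add: field_simps)
    qed
    finally show ?thesis using gen[of 1] by linarith
  next
    case False
    define \<theta> where "\<theta> = \<gamma> * \<mu> / 2"
    have \<theta>: "\<theta> \<ge> 0" using \<gamma> \<mu> by (simp add: \<theta>_def)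
    have "a \<le> exp (- (\<gamma> * \<mu>))" using ge(2) pu p \<gamma> \<mu> by simp
    also have "\<dots> \<le> exp (- \<theta>)" using \<gamma> \<mu> by (simp add: \<theta>_def)
    finally have "(1 - exp (- \<theta>)) * a \<le> 1 * exp (- \<theta>)" using a \<theta> by (intro mult_mono) auto
    then have "exp (- \<theta>) + (1 - exp (- \<theta>)) * a \<le> 2 * exp (- \<theta>)" by simp
    also have "\<dots> \<le> exp 1 * exp (- \<theta>)" using exp_ge_add_one_self[of 1] by (intro mult_right_mono) auto
    also have "\<dots> = exp (1 - \<theta>)" by (simp add: mult_exp_exp)
    finally have "(exp (- \<theta>) + (1 - exp (- \<theta>)) * a) ^ m \<le> exp (1 - \<theta>) ^ m"
      using a \<theta> by (intro power_mono add_nonneg_nonneg mult_nonneg_nonneg) auto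
    then have "exp (\<theta> * J) * (exp (- \<theta>) + (1 - exp (- \<theta>)) * a) ^ m \<le> exp (\<theta> * J) * exp (1 - \<theta>) ^ m"
      by (intro mult_left_mono) auto
    also have "\<dots> = exp (\<theta> * J + real m * (1 - \<theta>))"
      by (simp add: mult_exp_exp flip: exp_of_nat_mult)
    also have "\<dots> \<le> exp (- (\<gamma> / 36 * real m * \<mu>))"
    proof -
      have "J \<le> \<gamma> / 36 * real m * 1" unfolding J_def using \<gamma> by (intro mult_left_mono) auto
      also have "\<dots> \<le> real m / 36" using \<gamma> mult_right_mono[of \<gamma> 1 "real m"] by simp
      finally have "\<theta> * J \<le> \<theta> * (real m / 36)" using \<theta> by (rule mult_left_mono)
      moreover have "real m * 4 \<le> real m * \<theta>" using False by (intro mult_left_mono) (auto simp: \<theta>_def)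
      ultimately have "\<theta> * J + real m * (1 - \<theta>) \<le> - (\<theta> / 18 * real m)" by (simp add: algebra_simps)
      then show ?thesis by (simp add: \<theta>_def algebra_simps)
    qed
    finally show ?thesis using gen[OF \<theta>] by linarith
  qed
  then show ?thesis by (simp add: M_def N_def J_def \<mu>_def)
qed

text \<open>Tilting by \<open>exp (-1)\<close> per member gives expectation at most
  \<open>exp (- n * p / 2)\<close> for one feature; the deviation to a quarter of the mean gives
  back half of this exponent.\<close>

lemma prob_small_feature:
  assumes p: "0 \<le> p" "p \<le> 1"
  shows "measure_pmf.prob (incidences n m p)
     {\<omega>. \<exists>w\<in>{1..m}. real (card {v\<in>{1..n}. \<omega> (v, w)}) \<le> real n * p / 4} \<le> real m * exp (- (real n * p / 4))"
proof -
  define \<mu> where "\<mu> = real n * p"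
  define M where "M = incidences n m p"
  have col: "measure_pmf.prob (feature_column n p) {c. real (card {v\<in>{1..n}. c v}) \<le> \<mu> / 4} \<le> exp (- (\<mu> / 4))"
  proof -
    have e: "(\<Prod>v\<in>{1..n}. if c v then exp (-1) else 1 :: real) = exp (- real (card {v\<in>{1..n}. c v}))" for c
    proof -
      have "(\<Prod>v\<in>{1..n}. if c v then exp (-1) else 1 :: real) = exp (-1) ^ card {v\<in>{1..n}. c v}"
        by (subst prod.If_cases) (auto simp: Int_def)
      then show ?thesis by (simp flip: exp_of_nat_mult)
    qed
    have "measure_pmf.prob (feature_column n p) {c. real (card {v\<in>{1..n}. c v}) \<le> \<mu> / 4} * exp (- (\<mu> / 4)) =
       measure_pmf.expectation (feature_column n p) (\<lambda>c. indicator {c. real (card {v\<in>{1..n}. c v}) \<le> \<mu> / 4} c * exp (- (\<mu> / 4)))" by simp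
    also have "\<dots> \<le> measure_pmf.expectation (feature_column n p) (\<lambda>c. \<Prod>v\<in>{1..n}. if c v then exp (-1) else 1)"
      by (rule integral_mono) (simp_all add: e indicator_def del: One_nat_def)
    also have "\<dots> = (\<Prod>v\<in>{1..n}. p * (if True then exp (-1) else 1) + (1 - p) * (if False then exp (-1) else 1))"
      by (rule expectation_column[where f = "\<lambda>_ b. if b then exp (-1) else 1"]) (use p in auto)
    also have "\<dots> \<le> (\<Prod>v\<in>{1..n}. exp (- (p / 2)))"
    proof (rule prod_mono, intro conjI)
      have "exp (-1) \<le> (1/2 :: real)" using exp_ge_add_one_self[of 1] by (simp add: exp_minus field_simps)
      then have "p * exp (-1) \<le> p * (1/2)" using p by (intro mult_left_mono) auto
      then show "p * (if True then exp (-1) else 1) + (1 - p) * (if False then exp (-1) else 1) \<le> exp (- (p / 2))"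
        using exp_ge_add_one_self[of "- (p / 2)"] by simp
    qed (use p in auto)
    also have "\<dots> = exp (- (\<mu> / 4)) * exp (- (\<mu> / 4))"
      by (simp add: \<mu>_def mult_exp_exp flip: exp_of_nat_mult)
    finally show ?thesis by simp
  qed
  have single: "measure_pmf.prob M {\<omega>. real (card {v\<in>{1..n}. \<omega> (v, w)}) \<le> \<mu> / 4} \<le> exp (- (\<mu> / 4))" if "w \<in> {1..m}" for w
  proof -
    let ?G = "\<lambda>w'. if w' = w then {c. real (card {v\<in>{1..n}. c v}) \<le> \<mu> / 4} else UNIV"
    have "{\<omega>. real (card {v\<in>{1..n}. \<omega> (v, w)}) \<le> \<mu> / 4} = {\<omega>. \<forall>w'\<in>{1..m}. (\<lambda>v. \<omega> (v, w')) \<in> ?G w'}"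
      using that by auto
    then have "measure_pmf.prob M {\<omega>. real (card {v\<in>{1..n}. \<omega> (v, w)}) \<le> \<mu> / 4} =
        (\<Prod>w'\<in>{1..m}. measure_pmf.prob (feature_column n p) (?G w'))"
      using prob_columns[of n m p ?G] by (simp add: M_def)
    also have "\<dots> = (\<Prod>w'\<in>{1..m}. if w' = w then measure_pmf.prob (feature_column n p) {c. real (card {v\<in>{1..n}. c v}) \<le> \<mu> / 4} else 1)"
      by (rule prod.cong) auto
    also have "\<dots> = measure_pmf.prob (feature_column n p) {c. real (card {v\<in>{1..n}. c v}) \<le> \<mu> / 4}"
      using that by (simp add: prod.If_cases)
    finally show ?thesis using col by simp
  qed
  have "{\<omega>. \<exists>w\<in>{1..m}. real (card {v\<in>{1..n}. \<omega> (v, w)}) \<le> \<mu> / 4} =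
      (\<Union>w\<in>{1..m}. {\<omega>. real (card {v\<in>{1..n}. \<omega> (v, w)}) \<le> \<mu> / 4})" by auto
  then have "measure_pmf.prob M {\<omega>. \<exists>w\<in>{1..m}. real (card {v\<in>{1..n}. \<omega> (v, w)}) \<le> \<mu> / 4} \<le>
      (\<Sum>w\<in>{1..m}. measure_pmf.prob M {\<omega>. real (card {v\<in>{1..n}. \<omega> (v, w)}) \<le> \<mu> / 4})"
    using measure_pmf.finite_measure_subadditive_finite[of "{1..m}"] by simp
  also have "\<dots> \<le> (\<Sum>w\<in>{1..m}. exp (- (\<mu> / 4)))" by (rule sum_mono) (rule single)
  finally show ?thesis by (simp add: M_def \<mu>_def)
qed

text \<open>Induction on the ground set by conditioning on one coordinate. The difference of the two
  sides at that coordinate is \<open>p * (1 - p)\<close> times the increase of the average of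
  \<open>f\<close> times the decrease of the average of \<open>g\<close>, which is
  nonnegative.\<close>

lemma harris:
  fixes f g :: "('a \<Rightarrow> bool) \<Rightarrow> real"
  assumes p: "0 \<le> p" "p \<le> 1" and A: "finite A"
    and "\<And>h h'. (\<And>x. h x \<Longrightarrow> h' x) \<Longrightarrow> f h \<le> f h'" "\<And>h h'. (\<And>x. h x \<Longrightarrow> h' x) \<Longrightarrow> g h' \<le> g h"
  shows "measure_pmf.expectation (Pi_pmf A False (\<lambda>_. bernoulli_pmf p)) (\<lambda>h. f h * g h) \<le>
     measure_pmf.expectation (Pi_pmf A False (\<lambda>_. bernoulli_pmf p)) f *
     measure_pmf.expectation (Pi_pmf A False (\<lambda>_. bernoulli_pmf p)) g"
proof -
  define M where "M = (\<lambda>A :: 'a set. Pi_pmf A False (\<lambda>_. bernoulli_pmf p))"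
  have "measure_pmf.expectation (M A) (\<lambda>h. f h * g h) \<le>
     measure_pmf.expectation (M A) f * measure_pmf.expectation (M A) g"
    using A assms(4,5)
  proof (induction A arbitrary: f g rule: finite_induct)
    case empty
    then show ?case by (simp add: M_def)
  next
    case (insert x A)
    have int: "integrable (measure_pmf (M A)) k" for k :: "('a \<Rightarrow> bool) \<Rightarrow> real"
      unfolding M_def by (rule integrable_measure_pmf_finite) (rule finite_set_Pi_bool[OF insert.hyps(1)])
    have step: "measure_pmf.expectation (M (insert x A)) k =
        p * measure_pmf.expectation (M A) (\<lambda>h. k (h(x := True))) +
        (1 - p) * measure_pmf.expectation (M A) (\<lambda>h. k (h(x := False)))" for k :: "('a \<Rightarrow> bool) \<Rightarrow> real"
    proof -
      have eq: "M (insert x A) = bind_pmf (bernoulli_pmf p) (\<lambda>y. map_pmf (\<lambda>h. h(x := y)) (M A))"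
        unfolding M_def using insert.hyps by (subst Pi_pmf_insert') (auto simp: map_pmf_def)
      have "measure_pmf.expectation (M (insert x A)) k =
         (\<Sum>y\<in>UNIV. pmf (bernoulli_pmf p) y *\<^sub>R measure_pmf.expectation (map_pmf (\<lambda>h. h(x := y)) (M A)) k)"
        unfolding eq by (rule pmf_expectation_bind) (auto simp: M_def finite_set_Pi_bool[OF insert.hyps(1)])
      then show ?thesis using p by (simp add: UNIV_bool)
    qed
    define F where "F b = measure_pmf.expectation (M A) (\<lambda>h. f (h(x := b)))" for b
    define G where "G b = measure_pmf.expectation (M A) (\<lambda>h. g (h(x := b)))" for b
    have IH: "measure_pmf.expectation (M A) (\<lambda>h. f (h(x := b)) * g (h(x := b))) \<le> F b * G b" for b
      unfolding F_def G_def
      by (rule insert.IH) (auto intro!: insert.prems split: if_splits)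
    have "F False \<le> F True" unfolding F_def by (rule integral_mono[OF int int]) (auto intro!: insert.prems split: if_splits)
    moreover have "G True \<le> G False" unfolding G_def by (rule integral_mono[OF int int]) (auto intro!: insert.prems split: if_splits)
    ultimately have "0 \<le> p * (1 - p) * ((F True - F False) * (G False - G True))" using p by simp
    then have "p * (F True * G True) + (1 - p) * (F False * G False) \<le>
        (p * F True + (1 - p) * F False) * (p * G True + (1 - p) * G False)" by (simp add: algebra_simps)
    moreover have "p * measure_pmf.expectation (M A) (\<lambda>h. f (h(x := True)) * g (h(x := True))) \<le> p * (F True * G True)"
      using IH p by (intro mult_left_mono) auto
    moreover have "(1 - p) * measure_pmf.expectation (M A) (\<lambda>h. f (h(x := False)) * g (h(x := False))) \<le> (1 - p) * (F False * G False)"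
      using IH p by (intro mult_left_mono) auto
    ultimately show ?case unfolding step F_def[symmetric] G_def[symmetric] by linarith
  qed
  then show ?thesis by (simp only: M_def)
qed

lemma harris_prob:
  fixes A B :: "(nat \<times> nat \<Rightarrow> bool) set"
  assumes p: "0 \<le> p" "p \<le> 1"
    and A: "\<And>h h'. (\<And>x. h x \<Longrightarrow> h' x) \<Longrightarrow> h \<in> A \<Longrightarrow> h' \<in> A"
    and B: "\<And>h h'. (\<And>x. h x \<Longrightarrow> h' x) \<Longrightarrow> h' \<in> B \<Longrightarrow> h \<in> B"
  shows "measure_pmf.prob (incidences n m p) (A \<inter> B) \<le>
     measure_pmf.prob (incidences n m p) A * measure_pmf.prob (incidences n m p) B"
proof -
  define f g where "f = (indicator A :: _ \<Rightarrow> real)" and "g = (indicator B :: _ \<Rightarrow> real)"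
  have "measure_pmf.expectation (incidences n m p) (\<lambda>h. f h * g h) \<le>
    measure_pmf.expectation (incidences n m p) f * measure_pmf.expectation (incidences n m p) g"
    unfolding incidences_def
  proof (rule harris)
    fix h h' :: "nat \<times> nat \<Rightarrow> bool" assume *: "\<And>x. h x \<Longrightarrow> h' x"
    have "h \<in> A \<Longrightarrow> h' \<in> A" by (rule A[of h h']) (rule *)
    then show "f h \<le> f h'" by (auto simp: indicator_def f_def)
    have "h' \<in> B \<Longrightarrow> h \<in> B" by (rule B[of h h']) (rule *)
    then show "g h' \<le> g h" by (auto simp: indicator_def g_def)
  qed (use p in simp_all)
  moreover have "(\<lambda>h. f h * g h) = indicator (A \<inter> B)"
    by (simp add: fun_eq_iff indicator_inter_arith f_def g_def)
  ultimately show ?thesis by (simp add: f_def g_def)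
qed

section \<open>Isolated vertices\<close>

text \<open>The quantifiers over sets give both alternatives the shape required by
  \<open>prob_column_avoid\<close>.\<close>

definition isolated_column :: "nat \<Rightarrow> nat \<Rightarrow> (nat \<Rightarrow> bool) set" where
  "isolated_column n v = {c. \<forall>x\<in>{v}. \<not> c x} \<union> {c. \<forall>x\<in>{1..n} - {v}. \<not> c x}"

definition isolated :: "nat \<Rightarrow> nat \<Rightarrow> nat \<Rightarrow> (nat \<times> nat \<Rightarrow> bool) set" where
  "isolated n m v = {\<omega>. \<forall>w\<in>{1..m}. (\<lambda>x. \<omega> (x, w)) \<in> isolated_column n v}"

lemma isolated_nbhd: "\<omega> \<in> isolated n m v \<Longrightarrow> nbhd (rig_edges n m \<omega>) {v} = {}"
proof (rule equals0I)
  fix u assume iso: "\<omega> \<in> isolated n m v" and "u \<in> nbhd (rig_edges n m \<omega>) {v}"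
  then obtain w where "u \<noteq> v" "u \<in> {1..n}" "w \<in> {1..m}" "\<omega> (v, w)" "\<omega> (u, w)"
    unfolding nbhd_def rig_edges_iff by blast
  then show False using iso unfolding isolated_def isolated_column_def by blast
qed

lemma prob_isolated_column:
  assumes "v \<in> {1..n}" "0 \<le> p" "p \<le> 1"
  shows "measure_pmf.prob (feature_column n p) (isolated_column n v) = 1 - p * (1 - (1 - p) ^ (n - 1))"
proof -
  have I: "{c. \<forall>x\<in>{v}. \<not> c x} \<inter> {c. \<forall>x\<in>{1..n} - {v}. \<not> c x} = {c. \<forall>x\<in>{1..n}. \<not> c x}"
    using assms(1) by auto
  have "measure_pmf.prob (feature_column n p) (isolated_column n v) =
      measure_pmf.prob (feature_column n p) {c. \<forall>x\<in>{v}. \<not> c x} + measure_pmf.prob (feature_column n p) {c. \<forall>x\<in>{1..n} - {v}. \<not> c x}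
      - measure_pmf.prob (feature_column n p) {c. \<forall>x\<in>{1..n}. \<not> c x}"
    unfolding isolated_column_def
    by (subst measure_Un3) (simp_all only: I measure_pmf.fmeasurable_eq_sets, simp_all)
  also have "measure_pmf.prob (feature_column n p) {c. \<forall>x\<in>{v}. \<not> c x} = (1 - p) ^ card {v}"
    by (rule prob_column_avoid) (use assms in auto)
  also have "measure_pmf.prob (feature_column n p) {c. \<forall>x\<in>{1..n} - {v}. \<not> c x} = (1 - p) ^ card ({1..n} - {v})"
    by (rule prob_column_avoid) (use assms in auto)
  also have "measure_pmf.prob (feature_column n p) {c. \<forall>x\<in>{1..n}. \<not> c x} = (1 - p) ^ card {1..n}"
    by (rule prob_column_avoid) (use assms in auto)
  finally have "measure_pmf.prob (feature_column n p) (isolated_column n v) = (1 - p) + (1 - p) ^ (n - 1) - (1 - p) ^ n"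
    using assms(1) by simp
  moreover have "(1 - p) ^ n = (1 - p) * (1 - p) ^ (n - 1)"
    using assms(1) by (cases n) auto
  ultimately show ?thesis by (simp add: algebra_simps)
qed

text \<open>A feature containing \<open>u\<close> contains nothing else. So it misses both vertices,
  or consists of \<open>u\<close> alone, or consists of \<open>v\<close> alone.\<close>

lemma prob_isolated_column_pair:
  assumes uv: "u \<in> {1..n}" "v \<in> {1..n}" "u \<noteq> v" and p: "0 \<le> p" "p \<le> 1"
  shows "measure_pmf.prob (feature_column n p) (isolated_column n u \<inter> isolated_column n v) \<le>
     (1 - p)\<^sup>2 + 2 * p * (1 - p) ^ (n - 1)"
proof -
  let ?P = "measure_pmf.prob (feature_column n p)"
  let ?av = "\<lambda>S. {c :: nat \<Rightarrow> bool. \<forall>x\<in>S. \<not> c x}"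
  have n: "(1 - p) ^ n = (1 - p) * (1 - p) ^ (n - 1)" using uv by (cases n) auto
  have only: "?P (?av ({1..n} - {x}) - ?av {1..n}) = p * (1 - p) ^ (n - 1)" if "x \<in> {1..n}" for x
  proof -
    have "?P (?av ({1..n} - {x}) - ?av {1..n}) = ?P (?av ({1..n} - {x})) - ?P (?av {1..n})"
      by (rule measure_pmf.finite_measure_Diff) auto
    also have "\<dots> = (1 - p) ^ card ({1..n} - {x}) - (1 - p) ^ card {1..n}"
      by (intro arg_cong2[where f = minus] prob_column_avoid) (use p in auto)
    finally show ?thesis using that n by (simp add: algebra_simps)
  qed
  have "isolated_column n u \<inter> isolated_column n v \<subseteq>
      ?av {u, v} \<union> ((?av ({1..n} - {u}) - ?av {1..n}) \<union> (?av ({1..n} - {v}) - ?av {1..n}))"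
  proof
    fix c assume c: "c \<in> isolated_column n u \<inter> isolated_column n v"
    consider "c u" | "c v" | "\<not> c u" "\<not> c v" by blast
    then show "c \<in> ?av {u, v} \<union> ((?av ({1..n} - {u}) - ?av {1..n}) \<union> (?av ({1..n} - {v}) - ?av {1..n}))"
    proof cases
      case 1
      then have "c \<in> ?av ({1..n} - {u})" "c \<notin> ?av {1..n}" using c uv(1) unfolding isolated_column_def by blast+
      then show ?thesis by blast
    next
      case 2
      then have "c \<in> ?av ({1..n} - {v})" "c \<notin> ?av {1..n}" using c uv(2) unfolding isolated_column_def by blast+
      then show ?thesis by blast
    qed blast
  qed
  then have "?P (isolated_column n u \<inter> isolated_column n v) \<le>
      ?P (?av {u, v} \<union> ((?av ({1..n} - {u}) - ?av {1..n}) \<union> (?av ({1..n} - {v}) - ?av {1..n})))"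
    by (rule measure_pmf.finite_measure_mono) simp
  also have "\<dots> \<le> ?P (?av {u, v}) + (?P (?av ({1..n} - {u}) - ?av {1..n}) + ?P (?av ({1..n} - {v}) - ?av {1..n}))"
    by (intro order_trans[OF measure_Un_le] add_left_mono) auto
  also have "?P (?av {u, v}) = (1 - p) ^ card {u, v}" by (rule prob_column_avoid) (use uv p in auto)
  finally show ?thesis using only uv by (simp add: power2_eq_square)
qed

text \<open>Chebyshev's inequality for the number of isolated vertices. The first error term is the
  reciprocal of its mean, the second bounds the correlation of two vertices.\<close>

lemma prob_no_isolated:
  assumes p: "0 < p" "p \<le> 1 / 1000" and n: "n \<ge> 2" "ln (real n) \<ge> 1" "16 * ln (real n) / real n \<le> 1"
    and \<rho>: "intensity n m p \<le> 995 / 1000 * ln (real n)"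
  shows "measure_pmf.prob (incidences n m p) {\<omega>. \<forall>v\<in>{1..n}. nbhd (rig_edges n m \<omega>) {v} \<noteq> {}}
    \<le> real n powr (- 3 / 1000) + 32 * ln (real n) / real n"
proof -
  define M where "M = incidences n m p"
  define P where "P = measure_pmf.prob M"
  define b where "b = (1 - p) ^ (n - 1)"
  define x where "x = p * (1 - b)"
  define P1 where "P1 = (1 - x) ^ m"
  define t where "t = 8 * (real m * p\<^sup>2 * b)"
  define N where "N \<omega> = (\<Sum>v\<in>{1..n}. indicator (isolated n m v) \<omega> :: real)" for \<omega>
  have b: "0 \<le> b" "b \<le> 1" using p by (auto simp: b_def power_le_one)
  have x: "0 \<le> x" "x \<le> p" using b p by (auto simp: x_def mult_left_le)
  have mx: "real m * x = intensity n m p" by (simp add: x_def intensity_def b_def)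
  have L: "ln (real n) > 0" using n by simp
  have n0: "real n > 0" using n by simp
  have iso1: "P (isolated n m v) = P1" if "v \<in> {1..n}" for v
    unfolding P_def M_def isolated_def prob_columns
    using prob_isolated_column[of v n p] that p by (simp add: P1_def x_def b_def)
  have P1pos: "0 < P1" using x p by (simp add: P1_def)
  have iso2: "P (isolated n m u \<inter> isolated n m v) \<le> P1\<^sup>2 * exp t"
    if uv: "u \<in> {1..n}" "v \<in> {1..n}" "u \<noteq> v" for u v
  proof -
    have eq: "isolated n m u \<inter> isolated n m v =
        {\<omega>. \<forall>w\<in>{1..m}. (\<lambda>x. \<omega> (x, w)) \<in> isolated_column n u \<inter> isolated_column n v}"
      unfolding isolated_def by blast
    have "P (isolated n m u \<inter> isolated n m v) =
       (measure_pmf.prob (feature_column n p) (isolated_column n u \<inter> isolated_column n v)) ^ m"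
      unfolding P_def M_def eq prob_columns by simp
    also have "\<dots> \<le> ((1 - x)\<^sup>2 * exp (8 * (p\<^sup>2 * b))) ^ m"
    proof (intro power_mono measure_nonneg)
      have "measure_pmf.prob (feature_column n p) (isolated_column n u \<inter> isolated_column n v) \<le> (1 - p)\<^sup>2 + 2 * p * b"
        unfolding b_def by (rule prob_isolated_column_pair) (use uv p in auto)
      \<comment> \<open>The pair probability exceeds the square of the single one by at most
        \<open>2 * p\<^sup>2 * b\<close>, so the correlation is of second order in \<open>p\<close>
        for each feature.\<close>
      also have "\<dots> \<le> (1 - x)\<^sup>2 + 2 * p\<^sup>2 * b"
      proof -
        have "(1 - p)\<^sup>2 + 2 * p * b - ((1 - x)\<^sup>2 + 2 * p\<^sup>2 * b) = - (p\<^sup>2 * b\<^sup>2)"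
          by (simp add: x_def power2_eq_square algebra_simps)
        moreover have "0 \<le> p\<^sup>2 * b\<^sup>2" by simp
        ultimately show ?thesis by linarith
      qed
      also have "\<dots> \<le> (1 - x)\<^sup>2 * (1 + 8 * (p\<^sup>2 * b))"
      proof -
        have "(1/2)\<^sup>2 \<le> (1 - x)\<^sup>2" using x p by (intro power_mono) auto
        then have "1/4 * (8 * (p\<^sup>2 * b)) \<le> (1 - x)\<^sup>2 * (8 * (p\<^sup>2 * b))"
          using b by (intro mult_right_mono) (auto simp: power2_eq_square)
        then show ?thesis by (simp add: distrib_left)
      qed
      also have "\<dots> \<le> (1 - x)\<^sup>2 * exp (8 * (p\<^sup>2 * b))"
        using exp_ge_add_one_self by (intro mult_left_mono) auto
      finally show "measure_pmf.prob (feature_column n p) (isolated_column n u \<inter> isolated_column n v) \<le> (1 - x)\<^sup>2 * exp (8 * (p\<^sup>2 * b))" .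
    qed
    also have "\<dots> = P1\<^sup>2 * exp t"
      by (simp add: P1_def t_def power_mult_distrib mult_ac flip: power_mult exp_of_nat_mult)
    finally show ?thesis .
  qed
  have t0: "0 \<le> t" using b by (simp add: t_def)
  \<comment> \<open>From \<open>b * (1 + (n - 1) * p) <= 1\<close> the quantity
    \<open>m * p\<^sup>2 * b\<close> is at most the intensity divided by \<open>n - 1\<close>, hence
    of order ln n / n.\<close>
  have t1: "t \<le> 16 * ln (real n) / real n"
  proof -
    have "b * (1 + real (n - 1) * p) \<le> 1"
    proof -
      have "1 + real (n - 1) * p \<le> (1 + p) ^ (n - 1)" using Bernoulli_inequality[of p "n - 1"] p by simp
      then have "b * (1 + real (n - 1) * p) \<le> b * (1 + p) ^ (n - 1)" using b by (intro mult_left_mono)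
      also have "\<dots> = ((1 - p) * (1 + p)) ^ (n - 1)" by (simp add: b_def power_mult_distrib)
      also have "\<dots> \<le> 1" using p by (intro power_le_one) (auto simp: algebra_simps mult_le_one)
      finally show ?thesis .
    qed
    then have "b * p * real (n - 1) \<le> 1 - b" by (simp add: algebra_simps)
    then have "real m * p * (b * p * real (n - 1)) \<le> real m * p * (1 - b)"
      using p by (intro mult_left_mono) auto
    then have "real m * p\<^sup>2 * b * real (n - 1) \<le> intensity n m p"
      by (simp add: intensity_def b_def power2_eq_square algebra_simps)
    moreover have "real m * p\<^sup>2 * b * (real n / 2) \<le> real m * p\<^sup>2 * b * real (n - 1)"
      using n b by (intro mult_left_mono) auto
    ultimately have "real m * p\<^sup>2 * b * (real n / 2) \<le> ln (real n)" using \<rho> L by linarith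
    then show ?thesis using n0 by (simp add: t_def field_simps)
  qed
  have et: "exp t - 1 \<le> 2 * t"
  proof -
    have "t \<le> 1" using t1 n(3) by linarith
    then show ?thesis using exp_bound[of t] t0 mult_left_mono[of t 1 t] by (simp add: power2_eq_square)
  qed
  have int: "integrable (measure_pmf M) f" for f :: "_ \<Rightarrow> real" unfolding M_def by (rule integrable_incidences)
  have EN: "measure_pmf.expectation M N = real n * P1"
    unfolding N_def using iso1 by (subst Bochner_Integration.integral_sum) (auto simp: int P_def)
  have EN2: "measure_pmf.expectation M (\<lambda>\<omega>. (N \<omega>)\<^sup>2) \<le> real n * P1 + (real n)\<^sup>2 * (P1\<^sup>2 * exp t)"
  proof -
    have "measure_pmf.expectation M (\<lambda>\<omega>. (N \<omega>)\<^sup>2) =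
       measure_pmf.expectation M (\<lambda>\<omega>. \<Sum>u\<in>{1..n}. \<Sum>v\<in>{1..n}. indicator (isolated n m u \<inter> isolated n m v) \<omega>)"
      unfolding N_def power2_eq_square sum_product by (simp add: indicator_inter_arith)
    also have "\<dots> = (\<Sum>u\<in>{1..n}. \<Sum>v\<in>{1..n}. P (isolated n m u \<inter> isolated n m v))"
      by (simp add: Bochner_Integration.integral_sum int P_def)
    also have "\<dots> \<le> (\<Sum>u\<in>{1..n}. \<Sum>v\<in>{1..n}. (if v = u then P1 else 0) + P1\<^sup>2 * exp t)"
    proof (intro sum_mono)
      fix u v assume uv: "u \<in> {1..n}" "v \<in> {1..n}"
      show "P (isolated n m u \<inter> isolated n m v) \<le> (if v = u then P1 else 0) + P1\<^sup>2 * exp t"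
        using iso1[OF uv(1)] iso2[OF uv] by auto
    qed
    also have "\<dots> = real n * P1 + (real n)\<^sup>2 * (P1\<^sup>2 * exp t)"
      by (simp add: sum.distrib power2_eq_square algebra_simps)
    finally show ?thesis .
  qed
  have "P {\<omega>. N \<omega> = 0} * (real n * P1)\<^sup>2 =
      measure_pmf.expectation M (\<lambda>\<omega>. indicator {\<omega>. N \<omega> = 0} \<omega> * (real n * P1)\<^sup>2)" by (simp add: P_def)
  also have "\<dots> \<le> measure_pmf.expectation M (\<lambda>\<omega>. (N \<omega> - real n * P1)\<^sup>2)"
    by (rule integral_mono[OF int int]) (auto simp: indicator_def)
  also have "\<dots> = measure_pmf.expectation M (\<lambda>\<omega>. (N \<omega>)\<^sup>2) - 2 * (real n * P1) * measure_pmf.expectation M N + (real n * P1)\<^sup>2"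
  proof -
    have "(\<lambda>\<omega>. (N \<omega> - real n * P1)\<^sup>2) = (\<lambda>\<omega>. (N \<omega>)\<^sup>2 - 2 * (real n * P1) * N \<omega> + (real n * P1)\<^sup>2)"
      by (auto simp: fun_eq_iff power2_eq_square algebra_simps)
    then show ?thesis by (simp add: int)
  qed
  also have "\<dots> \<le> real n * P1 + (real n)\<^sup>2 * (P1\<^sup>2 * exp t) - (real n * P1)\<^sup>2"
    unfolding EN using EN2 by (simp add: power2_eq_square algebra_simps)
  also have "\<dots> = real n * P1 + (real n * P1)\<^sup>2 * (exp t - 1)" by (simp add: power_mult_distrib algebra_simps)
  also have "\<dots> \<le> real n * P1 + (real n * P1)\<^sup>2 * (2 * t)" using et by (intro add_left_mono mult_left_mono) auto
  also have "\<dots> = (1 / (real n * P1) + 2 * t) * (real n * P1)\<^sup>2"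
    using n0 P1pos by (simp add: power2_eq_square field_simps)
  finally have Pz: "P {\<omega>. N \<omega> = 0} \<le> 1 / (real n * P1) + 2 * t"
    using n0 P1pos by (simp only: mult_le_cancel_right_pos zero_less_power mult_pos_pos)
  \<comment> \<open>As \<open>x\<close> is at most 1/1000, replacing \<open>ln (1 - x)\<close> by
    \<open>- x\<close> costs a factor 1.002; since 0.995 times 1.002 is below 0.997, the mean is at
    least n^0.003.\<close>
  have nP1: "1 / (real n * P1) \<le> real n powr (- 3 / 1000)"
  proof -
    have "- (real m * x * (1 + 2 * x)) \<le> real m * ln (1 - x)"
      using mult_left_mono[OF ln_one_minus_pos_lower_bound[of x], of "real m"] x p
      by (simp add: power2_eq_square algebra_simps)
    moreover have "real m * x * (1 + 2 * x) \<le> 995 / 1000 * ln (real n) * (1 + 2 / 1000)"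
      unfolding mx by (rule mult_mono) (use \<rho> x p L in simp_all)
    moreover have "\<dots> \<le> 997 / 1000 * ln (real n)" using L by simp
    ultimately have "- (997 / 1000 * ln (real n)) \<le> real m * ln (1 - x)"
      by (meson neg_le_iff_le order_trans)
    also have "\<dots> = ln P1" using x p by (simp add: P1_def ln_realpow)
    finally have "3 / 1000 * ln (real n) \<le> ln (real n * P1)" using n0 P1pos by (simp add: ln_mult)
    then have "exp (3 / 1000 * ln (real n)) \<le> real n * P1"
      using n0 P1pos ln_ge_iff[of "real n * P1" "3 / 1000 * ln (real n)"] by simp
    then have "real n powr (3 / 1000) \<le> real n * P1" using n0 by (simp add: powr_def)
    then show ?thesis using n0 P1pos by (simp add: powr_minus_divide divide_left_mono)
  qed
  have "P {\<omega>. \<forall>v\<in>{1..n}. nbhd (rig_edges n m \<omega>) {v} \<noteq> {}} \<le> P {\<omega>. N \<omega> = 0}"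
    unfolding P_def
  proof (rule measure_pmf.finite_measure_mono)
    show "{\<omega>. \<forall>v\<in>{1..n}. nbhd (rig_edges n m \<omega>) {v} \<noteq> {}} \<subseteq> {\<omega>. N \<omega> = 0}"
      unfolding N_def using isolated_nbhd[of _ n m] by (auto simp: indicator_def intro!: sum.neutral)
  qed simp
  then show ?thesis using Pz nP1 t1 by (simp add: P_def M_def)
qed

section \<open>Clusters of vertices with few neighbours\<close>

text \<open>A cluster with a growth order: a vertex put in front is within distance 4 of an earlier
  one. Being a chain is increasing in the edges, as Harris' inequality requires. Distance 4 rather
  than 2 lets the same event rule out close pairs of exceptional vertices, which
  \<open>scattered\<close> forbids.\<close>

fun chain :: "nat \<Rightarrow> nat set set \<Rightarrow> nat list \<Rightarrow> bool" where
  "chain n E [] = True"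
| "chain n E (x # xs) \<longleftrightarrow> x \<in> {1..n} \<and> x \<notin> set xs \<and>
     (xs = [] \<or> (\<exists>y\<in>set xs. (y, x) \<in> near E 4)) \<and> chain n E xs"

lemma chain_set: "chain n E xs \<Longrightarrow> set xs \<subseteq> {1..n} \<and> distinct xs"
  by (induction xs) auto

lemma chain_mono: "H \<subseteq> E \<Longrightarrow> chain n H xs \<Longrightarrow> chain n E xs"
  by (induction xs) (auto dest: subsetD[OF near_edge_mono])

lemma near_ball:
  assumes G: "graph_on n E" and D: "\<And>v. v \<in> {1..n} \<Longrightarrow> card (nbhd E {v}) \<le> D" and y: "y \<in> {1..n}"
  shows "{x. (y, x) \<in> near E k} \<subseteq> {1..n} \<and> card {x. (y, x) \<in> near E k} \<le> (1 + D) ^ k"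
proof (induction k)
  case 0
  then show ?case using y by (simp add: near_def)
next
  case (Suc k)
  let ?B = "{x. (y, x) \<in> near E k}"
  have fB: "finite ?B" using Suc finite_subset[of ?B "{1..n}"] by auto
  have eq: "{x. (y, x) \<in> near E (Suc k)} = (\<Union>z\<in>?B. insert z (nbhd E {z}))"
    by (auto simp: near_def nbhd_def)
  have "card (\<Union>z\<in>?B. insert z (nbhd E {z})) \<le> (\<Sum>z\<in>?B. card (insert z (nbhd E {z})))"
    by (rule card_UN_le[OF fB])
  also have "\<dots> \<le> (\<Sum>z\<in>?B. 1 + D)"
  proof (rule sum_mono)
    fix z assume "z \<in> ?B"
    then have "z \<in> {1..n}" using Suc by blast
    then show "card (insert z (nbhd E {z})) \<le> 1 + D"
      using D[of z] finite_nbhd[OF G, of "{z}"] by (simp add: card_insert_if)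
  qed
  also have "\<dots> \<le> (1 + D) ^ k * (1 + D)" using Suc by (simp del: mult_Suc mult_Suc_right)
  finally have "card {x. (y, x) \<in> near E (Suc k)} \<le> (1 + D) ^ Suc k" unfolding eq by (simp add: mult.commute)
  moreover have "{x. (y, x) \<in> near E (Suc k)} \<subseteq> {1..n}"
    unfolding eq using Suc nbhd_subset[OF G] by blast
  ultimately show ?case by blast
qed

text \<open>There are \<open>n\<close> choices for the first vertex, and each later one lies in a
  ball of size at most \<open>K\<close> around one of the vertices already chosen.\<close>

lemma card_chains:
  assumes K: "\<And>y. y \<in> {1..n} \<Longrightarrow> {x. (y, x) \<in> near E 4} \<subseteq> {1..n} \<and> card {x. (y, x) \<in> near E 4} \<le> K"
  shows "finite {xs. chain n E xs \<and> length xs = Suc b} \<and>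
    card {xs. chain n E xs \<and> length xs = Suc b} \<le> n * (Suc b * K) ^ b"
proof (induction b)
  case 0
  have "{xs. chain n E xs \<and> length xs = Suc 0} = (\<lambda>x. [x]) ` {1..n}"
    by (auto simp: length_Suc_conv)
  then show ?case using card_image_le[of "{1..n}" "\<lambda>x. [x]"] by simp
next
  case (Suc b)
  let ?C = "{xs. chain n E xs \<and> length xs = Suc b}"
  let ?N = "\<lambda>xs. \<Union>y\<in>set xs. {x. (y, x) \<in> near E 4}"
  have N: "finite (?N xs) \<and> card (?N xs) \<le> Suc b * K" if "xs \<in> ?C" for xs
  proof
    have sub: "set xs \<subseteq> {1..n}" "card (set xs) = Suc b" using chain_set[of n E xs] that by (auto simp: distinct_card)
    show "finite (?N xs)"
    proof (rule finite_UN_I)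
      fix y assume "y \<in> set xs"
      then have "{x. (y, x) \<in> near E 4} \<subseteq> {1..n}" using K sub by blast
      then show "finite {x. (y, x) \<in> near E 4}" by (rule finite_subset) simp
    qed simp
    have "card (?N xs) \<le> (\<Sum>y\<in>set xs. card {x. (y, x) \<in> near E 4})" by (rule card_UN_le) simp
    also have "\<dots> \<le> (\<Sum>y\<in>set xs. K)" by (rule sum_mono) (use K sub in blast)
    finally show "card (?N xs) \<le> Suc b * K" using sub by simp
  qed
  let ?S = "SIGMA xs:?C. ?N xs"
  have sub: "{xs. chain n E xs \<and> length xs = Suc (Suc b)} \<subseteq> (\<lambda>(xs, x). x # xs) ` ?S"
  proof
    fix ys assume "ys \<in> {xs. chain n E xs \<and> length xs = Suc (Suc b)}"
    then obtain x xs where ys: "ys = x # xs" "chain n E (x # xs)" "length xs = Suc b" by (auto simp: length_Suc_conv)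
    then have "xs \<in> ?C" "x \<in> ?N xs" by auto
    then have "(xs, x) \<in> ?S" by blast
    then show "ys \<in> (\<lambda>(xs, x). x # xs) ` ?S" unfolding ys(1) by (rule rev_image_eqI) simp
  qed
  have fS: "finite ?S" using Suc N by (intro finite_SigmaI) auto
  have "card {xs. chain n E xs \<and> length xs = Suc (Suc b)} \<le> card ((\<lambda>(xs, x). x # xs) ` ?S)"
    by (rule card_mono[OF finite_imageI[OF fS] sub])
  also have "\<dots> \<le> card ?S" by (rule card_image_le[OF fS])
  also have "\<dots> = (\<Sum>xs\<in>?C. card (?N xs))" using Suc N by (intro card_SigmaI) auto
  also have "\<dots> \<le> (\<Sum>xs\<in>?C. Suc b * K)" using N by (intro sum_mono) blast
  also have "\<dots> \<le> (n * (Suc b * K) ^ b) * (Suc b * K)" using Suc by (simp del: mult_Suc mult_Suc_right)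
  also have "\<dots> = n * (Suc b * K) ^ Suc b" by (simp only: power_Suc2 mult.assoc)
  also have "\<dots> \<le> n * (Suc (Suc b) * K) ^ Suc b" by (intro mult_le_mono2 power_mono mult_le_mono1) auto
  finally show ?case using finite_subset[OF sub finite_imageI[OF fS]] by (intro conjI)
qed

lemma sparse_antimono:
  assumes "H \<subseteq> E" "graph_on n E" "sparse_nbhd n d E S"
  shows "sparse_nbhd n d H S"
proof -
  have "card (nbhd H S) \<le> card (nbhd E S)"
    using assms(1) by (intro card_mono finite_nbhd[OF assms(2)]) (auto simp: nbhd_def)
  then show ?thesis using assms(3) by (simp add: sparse_nbhd_def)
qed

text \<open>An inclusion-minimal sparse set cannot be split into two parts at distance more than 2,
  since the neighbourhoods of the parts would be disjoint.\<close>

lemma sparse_contains_chain: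
  assumes G: "graph_on n E" and d: "0 \<le> d" and C: "C \<subseteq> {1..n}" "sparse_nbhd n d E C" "C \<noteq> {}"
    and dC: "d * real (card C) \<le> real n"
  shows "\<exists>xs. chain n E xs \<and> xs \<noteq> [] \<and> set xs \<subseteq> C \<and> sparse_nbhd n d E (set xs)"
proof -
  have fC: "finite C" using C(1) finite_subset by auto
  define \<C> where "\<C> = {A. A \<subseteq> C \<and> A \<noteq> {} \<and> sparse_nbhd n d E A}"
  have "finite \<C>" unfolding \<C>_def using fC by simp
  moreover have "C \<in> \<C>" using C by (simp add: \<C>_def)
  ultimately obtain D where D: "D \<in> \<C>" "\<forall>A\<in>\<C>. A \<subseteq> D \<longrightarrow> D = A"
    using finite_has_minimal[of \<C>] by blast
  have DC: "D \<subseteq> C" "D \<noteq> {}" "sparse_nbhd n d E D" using D(1) by (auto simp: \<C>_def)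
  have fD: "finite D" using DC(1) fC by (rule finite_subset)
  have min: "\<not> sparse_nbhd n d E A" if "A \<subset> D" "A \<noteq> {}" for A
    using D(2) that DC(1) by (auto simp: \<C>_def)
  \<comment> \<open>For subsets of \<open>C\<close> the minimum in \<open>sparse_nbhd\<close> is its
    linear term, so the thresholds of two complementary parts add up to that of the whole.\<close>
  have dA: "min (d * real (card A)) (real n) = d * real (card A)" if "A \<subseteq> D" for A
  proof -
    have "card A \<le> card C" using that DC(1) fC by (intro card_mono) auto
    then have "d * real (card A) \<le> d * real (card C)" using d by (intro mult_left_mono) auto
    then show ?thesis using dC by simp
  qed
  have split: "\<exists>a\<in>A. \<exists>b\<in>D - A. (a, b) \<in> near E 4" if A: "A \<subset> D" "A \<noteq> {}" for A
  proof (rule ccontr)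
    assume "\<not> ?thesis"
    then have far: "(a, b) \<notin> near E k" if "a \<in> A" "b \<in> D - A" "k \<le> 4" for a b k
      using that near_mono[OF _ that(3), of a b E] by blast
    define B where "B = D - A"
    have B: "B \<subset> D" "B \<noteq> {}" using A by (auto simp: B_def)
    have nA: "nbhd E A \<subseteq> nbhd E D"
    proof
      fix u assume "u \<in> nbhd E A"
      then obtain a where a: "a \<in> A" "{a, u} \<in> E" "u \<notin> A" by (auto simp: nbhd_def)
      have "u \<notin> D" using far[OF a(1) _, of u 1] near_1[OF a(2)] a(3) by auto
      then show "u \<in> nbhd E D" using a A by (auto simp: nbhd_def)
    qed
    have nB: "nbhd E B \<subseteq> nbhd E D"
    proof
      fix u assume "u \<in> nbhd E B"
      then obtain b where b: "b \<in> B" "{b, u} \<in> E" "u \<notin> B" by (auto simp: nbhd_def)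
      have "(u, b) \<in> near E 1" using near_1[OF b(2)] by (rule near_sym)
      then have "u \<notin> D" using far[of u b 1] b by (auto simp: B_def)
      then show "u \<in> nbhd E D" using b by (auto simp: nbhd_def B_def)
    qed
    have "nbhd E A \<inter> nbhd E B = {}"
    proof (rule equals0I)
      fix u assume "u \<in> nbhd E A \<inter> nbhd E B"
      then obtain a b where ab: "a \<in> A" "{a, u} \<in> E" "b \<in> B" "{b, u} \<in> E" by (auto simp: nbhd_def)
      have "(a, b) \<in> near E (1 + 1)" by (rule near_trans[OF near_1[OF ab(2)] near_sym[OF near_1[OF ab(4)]]])
      then show False using far[of a b "1 + 1"] ab by (simp add: B_def)
    qed
    then have "card (nbhd E A) + card (nbhd E B) = card (nbhd E A \<union> nbhd E B)"
      by (intro card_Un_disjoint[symmetric] finite_nbhd[OF G])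
    also have "\<dots> \<le> card (nbhd E D)" using nA nB by (intro card_mono finite_nbhd[OF G]) auto
    finally have "real (card (nbhd E A)) + real (card (nbhd E B)) \<le> 1 / 10 ^ 6 * (d * real (card D))"
      using DC(3) dA[of D] by (simp add: sparse_nbhd_def)
    moreover have "card D = card A + card B"
      unfolding B_def using A fD card_Diff_subset[of A D] card_mono[of D A] finite_subset[of A D] by auto
    moreover have "1 / 10 ^ 6 * (d * real (card A)) < real (card (nbhd E A))"
      using min[OF A] dA[of A] A by (simp add: sparse_nbhd_def)
    moreover have "1 / 10 ^ 6 * (d * real (card B)) < real (card (nbhd E B))"
      using min[OF B] dA[of B] B by (simp add: sparse_nbhd_def)
    ultimately show False by (simp add: algebra_simps)
  qed
  have "\<exists>xs. chain n E xs \<and> set xs \<subseteq> D \<and> length xs = Suc k" if "Suc k \<le> card D" for k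
    using that
  proof (induction k)
    case 0
    obtain x where "x \<in> D" using DC(2) by blast
    then have "chain n E [x] \<and> set [x] \<subseteq> D \<and> length [x] = Suc 0" using DC(1) C(1) by auto
    then show ?case by blast
  next
    case (Suc k)
    then obtain xs where xs: "chain n E xs" "set xs \<subseteq> D" "length xs = Suc k" by auto
    have "card (set xs) < card D" using chain_set[OF xs(1)] xs(3) Suc.prems by (simp add: distinct_card)
    then have "set xs \<subset> D" "set xs \<noteq> {}" using xs by auto
    from split[OF this] obtain a b where "a \<in> set xs" "b \<in> D - set xs" "(a, b) \<in> near E 4" by blast
    then have "chain n E (b # xs)" "set (b # xs) \<subseteq> D" "length (b # xs) = Suc (Suc k)"
      using xs DC(1) C(1) by auto
    then show ?case by blast
  qed
  from this[of "card D - 1"] obtain xs where xs: "chain n E xs" "set xs \<subseteq> D" "length xs = card D"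
    using DC(2) fD by (auto simp: card_gt_0_iff Suc_le_eq)
  have "card (set xs) = card D" using chain_set[OF xs(1)] xs(3) by (simp add: distinct_card)
  then have "set xs = D" by (rule card_subset_eq[OF fD xs(2)])
  then show ?thesis using xs DC by auto
qed

section \<open>Random intersection graphs expand\<close>

lemma prob_Bex_le:
  assumes "finite F"
  shows "measure_pmf.prob M {\<omega>. \<exists>x\<in>F. Q x \<omega>} \<le> (\<Sum>x\<in>F. measure_pmf.prob M {\<omega>. Q x \<omega>})"
proof -
  have "{\<omega>. \<exists>x\<in>F. Q x \<omega>} = (\<Union>x\<in>F. {\<omega>. Q x \<omega>})" by auto
  then show ?thesis using measure_pmf.finite_measure_subadditive_finite[OF assms, of "\<lambda>x. {\<omega>. Q x \<omega>}" M] by simp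
qed

lemma prob_Bex_le_const:
  assumes "finite F" "\<And>x. x \<in> F \<Longrightarrow> measure_pmf.prob M {\<omega>. Q x \<omega>} \<le> b"
  shows "measure_pmf.prob M {\<omega>. \<exists>x\<in>F. Q x \<omega>} \<le> real (card F) * b"
  using order_trans[OF prob_Bex_le[OF assms(1)] sum_mono[OF assms(2)]] by simp

lemma binomial_exp_bound:
  assumes "s \<ge> 1"
  shows "real (n choose s) \<le> (exp 1 * real n / real s) ^ s"
proof -
  have "real s ^ s / fact s \<le> exp (real s)"
  proof -
    have "(\<Sum>k\<in>{s}. (real s ^ k) /\<^sub>R fact k) \<le> (\<Sum>k. (real s ^ k) /\<^sub>R fact k)"
      by (rule sum_le_suminf[OF summable_exp_generic]) auto
    then show ?thesis by (simp add: exp_def divide_inverse mult.commute)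
  qed
  then have 1: "real s ^ s \<le> exp (real s) * fact s" by (simp add: field_simps)
  have "real (n choose s) * fact s \<le> real n ^ s"
    using binomial_fact_pow[of n s] by (metis of_nat_fact of_nat_le_iff of_nat_mult of_nat_power)
  then have "real (n choose s) * real s ^ s \<le> exp (real s) * real n ^ s"
  proof -
    have "real (n choose s) * real s ^ s \<le> real (n choose s) * (exp (real s) * fact s)"
      using 1 by (intro mult_left_mono) auto
    also have "\<dots> = exp (real s) * (real (n choose s) * fact s)" by simp
    also have "\<dots> \<le> exp (real s) * real n ^ s"
      using \<open>real (n choose s) * fact s \<le> real n ^ s\<close> by (intro mult_left_mono) auto
    finally show ?thesis .
  qed
  moreover have "(exp 1 * real n / real s) ^ s = exp (real s) * real n ^ s / real s ^ s"
  proof -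
    have "exp 1 ^ s = exp (real s)" by (simp flip: exp_of_nat_mult)
    then show ?thesis by (simp only: power_divide power_mult_distrib)
  qed
  ultimately show ?thesis using assms by (simp add: pos_le_divide_eq)
qed

text \<open>The exponents: n^0.06 separates small from large sets, n^0.09 is the degree above which
  features are large, n^0.08 is then a lower bound for \<open>n * p\<close>, and n^0.20 bounds the
  degrees otherwise. Balls of radius 4 then have order n^0.80, and 0.80 + 0.06 stays below 0.97. The
  bound 10^10 makes exponents that carry small constants beat 2^n.\<close>

definition ample :: "nat \<Rightarrow> bool" where
  "ample n \<longleftrightarrow> 5000 \<le> n \<and> 10 ^ 10 \<le> ln (real n) \<and> exp 2 \<le> real n powr (3/100) \<and>
     12 * ln (real n) < real n powr (9/100) \<and>
     real n powr (8/100) * (6 * ln (real n)) \<le> real n powr (9/100) \<and>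
     3 * (real n powr (6/100) + 1) + 1 \<le> real n powr (8/100) / 4 \<and>
     (2 * real n powr (6/100) + 1) * ln (real n) + 2 * real n powr (9/100)
        \<le> real n powr (20/100) / (2 * (1 + real n powr (9/100))) \<and>
     32 * real n powr (- 11/100) \<le> 1 \<and>
     real n powr (9/100) * (real n powr (6/100) + 1) \<le> real n / 2 \<and>
     2 < real n powr (6/100) \<and> 1 \<le> real n powr (20/100)"

lemma eventually_ample: "eventually ample sequentially"
  unfolding ample_def
  by (intro eventually_conj; real_asymp)

definition large_size :: "nat \<Rightarrow> nat" where
  "large_size n = nat \<lceil>real n powr (6/100)\<rceil>"

text \<open>In order: disconnectedness, sparse large sets, sparse sets of any size at high
  intensity, a small feature, and a sparse chain.\<close>

definition expansion_error :: "nat \<Rightarrow> real" where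
  "expansion_error n = exp (- real n) + real n * exp (- (real n powr (6/100))) + real n * real n powr (- 19/10)
     + 6 * ln (real n) * real n * exp (- (real n powr (8/100) / 4)) + 128 * real n powr (- 2/100)"

context
  fixes n m :: nat and p :: real
  assumes p: "0 < p" "p < 1" and ample: "ample n"
    and \<rho>_ge: "99 / 100 * ln (real n) \<le> intensity n m p"
begin

lemma n5000: "n \<ge> 5000" and L_ge: "10 ^ 10 \<le> ln (real n)"
  using ample by (auto simp: ample_def)

lemma n_pos: "0 < real n"
  using n5000 by simp

lemma exp_ln_powr: "exp (a * ln (real n)) = real n powr a"
  using n_pos by (simp add: powr_def)

lemma d_ge: "intensity n m p \<le> eff_degree n m p"
proof -
  have "1 - (1 - p) ^ (n - 1) \<le> real (n - 1) * p"
    using Bernoulli_inequality[of "-p" "n - 1"] p by simp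
  also have "\<dots> \<le> real n * p" using p by (intro mult_right_mono) auto
  finally have "real m * p * (1 - (1 - p) ^ (n - 1)) \<le> real m * p * (real n * p)"
    using p by (intro mult_left_mono) auto
  then show ?thesis by (simp add: intensity_def eff_degree_def power2_eq_square mult_ac)
qed

lemma \<rho>_ge1: "1 \<le> intensity n m p"
  using \<rho>_ge L_ge by simp

lemma d_pos: "0 < eff_degree n m p"
  using \<rho>_ge1 d_ge by linarith

text \<open>The size restriction is put inside the event, so that the bound holds for all
  \<open>S\<close> and union bounds need no case distinction.\<close>

lemma prob_sparse_le:
  assumes "S \<subseteq> {1..n}" "a * ln (real n) \<le> 98 / 100 * intensity n m p"
  shows "measure_pmf.prob (incidences n m p)
     {\<omega>. real (card S) \<le> real n / 800 \<and> sparse_nbhd n (eff_degree n m p) (rig_edges n m \<omega>) S}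
    \<le> exp (- (a * ln (real n) * real (card S)))"
proof (cases "real (card S) \<le> real n / 800")
  case True
  then have "measure_pmf.prob (incidences n m p) {\<omega>. sparse_nbhd n (eff_degree n m p) (rig_edges n m \<omega>) S}
    \<le> exp (- (98 / 100 * intensity n m p * real (card S)))"
    by (intro prob_sparse) (use p n5000 \<rho>_ge1 assms in auto)
  also have "\<dots> \<le> exp (- (a * ln (real n) * real (card S)))"
    using mult_right_mono[OF assms(2), of "real (card S)"] by simp
  finally show ?thesis using True by simp
qed simp

lemma prob_sparse_set:
  assumes a: "a * ln (real n) \<le> 98 / 100 * intensity n m p"
    and b: "\<And>s. s0 \<le> s \<Longrightarrow> s \<le> n \<Longrightarrow> real (n choose s) * exp (- (a * ln (real n) * real s)) \<le> b"
    and s0: "s0 \<ge> 1" and b0: "0 \<le> b"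
  shows "measure_pmf.prob (incidences n m p)
    {\<omega>. \<exists>S\<subseteq>{1..n}. s0 \<le> card S \<and> real (card S) \<le> real n / 800 \<and> sparse_nbhd n (eff_degree n m p) (rig_edges n m \<omega>) S}
    \<le> real n * b"
proof -
  let ?Q = "\<lambda>S \<omega>. real (card S) \<le> real n / 800 \<and> sparse_nbhd n (eff_degree n m p) (rig_edges n m \<omega>) S"
  let ?F = "\<lambda>s. {S. S \<subseteq> {1..n} \<and> card S = s}"
  have "{\<omega>. \<exists>S\<subseteq>{1..n}. s0 \<le> card S \<and> ?Q S \<omega>} \<subseteq> {\<omega>. \<exists>s\<in>{s0..n}. \<exists>S\<in>?F s. ?Q S \<omega>}"
  proof
    fix \<omega> assume "\<omega> \<in> {\<omega>. \<exists>S\<subseteq>{1..n}. s0 \<le> card S \<and> ?Q S \<omega>}"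
    then obtain S where S: "S \<subseteq> {1..n}" "s0 \<le> card S" "?Q S \<omega>" by blast
    have "card S \<le> n" using card_mono[OF _ S(1)] by simp
    then show "\<omega> \<in> {\<omega>. \<exists>s\<in>{s0..n}. \<exists>S\<in>?F s. ?Q S \<omega>}" using S by (intro CollectI bexI[of _ "card S"] bexI[of _ S]) auto
  qed
  then have "measure_pmf.prob (incidences n m p) {\<omega>. \<exists>S\<subseteq>{1..n}. s0 \<le> card S \<and> ?Q S \<omega>} \<le>
      measure_pmf.prob (incidences n m p) {\<omega>. \<exists>s\<in>{s0..n}. \<exists>S\<in>?F s. ?Q S \<omega>}"
    by (rule measure_pmf.finite_measure_mono) simp
  also have "\<dots> \<le> real (card {s0..n}) * b"
  proof (rule prob_Bex_le_const)
    fix s assume s: "s \<in> {s0..n}"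
    have "measure_pmf.prob (incidences n m p) {\<omega>. \<exists>S\<in>?F s. ?Q S \<omega>} \<le> real (card (?F s)) * exp (- (a * ln (real n) * real s))"
    proof (rule prob_Bex_le_const)
      fix S assume "S \<in> ?F s"
      then show "measure_pmf.prob (incidences n m p) {\<omega>. ?Q S \<omega>} \<le> exp (- (a * ln (real n) * real s))"
        using prob_sparse_le[OF _ a, of S] by auto
    qed simp
    also have "card (?F s) = n choose s" using n_subsets[of "{1..n}" s] by simp
    finally show "measure_pmf.prob (incidences n m p) {\<omega>. \<exists>S\<in>?F s. ?Q S \<omega>} \<le> b" using b[of s] s by simp
  qed simp
  also have "\<dots> \<le> real n * b" using b0 s0 by (intro mult_right_mono) auto
  finally show ?thesis .
qed

lemma large_size_bounds: "real n powr (6/100) \<le> real (large_size n)" "real (large_size n) \<le> real n powr (6/100) + 1" "3 \<le> large_size n"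
proof -
  show 1: "real n powr (6/100) \<le> real (large_size n)" and "real (large_size n) \<le> real n powr (6/100) + 1"
    unfolding large_size_def using powr_ge_zero[of "real n" "6/100"] by linarith+
  have "2 < real n powr (6/100)" using ample by (simp add: ample_def)
  then show "3 \<le> large_size n" using 1 by linarith
qed

text \<open>For \<open>s >= n^0.06\<close> there are at most \<open>(e * n^0.94)^s\<close> sets, and
  each is sparse with probability at most \<open>n^(-0.97 s)\<close>; the surplus n^0.03 exceeds
  \<open>exp 2\<close>. Smaller sets escape this union bound.\<close>

lemma prob_large_sparse:
  "measure_pmf.prob (incidences n m p)
    {\<omega>. \<exists>S\<subseteq>{1..n}. large_size n \<le> card S \<and> real (card S) \<le> real n / 800 \<and> sparse_nbhd n (eff_degree n m p) (rig_edges n m \<omega>) S}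
    \<le> real n * exp (- (real n powr (6/100)))"
proof (rule prob_sparse_set[where a = "97/100"])
  show "97 / 100 * ln (real n) \<le> 98 / 100 * intensity n m p" using \<rho>_ge L_ge by simp
  fix s assume s: "large_size n \<le> s" "s \<le> n"
  have s1: "1 \<le> s" using s large_size_bounds(3) by simp
  have sl: "real n powr (6/100) \<le> real s" using s(1) large_size_bounds(1) by linarith
  have np: "0 < real n powr (6/100)" using n_pos by simp
  have "exp 1 * real n / real s * real n powr (- 97/100) \<le> exp 1 * real n / real n powr (6/100) * real n powr (- 97/100)"
    using sl np s1 by (intro mult_right_mono divide_left_mono) auto
  also have "\<dots> = exp 1 / real n powr (3/100)"
  proof -
    have "real n / real n powr (6/100) * real n powr (- 97/100) = real n powr (1 - 6/100 + - 97/100)"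
      using n_pos by (subst powr_add, subst powr_diff) simp
    then have "exp 1 * (real n / real n powr (6/100) * real n powr (- 97/100)) = exp 1 * (1 / real n powr (3/100))"
      by (simp add: powr_minus_divide)
    then show ?thesis by (simp only: times_divide_eq_right times_divide_eq_left mult.assoc mult_1_right)
  qed
  also have "\<dots> \<le> exp 1 / exp 2" using ample n_pos by (intro divide_left_mono) (auto simp: ample_def)
  also have "\<dots> = exp (-1 :: real)" by (simp flip: exp_diff)
  finally have base: "exp 1 * real n / real s * real n powr (- 97/100) \<le> exp (-1)" .
  have "real (n choose s) * exp (- (97/100 * ln (real n) * real s)) \<le>
     (exp 1 * real n / real s) ^ s * (real n powr (- 97/100)) ^ s"
  proof (rule mult_mono[OF binomial_exp_bound[OF s1]])
    show "exp (- (97/100 * ln (real n) * real s)) \<le> (real n powr (- 97/100)) ^ s"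
      by (simp add: mult_ac flip: exp_ln_powr exp_of_nat_mult)
  qed auto
  also have "\<dots> = (exp 1 * real n / real s * real n powr (- 97/100)) ^ s" by (simp only: power_mult_distrib)
  also have "\<dots> \<le> exp (-1) ^ s" by (rule power_mono[OF base]) simp
  also have "\<dots> = exp (- real s)" by (simp flip: exp_of_nat_mult)
  also have "\<dots> \<le> exp (- (real n powr (6/100)))" using sl by simp
  finally show "real (n choose s) * exp (- (97/100 * ln (real n) * real s)) \<le> exp (- (real n powr (6/100)))" .
qed (use large_size_bounds in auto)

text \<open>At this intensity the exponent 2.9 per vertex beats the crude count \<open>n ^ s\<close>
  for every size.\<close>

lemma prob_any_sparse:
  assumes "3 * ln (real n) \<le> intensity n m p"
  shows "measure_pmf.prob (incidences n m p)
    {\<omega>. \<exists>S\<subseteq>{1..n}. 1 \<le> card S \<and> real (card S) \<le> real n / 800 \<and> sparse_nbhd n (eff_degree n m p) (rig_edges n m \<omega>) S}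
    \<le> real n * real n powr (- 19/10)"
proof (rule prob_sparse_set[where a = "29/10"])
  show "29 / 10 * ln (real n) \<le> 98 / 100 * intensity n m p" using assms L_ge by simp
  fix s :: nat assume s: "1 \<le> s" "s \<le> n"
  have "real (n choose s) \<le> real n ^ s" using binomial_le_pow2[of n s] s(2) binomial_le_pow[of s n]
    by (metis of_nat_le_iff of_nat_power)
  then have "real (n choose s) * exp (- (29/10 * ln (real n) * real s)) \<le> real n ^ s * (real n powr (- 29/10)) ^ s"
    by (intro mult_mono) (simp_all add: mult_ac flip: exp_ln_powr exp_of_nat_mult)
  also have "\<dots> = (real n powr (- 19/10)) ^ s"
    using n_pos powr_add[of "real n" 1 "- 29/10"] by (simp flip: power_mult_distrib)
  also have "\<dots> \<le> (real n powr (- 19/10)) ^ 1"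
    using s n5000 by (intro power_decreasing) (auto intro: powr_le_one_le simp: powr_minus_divide ge_one_powr_ge_zero)
  finally show "real (n choose s) * exp (- (29/10 * ln (real n) * real s)) \<le> real n powr (- 19/10)" by simp
qed auto

text \<open>A linear number of vertices without outside neighbours has probability at most
  \<open>exp (- 2 n)\<close>, against at most 2^n choices.\<close>

lemma prob_disconnected:
  "measure_pmf.prob (incidences n m p)
    {\<omega>. \<exists>Y\<subseteq>{1..n}. nbhd (rig_edges n m \<omega>) Y = {} \<and> 1 / 10 ^ 6 / 12 * real n \<le> real (card Y) \<and> real (card Y) \<le> real n / 2}
    \<le> exp (- real n)"
proof -
  define \<gamma> where "\<gamma> = (1 / 10 ^ 6 / 12 :: real)"
  \<comment> \<open>Only a part \<open>S\<close> of \<open>Y\<close> of this size is used: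
    \<open>Y\<close> may have n/2 vertices, and in \<open>prob_no_edge\<close> the difference of the
    two sizes enters the exponent.\<close>
  define s where "s = nat \<lceil>\<gamma> * real n\<rceil>"
  have "0 \<le> \<gamma> * real n" by (simp add: \<gamma>_def)
  then have s: "\<gamma> * real n \<le> real s" "real s \<le> \<gamma> * real n + 1" unfolding s_def by linarith+
  have s4: "real s \<le> real n / 4" using s(2) n5000 by (simp add: \<gamma>_def)
  let ?F = "{Y. Y \<subseteq> {1..n} \<and> \<gamma> * real n \<le> real (card Y) \<and> real (card Y) \<le> real n / 2}"
  have fF: "finite ?F" by (rule finite_subset[of _ "Pow {1..n}"]) auto
  have "card ?F \<le> card (Pow {1..n})" by (rule card_mono) auto
  then have cF: "real (card ?F) \<le> 2 ^ n" by (simp add: card_Pow flip: of_nat_power)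
  have "measure_pmf.prob (incidences n m p) {\<omega>. \<exists>Y\<in>?F. nbhd (rig_edges n m \<omega>) Y = {}} \<le>
      real (card ?F) * exp (- 2 * real n)"
  proof (rule prob_Bex_le_const[OF fF])
    fix Y assume Y: "Y \<in> ?F"
    have "s \<le> card Y" using Y unfolding s_def by (simp add: nat_le_iff ceiling_le_iff)
    then obtain S where S: "S \<subseteq> Y" "card S = s" by (meson obtain_subset_with_card_n)
    define R where "R = {1..n} - Y"
    have fY: "finite Y" using Y by (auto intro: finite_subset)
    have cR: "card R = n - card Y" unfolding R_def using Y fY by (subst card_Diff_subset) auto
    have r2: "real n / 2 \<le> real (card R)" using Y cR by (simp add: of_nat_diff)
    have sR: "s \<le> card R" using r2 s4 n_pos by linarith
    have r4: "real n / 4 \<le> real (card R - s)" using r2 s4 sR by (simp add: of_nat_diff)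
    have "measure_pmf.prob (incidences n m p) {\<omega>. nbhd (rig_edges n m \<omega>) Y = {}} \<le>
        measure_pmf.prob (incidences n m p) {\<omega>. nbhd (rig_edges n m \<omega>) S \<inter> R = {}}"
    proof (rule measure_pmf.finite_measure_mono)
      show "{\<omega>. nbhd (rig_edges n m \<omega>) Y = {}} \<subseteq> {\<omega>. nbhd (rig_edges n m \<omega>) S \<inter> R = {}}"
        using S(1) unfolding nbhd_def R_def by blast
    qed simp
    also have "\<dots> \<le> exp (- (real m * p * real s * (1 - (1 - p) ^ (card R - s))))"
      using prob_no_edge[of S n R p m] S Y sR p unfolding R_def by auto
    also have "\<dots> \<le> exp (- 2 * real n)"
    proof -
      have rn: "card R - s \<le> n" using cR by simp
      have "1/4 * real n * (1 - (1 - p) ^ n) \<le> real (card R - s) * (1 - (1 - p) ^ n)"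
        using r4 p by (intro mult_right_mono) (auto simp: power_le_one)
      also have "\<dots> \<le> real n * (1 - (1 - p) ^ (card R - s))" by (rule geometric_concave[OF _ _ rn]) (use p in auto)
      finally have "real n * (1/4 * (1 - (1 - p) ^ n)) \<le> real n * (1 - (1 - p) ^ (card R - s))" by (simp only: mult_ac)
      then have "1/4 * (1 - (1 - p) ^ n) \<le> 1 - (1 - p) ^ (card R - s)" using n_pos by (simp only: mult_le_cancel_left_pos)
      moreover have "1/4 * (1 - (1 - p) ^ (n - 1)) \<le> 1/4 * (1 - (1 - p) ^ n)"
        using p by (intro mult_left_mono diff_left_mono power_decreasing) auto
      ultimately have "1/4 * (1 - (1 - p) ^ (n - 1)) \<le> 1 - (1 - p) ^ (card R - s)" by (rule order_trans[rotated])
      then have "real m * p * (1/4 * (1 - (1 - p) ^ (n - 1))) \<le> real m * p * (1 - (1 - p) ^ (card R - s))"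
        using p by (intro mult_left_mono) auto
      then have "intensity n m p / 4 \<le> real m * p * (1 - (1 - p) ^ (card R - s))" by (simp add: intensity_def)
      moreover have "99 / 100 * 10 ^ 8 / 4 \<le> intensity n m p / 4" using \<rho>_ge L_ge by simp
      ultimately have "(99 / 100 * 10 ^ 8 / 4) * (\<gamma> * real n) \<le> real m * p * (1 - (1 - p) ^ (card R - s)) * real s"
        using s(1) \<open>0 \<le> \<gamma> * real n\<close> by (intro mult_mono) auto
      moreover have "2 * real n \<le> (99 / 100 * 10 ^ 8 / 4) * (\<gamma> * real n)" by (simp add: \<gamma>_def)
      ultimately have "2 * real n \<le> real m * p * real s * (1 - (1 - p) ^ (card R - s))" by (simp add: mult_ac)
      then show ?thesis by simp
    qed
    finally show "measure_pmf.prob (incidences n m p) {\<omega>. nbhd (rig_edges n m \<omega>) Y = {}} \<le> exp (- 2 * real n)" .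
  qed
  also have "\<dots> \<le> exp (real n) * exp (- 2 * real n)"
  proof (rule mult_right_mono)
    have "(2::real) ^ n \<le> exp 1 ^ n" using exp_ge_add_one_self[of 1] by (intro power_mono) auto
    then have "2 ^ n \<le> exp (real n)" by (simp flip: exp_of_nat_mult)
    then show "real (card ?F) \<le> exp (real n)" by (rule order_trans[OF cF])
  qed simp
  also have "\<dots> = exp (- real n)" by (simp add: mult_exp_exp)
  finally show ?thesis by (simp add: \<gamma>_def conj_ac Bex_def) 
qed


text \<open>Large \<open>d\<close> with small intensity forces large features. First
  \<open>p * (n - 1) > 1\<close>, since otherwise \<open>d\<close> and the intensity are comparable;
  hence \<open>m * p\<close> is below 6 ln n. As \<open>d\<close> is the product of
  \<open>n * p\<close> and \<open>m * p\<close>, this makes \<open>n * p\<close> large, and all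
  features are concentrated around it.\<close>

lemma prob_small_features:
  assumes d: "real n powr (9/100) < eff_degree n m p" and \<rho>: "intensity n m p < 3 * ln (real n)"
  shows "measure_pmf.prob (incidences n m p)
     {\<omega>. \<exists>w\<in>{1..m}. real (card {v\<in>{1..n}. \<omega> (v, w)}) \<le> real n powr (8/100) / 4}
    \<le> 6 * ln (real n) * real n * exp (- (real n powr (8/100) / 4))"
proof -
  have L: "0 < ln (real n)" using L_ge by simp
  have half: "real n * p / 2 \<le> p * real (n - 1)" using p n5000 by (simp add: field_simps)
  have "1 < p * real (n - 1)"
  proof (rule ccontr)
    assume "\<not> ?thesis"
    then have t1: "p * real (n - 1) \<le> 1" by simp
    have "real n * p / 4 \<le> p * real (n - 1) / 2" using half by (simp add: mult.commute)
    also have "\<dots> \<le> p * real (n - 1) / (1 + p * real (n - 1))"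
      using t1 p by (intro divide_left_mono) (auto intro: add_pos_nonneg)
    also have "\<dots> \<le> 1 - (1 - p) ^ (n - 1)" using one_minus_power_ge(1)[of p "p * real (n - 1)" "n - 1"] p by simp
    finally have "real m * p * (real n * p / 4) \<le> intensity n m p"
      unfolding intensity_def using p by (intro mult_left_mono) auto
    then have "eff_degree n m p / 4 \<le> intensity n m p" by (simp add: eff_degree_def power2_eq_square mult_ac)
    then show False using \<rho> d ample by (simp add: ample_def)
  qed
  note p1 = this
  have "1 - exp (- 1) \<le> 1 - (1 - p) ^ (n - 1)" by (rule one_minus_power_ge(2)) (use p p1 in linarith)+
  moreover have "exp (- 1 :: real) \<le> 1/2" using exp_ge_add_one_self[of 1] by (simp add: exp_minus field_simps)
  ultimately have "1/2 \<le> 1 - (1 - p) ^ (n - 1)" by linarith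
  then have "real m * p * (1/2) \<le> intensity n m p" unfolding intensity_def using p by (intro mult_left_mono) auto
  then have mp: "real m * p < 6 * ln (real n)" using \<rho> by simp
  have \<mu>: "real n powr (8/100) \<le> real n * p"
  proof (rule ccontr)
    assume "\<not> real n powr (8/100) \<le> real n * p"
    then have "real n * p \<le> real n powr (8/100)" by simp
    then have "real n * p * (real m * p) \<le> real n powr (8/100) * (6 * ln (real n))"
      by (rule mult_mono) (use mp p in auto)
    also have "\<dots> \<le> real n powr (9/100)" using ample by (simp add: ample_def)
    finally show False using d by (simp add: eff_degree_def power2_eq_square mult_ac)
  qed
  have "p * real (n - 1) \<le> p * real n" using p by (intro mult_left_mono) auto
  then have pn: "1 \<le> p * real n" using p1 by linarith
  have mn: "real m \<le> 6 * ln (real n) * real n"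
  proof -
    have "real m * 1 \<le> real m * (p * real n)" using pn by (intro mult_left_mono) auto
    also have "\<dots> = (real m * p) * real n" by simp
    also have "\<dots> \<le> 6 * ln (real n) * real n" using mp by (intro mult_right_mono) auto
    finally show ?thesis by simp
  qed
  have "measure_pmf.prob (incidences n m p)
     {\<omega>. \<exists>w\<in>{1..m}. real (card {v\<in>{1..n}. \<omega> (v, w)}) \<le> real n powr (8/100) / 4} \<le>
    measure_pmf.prob (incidences n m p) {\<omega>. \<exists>w\<in>{1..m}. real (card {v\<in>{1..n}. \<omega> (v, w)}) \<le> real n * p / 4}"
    by (rule measure_pmf.finite_measure_mono) (use \<mu> in \<open>auto intro: order_trans\<close>)
  also have "\<dots> \<le> real m * exp (- (real n * p / 4))" by (rule prob_small_feature) (use p in auto)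
  also have "\<dots> \<le> (6 * ln (real n) * real n) * exp (- (real n powr (8/100) / 4))"
    using \<mu> mn L by (intro mult_mono) auto
  finally show ?thesis .
qed

text \<open>The bound has to beat the number \<open>n ^ Suc b\<close> of all lists considered in
  \<open>prob_sparse_chain\<close>, hence the exponent with n^0.06 ln n.\<close>

lemma prob_max_degree:
  assumes d: "eff_degree n m p \<le> real n powr (9/100)"
  shows "measure_pmf.prob (incidences n m p)
     {\<omega>. \<exists>v\<in>{1..n}. real n powr (20/100) \<le> real (card (nbhd (rig_edges n m \<omega>) {v}))}
    \<le> exp (- (2 * real n powr (6/100) * ln (real n)))"
proof -
  define \<Delta> where "\<Delta> = real n powr (20/100)"
  have "1 \<le> real m * p"
  proof -
    have "intensity n m p \<le> real m * p * 1" unfolding intensity_def using p by (intro mult_left_mono) auto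
    then show ?thesis using \<rho>_ge1 by simp
  qed
  then have "1 * (real n * p) \<le> real m * p * (real n * p)" using p by (intro mult_right_mono) auto
  then have np: "real n * p \<le> real n powr (9/100)" using d by (simp add: eff_degree_def power2_eq_square mult_ac)
  have "measure_pmf.prob (incidences n m p) {\<omega>. \<exists>v\<in>{1..n}. \<Delta> \<le> real (card (nbhd (rig_edges n m \<omega>) {v}))} \<le>
      real (card {1..n}) * exp (2 * real n powr (9/100) - \<Delta> / (2 * (1 + real n powr (9/100))))"
  proof (rule prob_Bex_le_const)
    fix v assume "v \<in> {1..n}"
    then have "measure_pmf.prob (incidences n m p) {\<omega>. \<Delta> \<le> real (card (nbhd (rig_edges n m \<omega>) {v}))} \<le>
       exp (2 * real n * real m * p\<^sup>2 - \<Delta> / (2 * (1 + real n * p)))"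
      by (rule prob_large_degree) (use p in auto)
    also have "\<dots> \<le> exp (2 * real n powr (9/100) - \<Delta> / (2 * (1 + real n powr (9/100))))"
    proof -
      have "\<Delta> / (2 * (1 + real n powr (9/100))) \<le> \<Delta> / (2 * (1 + real n * p))"
        using np p by (intro divide_left_mono) (auto simp: \<Delta>_def intro!: mult_pos_pos add_pos_nonneg)
      moreover have "2 * real n * real m * p\<^sup>2 \<le> 2 * real n powr (9/100)" using d by (simp add: eff_degree_def)
      ultimately show ?thesis by simp
    qed
    finally show "measure_pmf.prob (incidences n m p) {\<omega>. \<Delta> \<le> real (card (nbhd (rig_edges n m \<omega>) {v}))} \<le>
      exp (2 * real n powr (9/100) - \<Delta> / (2 * (1 + real n powr (9/100))))" .
  qed simp
  also have "\<dots> = exp (ln (real n) + (2 * real n powr (9/100) - \<Delta> / (2 * (1 + real n powr (9/100)))))"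
    using n_pos by (simp only: exp_add exp_ln card_atLeastAtMost) simp
  also have "\<dots> \<le> exp (- (2 * real n powr (6/100) * ln (real n)))"
  proof -
    have "(2 * real n powr (6/100) + 1) * ln (real n) + 2 * real n powr (9/100)
        \<le> \<Delta> / (2 * (1 + real n powr (9/100)))" using ample by (simp add: ample_def \<Delta>_def)
    then show ?thesis by (simp add: distrib_right)
  qed
  finally show ?thesis by (simp only: \<Delta>_def)
qed

text \<open>The expected number of chains is at most \<open>2 * Z\<close>, and by Harris' inequality
  sparsity contributes a factor n^(-0.97 (b + 1)) for each. In total this is of order n^0.03 times a
  \<open>b\<close>-th power of at most 32 n^(-0.11). For \<open>b = 0\<close> the bound would exceed
  1, which is why single sparse vertices are tolerated as exceptional.\<close>

lemma prob_sparse_chain: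
  assumes d: "eff_degree n m p \<le> real n powr (9/100)" and b: "1 \<le> b" "Suc b < large_size n"
  shows "measure_pmf.prob (incidences n m p)
     {\<omega>. \<exists>xs. length xs = Suc b \<and> chain n (rig_edges n m \<omega>) xs \<and> real (card (set xs)) \<le> real n / 800 \<and>
        sparse_nbhd n (eff_degree n m p) (rig_edges n m \<omega>) (set xs)}
    \<le> 64 * real n powr (- 8/100)"
proof -
  define M where "M = incidences n m p"
  define P where "P = measure_pmf.prob M"
  define \<Delta> where "\<Delta> = real n powr (20/100)"
  define D where "D = nat \<lfloor>\<Delta>\<rfloor>"
  define K where "K = (1 + D) ^ 4"
  define Bd where "Bd = {\<omega>. \<exists>v\<in>{1..n}. \<Delta> \<le> real (card (nbhd (rig_edges n m \<omega>) {v}))}"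
  define F where "F = {xs. set xs \<subseteq> {1..n} \<and> length xs = Suc b}"
  define Ch where "Ch xs = {\<omega>. chain n (rig_edges n m \<omega>) xs}" for xs
  define Sp where "Sp xs = {\<omega>. real (card (set xs)) \<le> real n / 800 \<and> sparse_nbhd n (eff_degree n m p) (rig_edges n m \<omega>) (set xs)}" for xs
  have int: "integrable (measure_pmf M) f" for f :: "_ \<Rightarrow> real" unfolding M_def by (rule integrable_incidences)
  have \<Delta>1: "1 \<le> \<Delta>" using ample by (simp add: ample_def \<Delta>_def)
  have D\<Delta>: "real D \<le> \<Delta>" "\<Delta> < real D + 1" using \<Delta>1 unfolding D_def by linarith+
  have fF: "finite F" unfolding F_def by (rule finite_lists_length_eq) simp
  have cF: "card F = n ^ Suc b" unfolding F_def using card_lists_length_eq[of "{1..n}" "Suc b"] by simp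
  have bs: "real (Suc b) \<le> real n powr (6/100)" using b(2) large_size_bounds(2) by linarith
  have PBd: "P Bd \<le> exp (- (2 * real n powr (6/100) * ln (real n)))"
    unfolding P_def M_def Bd_def \<Delta>_def by (rule prob_max_degree[OF d])
  have K: "real K \<le> 16 * real n powr (80/100)"
  proof -
    have "real K = (1 + real D) ^ 4" by (simp add: K_def)
    also have "\<dots> \<le> (2 * \<Delta>) ^ 4" using D\<Delta> \<Delta>1 by (intro power_mono) auto
    also have "\<dots> = 16 * \<Delta> ^ 4" by (simp add: power_mult_distrib)
    also have "\<Delta> ^ 4 = real n powr (80/100)" using n_pos by (simp add: \<Delta>_def powr_power)
    finally show ?thesis .
  qed
  define Z where "Z = real n * (real (Suc b) * real K) ^ b"
  have Z1: "1 \<le> Z"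
  proof -
    have "1 \<le> K" by (simp add: K_def)
    then have "1 * 1 \<le> real (Suc b) * real K" by (intro mult_mono) auto
    then have "1 \<le> (real (Suc b) * real K) ^ b" by (intro one_le_power) simp
    then have "1 * 1 \<le> real n * (real (Suc b) * real K) ^ b" using n5000 by (intro mult_mono) auto
    then show ?thesis by (simp add: Z_def)
  qed
  \<comment> \<open>Off the event \<open>Bd\<close> all degrees are below \<open>\<Delta>\<close>
    and chains are counted through balls; on \<open>Bd\<close> the trivial count is compensated by
    its probability.\<close>
  have count: "(\<Sum>xs\<in>F. indicator (Ch xs) \<omega>) \<le> Z + real (n ^ Suc b) * indicator Bd \<omega>" for \<omega>
  proof -
    have eq: "(\<Sum>xs\<in>F. indicator (Ch xs) \<omega> :: real) = real (card {xs\<in>F. chain n (rig_edges n m \<omega>) xs})"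
      using fF by (simp add: indicator_def sum.If_cases Int_def Ch_def)
    show ?thesis
    proof (cases "\<omega> \<in> Bd")
      case True
      have "card {xs\<in>F. chain n (rig_edges n m \<omega>) xs} \<le> n ^ Suc b"
        using card_mono[OF fF, of "{xs\<in>F. chain n (rig_edges n m \<omega>) xs}"] cF by auto
      then have "real (card {xs\<in>F. chain n (rig_edges n m \<omega>) xs}) \<le> real (n ^ Suc b)" by (rule of_nat_mono)
      then show ?thesis unfolding eq using True Z1 by simp
    next
      case False
      have "card (nbhd (rig_edges n m \<omega>) {v}) \<le> D" if "v \<in> {1..n}" for v
      proof -
        have "\<not> \<Delta> \<le> real (card (nbhd (rig_edges n m \<omega>) {v}))" using False that unfolding Bd_def by blast
        then show ?thesis using D\<Delta>(2) by linarith
      qed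
      from near_ball[OF graph_on_rig_edges this, where k = 4]
      have nb: "\<And>y. y \<in> {1..n} \<Longrightarrow> {x. (y, x) \<in> near (rig_edges n m \<omega>) 4} \<subseteq> {1..n} \<and>
           card {x. (y, x) \<in> near (rig_edges n m \<omega>) 4} \<le> K" unfolding K_def by blast
      have "card {xs\<in>F. chain n (rig_edges n m \<omega>) xs} \<le> card {xs. chain n (rig_edges n m \<omega>) xs \<and> length xs = Suc b}"
        using card_chains[OF nb, of b] by (intro card_mono) (auto simp: F_def)
      also have "\<dots> \<le> n * (Suc b * K) ^ b" using card_chains[OF nb, of b] by blast
      finally have "real (card {xs\<in>F. chain n (rig_edges n m \<omega>) xs}) \<le> real (n * (Suc b * K) ^ b)" by (rule of_nat_mono)
      then have "real (card {xs\<in>F. chain n (rig_edges n m \<omega>) xs}) \<le> Z"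
        by (simp only: Z_def of_nat_mult of_nat_power)
      then show ?thesis unfolding eq using False by simp
    qed
  qed
  have EC: "(\<Sum>xs\<in>F. P (Ch xs)) \<le> 2 * Z"
  proof -
    have "(\<Sum>xs\<in>F. P (Ch xs)) = measure_pmf.expectation M (\<lambda>\<omega>. \<Sum>xs\<in>F. indicator (Ch xs) \<omega>)"
      by (simp add: Bochner_Integration.integral_sum int P_def)
    also have "\<dots> \<le> measure_pmf.expectation M (\<lambda>\<omega>. Z + real (n ^ Suc b) * indicator Bd \<omega>)"
      by (rule integral_mono[OF int int]) (rule count)
    also have "\<dots> = Z + real (n ^ Suc b) * P Bd" by (simp add: int P_def)
    also have "real (n ^ Suc b) * P Bd \<le> exp (ln (real n) * real (Suc b)) * exp (- (2 * real n powr (6/100) * ln (real n)))"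
    proof (rule mult_mono[OF _ PBd])
      show "real (n ^ Suc b) \<le> exp (ln (real n) * real (Suc b))"
        using n_pos by (simp only: exp_of_nat2_mult exp_ln of_nat_power)
    qed (auto simp: P_def)
    also have "\<dots> \<le> 1"
    proof -
      have "ln (real n) * real (Suc b) \<le> ln (real n) * (2 * real n powr (6/100))"
        using bs L_ge by (intro mult_left_mono) auto
      then show ?thesis by (simp add: mult_exp_exp mult_ac)
    qed
    finally show ?thesis using Z1 by simp
  qed
  define e where "e = exp (- (97/100 * ln (real n) * real (Suc b)))"
  have each: "P (Ch xs \<inter> Sp xs) \<le> P (Ch xs) * e" if xs: "xs \<in> F" for xs
  proof (cases "distinct xs")
    case True
    \<comment> \<open>More incidences make a chain more likely and a sparse neighbourhood less
      likely.\<close>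
    have "P (Ch xs \<inter> Sp xs) \<le> P (Ch xs) * P (Sp xs)"
      unfolding P_def M_def
    proof (rule harris_prob)
      fix h h' :: "nat \<times> nat \<Rightarrow> bool" assume "\<And>x. h x \<Longrightarrow> h' x"
      then have sub: "rig_edges n m h \<subseteq> rig_edges n m h'" by (rule rig_edges_mono)
      show "h \<in> Ch xs \<Longrightarrow> h' \<in> Ch xs" using chain_mono[OF sub] by (simp add: Ch_def)
      show "h' \<in> Sp xs \<Longrightarrow> h \<in> Sp xs" using sparse_antimono[OF sub graph_on_rig_edges] by (simp add: Sp_def)
    qed (use p in auto)
    also have "P (Sp xs) \<le> exp (- (97/100 * ln (real n) * real (card (set xs))))"
      unfolding P_def M_def Sp_def by (rule prob_sparse_le) (use xs \<rho>_ge L_ge in \<open>auto simp: F_def\<close>)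
    also have "card (set xs) = Suc b" using True xs by (simp add: distinct_card F_def)
    finally show ?thesis by (simp add: e_def mult_left_mono P_def)
  next
    case False
    then have "Ch xs = {}" using chain_set[of n _ xs] by (auto simp: Ch_def)
    then show ?thesis by (simp add: P_def)
  qed
  have "{\<omega>. \<exists>xs. length xs = Suc b \<and> chain n (rig_edges n m \<omega>) xs \<and> real (card (set xs)) \<le> real n / 800 \<and>
        sparse_nbhd n (eff_degree n m p) (rig_edges n m \<omega>) (set xs)} \<subseteq> {\<omega>. \<exists>xs\<in>F. \<omega> \<in> Ch xs \<inter> Sp xs}"
    using chain_set[of n] by (auto simp: F_def Ch_def Sp_def)
  then have "P {\<omega>. \<exists>xs. length xs = Suc b \<and> chain n (rig_edges n m \<omega>) xs \<and> real (card (set xs)) \<le> real n / 800 \<and>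
        sparse_nbhd n (eff_degree n m p) (rig_edges n m \<omega>) (set xs)} \<le> P {\<omega>. \<exists>xs\<in>F. \<omega> \<in> Ch xs \<inter> Sp xs}"
    unfolding P_def by (rule measure_pmf.finite_measure_mono) simp
  also have "\<dots> \<le> (\<Sum>xs\<in>F. P (Ch xs \<inter> Sp xs))" unfolding P_def using prob_Bex_le[OF fF, of M "\<lambda>xs \<omega>. \<omega> \<in> Ch xs \<inter> Sp xs"]
    by (simp only: Collect_mem_eq)
  also have "\<dots> \<le> (\<Sum>xs\<in>F. P (Ch xs) * e)" by (rule sum_mono) (rule each)
  also have "\<dots> = (\<Sum>xs\<in>F. P (Ch xs)) * e" by (simp add: sum_distrib_right)
  also have "\<dots> \<le> 2 * Z * e" using EC by (intro mult_right_mono) (auto simp: e_def)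
  also have "\<dots> = 2 * real n powr (3/100) * (real (Suc b) * real K * real n powr (- 97/100)) ^ b"
  proof -
    have "e = (real n powr (- 97/100)) ^ Suc b"
      by (simp add: e_def mult_ac del: of_nat_Suc power_Suc flip: exp_ln_powr exp_of_nat_mult)
    moreover have "real n * real n powr (- 97/100) = real n powr (3/100)"
      using n_pos powr_add[of "real n" 1 "- 97/100"] by simp
    ultimately show ?thesis by (simp add: Z_def power_mult_distrib mult_ac)
  qed
  also have "\<dots> \<le> 2 * real n powr (3/100) * (32 * real n powr (- 11/100))"
  proof (rule mult_left_mono)
    have "real (Suc b) * real K * real n powr (- 97/100) \<le> (2 * real n powr (6/100)) * (16 * real n powr (80/100)) * real n powr (- 97/100)"
      using bs K by (intro mult_right_mono mult_mono) auto
    also have "\<dots> = 32 * real n powr (- 11/100)"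
      using powr_add[of "real n" "6/100" "80/100"] powr_add[of "real n" "86/100" "- 97/100"] by simp
    finally have le: "real (Suc b) * real K * real n powr (- 97/100) \<le> 32 * real n powr (- 11/100)" .
    then have "(real (Suc b) * real K * real n powr (- 97/100)) ^ b \<le> (32 * real n powr (- 11/100)) ^ b"
      by (intro power_mono) auto
    also have "\<dots> \<le> (32 * real n powr (- 11/100)) ^ 1"
      using b ample by (intro power_decreasing) (auto simp: ample_def)
    finally show "(real (Suc b) * real K * real n powr (- 97/100)) ^ b \<le> 32 * real n powr (- 11/100)" by simp
  qed simp
  also have "\<dots> = 64 * real n powr (- 8/100)"
    using powr_add[of "real n" "3/100" "- 11/100"] by simp
  finally show ?thesis by (simp add: P_def M_def)
qed


lemma expanderI:
  assumes deg2: "\<forall>v\<in>{1..n}. 2 \<le> card (nbhd (rig_edges n m \<omega>) {v})"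
    and conn: "\<not> (\<exists>Y\<subseteq>{1..n}. nbhd (rig_edges n m \<omega>) Y = {} \<and> 1 / 10 ^ 6 / 12 * real n \<le> real (card Y) \<and> real (card Y) \<le> real n / 2)"
    and "scattered (rig_edges n m \<omega>) X"
    and exp: "\<And>C. C \<subseteq> {1..n} \<Longrightarrow> C \<inter> X = {} \<Longrightarrow> s0 \<le> card C \<Longrightarrow> real (card C) \<le> real n / 800 \<Longrightarrow>
        \<not> sparse_nbhd n (eff_degree n m p) (rig_edges n m \<omega>) C"
    and "s0 \<ge> 1" "s0 = 1 \<or> X = {} \<and> (\<forall>v\<in>{1..n}. 3 * s0 \<le> card (nbhd (rig_edges n m \<omega>) {v}))"
  shows "expander n (rig_edges n m \<omega>) X s0 (1 / 10 ^ 6) (eff_degree n m p)"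
proof
  show "12 \<le> 1 / 10 ^ 6 * eff_degree n m p" using d_ge \<rho>_ge L_ge by simp
  show "1 / 10 ^ 6 * min (eff_degree n m p * real (card C)) (real n) < real (card (nbhd (rig_edges n m \<omega>) C))"
    if "C \<subseteq> {1..n}" "C \<inter> X = {}" "s0 \<le> card C" "real (card C) \<le> real n / 800" for C
    using exp[OF that] by (simp only: sparse_nbhd_def not_le)
  show "real n / 2 < real (card Y)"
    if "Y \<subseteq> {1..n}" "nbhd (rig_edges n m \<omega>) Y = {}" "1 / 10 ^ 6 / 12 * real n \<le> real (card Y)" for Y
    using conn that by (meson not_le)
qed (use assms graph_on_rig_edges in auto)

text \<open>Three regimes. At intensity at least 3 ln n all sets of moderate size expand. Below
  that, if \<open>d\<close> exceeds n^0.09, every vertex lies in a large feature, so all degrees are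
  at least \<open>3 * large_size n\<close> and expansion of large sets suffices. Otherwise sparse
  vertices are declared exceptional. Minimum degree 2 belongs to the event because
  \<open>expander\<close> requires it and it need not hold with high probability.\<close>

lemma prob_not_expander:
  "measure_pmf.prob (incidences n m p)
     {\<omega>. (\<forall>v\<in>{1..n}. 2 \<le> card (nbhd (rig_edges n m \<omega>) {v})) \<and>
        \<not> (\<exists>X s0. expander n (rig_edges n m \<omega>) X s0 (1 / 10 ^ 6) (eff_degree n m p))} \<le> expansion_error n"
proof -
  define M where "M = incidences n m p"
  define P where "P = measure_pmf.prob M"
  define E where "E \<omega> = rig_edges n m \<omega>" for \<omega>
  define d where "d = eff_degree n m p"
  define Bad where "Bad = {\<omega>. (\<forall>v\<in>{1..n}. 2 \<le> card (nbhd (E \<omega>) {v})) \<and> \<not> (\<exists>X s0. expander n (E \<omega>) X s0 (1 / 10 ^ 6) d)}"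
  define A1 where "A1 = {\<omega>. \<exists>Y\<subseteq>{1..n}. nbhd (E \<omega>) Y = {} \<and> 1 / 10 ^ 6 / 12 * real n \<le> real (card Y) \<and> real (card Y) \<le> real n / 2}"
  define A2 where "A2 = {\<omega>. \<exists>S\<subseteq>{1..n}. large_size n \<le> card S \<and> real (card S) \<le> real n / 800 \<and> sparse_nbhd n d (E \<omega>) S}"
  have L: "0 \<le> ln (real n)" using L_ge by simp
  have PA1: "P A1 \<le> exp (- real n)" unfolding P_def M_def A1_def E_def by (rule prob_disconnected)
  have PA2: "P A2 \<le> real n * exp (- (real n powr (6/100)))"
    unfolding P_def M_def A2_def E_def d_def by (rule prob_large_sparse)
  have mono: "P A \<le> P B" if "A \<subseteq> B" for A B
    unfolding P_def by (rule measure_pmf.finite_measure_mono[OF that]) simp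
  have Un: "P (A \<union> B) \<le> P A + P B" for A B unfolding P_def by (rule measure_Un_le) auto
  have terms: "0 \<le> real n * real n powr (- 19/10)" "0 \<le> real n * exp (- (real n powr (6/100)))"
    "0 \<le> 6 * ln (real n) * real n * exp (- (real n powr (8/100) / 4))" "0 \<le> 128 * real n powr (- 2/100)"
    using L by auto
  have iso: "\<omega> \<notin> Bad" if "\<forall>v\<in>{1..n}. 2 \<le> card (nbhd (E \<omega>) {v}) \<Longrightarrow> \<exists>X s0. expander n (E \<omega>) X s0 (1 / 10 ^ 6) d" for \<omega>
    using that by (auto simp: Bad_def)
  note expI = expanderI[folded E_def d_def]
  have "P Bad \<le> expansion_error n"
  proof (cases "3 * ln (real n) \<le> intensity n m p")
    case True
    define A3 where "A3 = {\<omega>. \<exists>S\<subseteq>{1..n}. 1 \<le> card S \<and> real (card S) \<le> real n / 800 \<and> sparse_nbhd n d (E \<omega>) S}"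
    have PA3: "P A3 \<le> real n * real n powr (- 19/10)"
      unfolding P_def M_def A3_def E_def d_def by (rule prob_any_sparse[OF True])
    have "Bad \<subseteq> A1 \<union> A3"
    proof (rule ccontr)
      assume "\<not> Bad \<subseteq> A1 \<union> A3"
      then obtain \<omega> where \<omega>: "\<omega> \<in> Bad" "\<omega> \<notin> A1" "\<omega> \<notin> A3" by blast
      have "expander n (E \<omega>) {} 1 (1 / 10 ^ 6) d"
      proof (rule expI)
        show "\<not> sparse_nbhd n d (E \<omega>) C" if "C \<subseteq> {1..n}" "C \<inter> {} = {}" "1 \<le> card C" "real (card C) \<le> real n / 800" for C
          using \<omega>(3) that unfolding A3_def by blast
      qed (use \<omega>(1,2) in \<open>auto simp: Bad_def A1_def scattered_def\<close>)
      then show False using \<omega>(1) unfolding Bad_def by blast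
    qed
    then have "P Bad \<le> P A1 + P A3" using mono[of Bad "A1 \<union> A3"] Un[of A1 A3] by linarith
    then show ?thesis using PA1 PA3 terms unfolding expansion_error_def by linarith
  next
    case \<rho>: False
    show ?thesis
    proof (cases "d \<le> real n powr (9/100)")
      case False
      define A3 where "A3 = {\<omega>. \<exists>w\<in>{1..m}. real (card {v\<in>{1..n}. \<omega> (v, w)}) \<le> real n powr (8/100) / 4}"
      have PA3: "P A3 \<le> 6 * ln (real n) * real n * exp (- (real n powr (8/100) / 4))"
        unfolding P_def M_def A3_def by (rule prob_small_features) (use False \<rho> in \<open>auto simp: d_def\<close>)
      have "Bad \<subseteq> A1 \<union> (A2 \<union> A3)"
      proof (rule ccontr)
        assume "\<not> Bad \<subseteq> A1 \<union> (A2 \<union> A3)"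
        then obtain \<omega> where \<omega>: "\<omega> \<in> Bad" "\<omega> \<notin> A1" "\<omega> \<notin> A2" "\<omega> \<notin> A3" by blast
        \<comment> \<open>A vertex with a neighbour belongs to some feature, and all other members
          of that feature are its neighbours.\<close>
        have deg: "3 * large_size n \<le> card (nbhd (E \<omega>) {v})" if v: "v \<in> {1..n}" for v
        proof -
          have "2 \<le> card (nbhd (E \<omega>) {v})" using \<omega>(1) v unfolding Bad_def by blast
          then have "nbhd (E \<omega>) {v} \<noteq> {}" by auto
          then obtain u where "{v, u} \<in> E \<omega>" by (auto simp: nbhd_def)
          then obtain w where w: "w \<in> {1..m}" "\<omega> (v, w)" unfolding E_def rig_edges_iff by blast
          have "\<not> real (card {x\<in>{1..n}. \<omega> (x, w)}) \<le> real n powr (8/100) / 4"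
            using \<omega>(4) w(1) unfolding A3_def by blast
          moreover have "card {x\<in>{1..n}. \<omega> (x, w)} - card {v} \<le> card ({x\<in>{1..n}. \<omega> (x, w)} - {v})"
            by (rule diff_card_le_card_Diff) simp
          moreover have "card ({x\<in>{1..n}. \<omega> (x, w)} - {v}) \<le> card (nbhd (E \<omega>) {v})"
          proof (rule card_mono)
            show "finite (nbhd (E \<omega>) {v})" unfolding E_def by (rule finite_nbhd[OF graph_on_rig_edges])
            show "{x\<in>{1..n}. \<omega> (x, w)} - {v} \<subseteq> nbhd (E \<omega>) {v}"
            proof
              fix x assume "x \<in> {x\<in>{1..n}. \<omega> (x, w)} - {v}"
              then have "{v, x} \<in> E \<omega>" "x \<noteq> v" unfolding E_def rig_edges_iff using v w by auto
              then show "x \<in> nbhd (E \<omega>) {v}" by (simp add: nbhd_def)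
            qed
          qed
          moreover have "3 * real (large_size n) + 1 \<le> real n powr (8/100) / 4"
            using ample large_size_bounds(2) by (simp add: ample_def)
          ultimately show ?thesis by simp
        qed
        have "expander n (E \<omega>) {} (large_size n) (1 / 10 ^ 6) d"
        proof (rule expI)
          show "\<not> sparse_nbhd n d (E \<omega>) C" if "C \<subseteq> {1..n}" "C \<inter> {} = {}" "large_size n \<le> card C" "real (card C) \<le> real n / 800" for C
            using \<omega>(3) that unfolding A2_def by blast
        qed (use \<omega>(1,2) deg large_size_bounds(3) in \<open>auto simp: Bad_def A1_def scattered_def\<close>)
        then show False using \<omega>(1) unfolding Bad_def by blast
      qed
      then have "P Bad \<le> P A1 + (P A2 + P A3)"
        using mono[of Bad "A1 \<union> (A2 \<union> A3)"] Un[of A1 "A2 \<union> A3"] Un[of A2 A3] by linarith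
      then show ?thesis using PA1 PA2 PA3 terms unfolding expansion_error_def by linarith
    next
      case dn: True
      define Q where "Q b \<omega> \<longleftrightarrow> (\<exists>xs. length xs = Suc b \<and> chain n (E \<omega>) xs \<and> real (card (set xs)) \<le> real n / 800 \<and> sparse_nbhd n d (E \<omega>) (set xs))" for b \<omega>
      define I where "I = {b. 1 \<le> b \<and> Suc b < large_size n}"
      define A3 where "A3 = {\<omega>. \<exists>b\<in>I. Q b \<omega>}"
      have I: "finite I" "card I \<le> large_size n"
      proof -
        have "I \<subseteq> {..<large_size n}" by (auto simp: I_def)
        then show "finite I" "card I \<le> large_size n" using finite_subset[of I "{..<large_size n}"] card_mono[of "{..<large_size n}" I] by auto
      qed
      have "P A3 \<le> real (card I) * (64 * real n powr (- 8/100))"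
        unfolding P_def A3_def
      proof (rule prob_Bex_le_const[OF I(1)])
        fix b assume "b \<in> I"
        then show "measure_pmf.prob M {\<omega>. Q b \<omega>} \<le> 64 * real n powr (- 8/100)"
          unfolding M_def Q_def E_def d_def
          by (intro prob_sparse_chain) (use dn in \<open>auto simp: I_def d_def\<close>)
      qed
      also have "\<dots> \<le> (2 * real n powr (6/100)) * (64 * real n powr (- 8/100))"
      proof (rule mult_right_mono)
        have "2 < real n powr (6/100)" using ample by (simp add: ample_def)
        then show "real (card I) \<le> 2 * real n powr (6/100)" using I(2) large_size_bounds(2) by linarith
      qed simp
      also have "\<dots> = 128 * real n powr (- 2/100)" using powr_add[of "real n" "6/100" "- 8/100"] by simp
      finally have PA3: "P A3 \<le> 128 * real n powr (- 2/100)" .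
      have "Bad \<subseteq> A1 \<union> (A2 \<union> A3)"
      proof (rule ccontr)
        assume "\<not> Bad \<subseteq> A1 \<union> (A2 \<union> A3)"
        then obtain \<omega> where \<omega>: "\<omega> \<in> Bad" "\<omega> \<notin> A1" "\<omega> \<notin> A2" "\<omega> \<notin> A3" by blast
        define X where "X = {v\<in>{1..n}. sparse_nbhd n d (E \<omega>) {v}}"
        have G: "graph_on n (E \<omega>)" unfolding E_def by (rule graph_on_rig_edges)
        have d0: "0 \<le> d" using d_pos by (simp add: d_def)
        have small: "d * (real n powr (6/100) + 1) \<le> real n / 2"
        proof -
          have "d * (real n powr (6/100) + 1) \<le> real n powr (9/100) * (real n powr (6/100) + 1)"
            by (rule mult_right_mono[OF dn]) simp
          also have "\<dots> \<le> real n / 2" using ample by (simp add: ample_def)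
          finally show ?thesis .
        qed
        have nochain: "\<not> sparse_nbhd n d (E \<omega>) (set xs)"
          if xs: "chain n (E \<omega>) xs" "2 \<le> length xs" "length xs < large_size n" for xs
        proof
          assume sp: "sparse_nbhd n d (E \<omega>) (set xs)"
          have "card (set xs) = length xs" using chain_set[OF xs(1)] by (simp add: distinct_card)
          moreover have "real (large_size n) \<le> real n / 800"
          proof -
            have "real n powr (6/100) + 1 \<le> d * (real n powr (6/100) + 1) / 10 ^ 6"
            proof -
              have "10 ^ 6 \<le> d" using d_ge \<rho>_ge L_ge unfolding d_def by simp
              then have "10 ^ 6 * (real n powr (6/100) + 1) \<le> d * (real n powr (6/100) + 1)"
                by (rule mult_right_mono) simp
              then show ?thesis by simp
            qed
            then show ?thesis using small large_size_bounds(2) by simp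
          qed
          ultimately have "real (card (set xs)) \<le> real n / 800" using xs(3) by linarith
          then have "Q (length xs - 1) \<omega>" unfolding Q_def using xs sp by (intro exI[of _ xs]) auto
          moreover have "length xs - 1 \<in> I" using xs by (auto simp: I_def)
          ultimately show False using \<omega>(4) unfolding A3_def by blast
        qed
        \<comment> \<open>Two close exceptional vertices form a chain of length 2, sparse because
          the sizes of their neighbourhoods add up at most; \<open>nochain\<close> excludes
          it.\<close>
        have sc: "scattered (E \<omega>) X"
          unfolding scattered_def
        proof (intro ballI impI, rule ccontr)
          fix x y assume xy: "x \<in> X" "y \<in> X" "(x, y) \<in> near (E \<omega>) 4" "x \<noteq> y"
          have "chain n (E \<omega>) [y, x]" using xy by (auto simp: X_def)
          then have "\<not> sparse_nbhd n d (E \<omega>) (set [y, x])" by (rule nochain) (use large_size_bounds(3) in simp_all)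
          moreover have "sparse_nbhd n d (E \<omega>) {x, y}"
          proof -
            have "nbhd (E \<omega>) {x, y} \<subseteq> nbhd (E \<omega>) {x} \<union> nbhd (E \<omega>) {y}" by (auto simp: nbhd_def)
            then have "card (nbhd (E \<omega>) {x, y}) \<le> card (nbhd (E \<omega>) {x} \<union> nbhd (E \<omega>) {y})"
              using finite_nbhd[OF G] by (intro card_mono) auto
            also have "\<dots> \<le> card (nbhd (E \<omega>) {x}) + card (nbhd (E \<omega>) {y})" by (rule card_Un_le)
            finally have c: "real (card (nbhd (E \<omega>) {x, y})) \<le> real (card (nbhd (E \<omega>) {x})) + real (card (nbhd (E \<omega>) {y}))"
              by simp
            have "d * 2 \<le> d * (real n powr (6/100) + 1)" using d0 ample by (intro mult_left_mono) (auto simp: ample_def)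
            then have d2: "d * 2 \<le> real n" using small by simp
            have "real (card (nbhd (E \<omega>) {z})) \<le> 1 / 10 ^ 6 * d" if "z \<in> X" for z
            proof -
              have "1 / 10 ^ 6 * min (d * real (card {z})) (real n) \<le> 1 / 10 ^ 6 * d" by simp
              then show ?thesis using that by (auto simp: X_def sparse_nbhd_def)
            qed
            then have "real (card (nbhd (E \<omega>) {x})) \<le> 1 / 10 ^ 6 * d" "real (card (nbhd (E \<omega>) {y})) \<le> 1 / 10 ^ 6 * d"
              using xy by blast+
            then have "real (card (nbhd (E \<omega>) {x, y})) \<le> 1 / 10 ^ 6 * (d * 2)" using c by simp
            moreover have "card {x, y} = 2" using xy(4) by simp
            ultimately show ?thesis using d2 by (simp add: sparse_nbhd_def)
          qed
          ultimately show False by (simp add: insert_commute)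
        qed
        have "expander n (E \<omega>) X 1 (1 / 10 ^ 6) d"
        proof (rule expI)
          \<comment> \<open>Large sets are covered by \<open>A2\<close>. A small sparse set contains
            a sparse chain; chains of length at least 2 are excluded, and a chain of length 1 is a
            vertex of \<open>X\<close>.\<close>
          show "\<not> sparse_nbhd n d (E \<omega>) C" if C: "C \<subseteq> {1..n}" "C \<inter> X = {}" "1 \<le> card C" "real (card C) \<le> real n / 800" for C
          proof (cases "large_size n \<le> card C")
            case True
            then show ?thesis using \<omega>(3) C unfolding A2_def by blast
          next
            case False
            show ?thesis
            proof
              assume sp: "sparse_nbhd n d (E \<omega>) C"
              have "real (card C) \<le> real n powr (6/100) + 1" using False large_size_bounds(2) by linarith
              then have "d * real (card C) \<le> d * (real n powr (6/100) + 1)" using d0 by (rule mult_left_mono)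
              then have dC: "d * real (card C) \<le> real n" using small by simp
              have "C \<noteq> {}" using C(3) by auto
              from sparse_contains_chain[OF G d0 C(1) sp this dC] obtain xs where
                xs: "chain n (E \<omega>) xs" "xs \<noteq> []" "set xs \<subseteq> C" "sparse_nbhd n d (E \<omega>) (set xs)" by blast
              have "finite C" using C(1) by (rule finite_subset) simp
              then have "length xs \<le> card C"
                using card_mono[OF _ xs(3)] chain_set[OF xs(1)] by (simp add: distinct_card)
              then have "\<not> 2 \<le> length xs" using nochain[OF xs(1)] xs(4) False by auto
              then obtain x where "xs = [x]" using xs(2) by (cases xs; cases "tl xs") auto
              then have "x \<in> X \<inter> C" using xs C(1) by (auto simp: X_def)
              then show False using C(2) by blast
            qed
          qed
        qed (use \<omega>(1,2) sc in \<open>auto simp: Bad_def A1_def\<close>)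
        then show False using \<omega>(1) unfolding Bad_def by blast
      qed
      then have "P Bad \<le> P A1 + (P A2 + P A3)"
        using mono[of Bad "A1 \<union> (A2 \<union> A3)"] Un[of A1 "A2 \<union> A3"] Un[of A2 A3] by linarith
      then show ?thesis using PA1 PA2 PA3 terms unfolding expansion_error_def by linarith
    qed
  qed
  then show ?thesis by (simp only: P_def M_def Bad_def E_def d_def)
qed


text \<open>Since \<open>m * p\<close> is at least the intensity, it exceeds a huge constant, and
  the exponent of \<open>prob_few_features\<close> is at least \<open>2 * n\<close>.\<close>

lemma prob_few_features_union:
  fixes \<gamma> :: real
  defines "\<gamma> \<equiv> 1 / 10 ^ 6 / 12"
  shows "measure_pmf.prob (incidences n m p)
    {\<omega>. \<exists>U\<subseteq>{1..n}. \<gamma> * real n \<le> real (card U) \<and>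
       real (card {w\<in>{1..m}. \<exists>u\<in>U. \<omega> (u, w)}) \<le> \<gamma> / 36 * real m * min 1 (real n * p)} \<le> exp (- real n)"
proof -
  let ?F = "{U. U \<subseteq> {1..n} \<and> \<gamma> * real n \<le> real (card U)}"
  let ?Q = "\<lambda>U \<omega>. real (card {w\<in>{1..m}. \<exists>u\<in>U. \<omega> (u, w)}) \<le> \<gamma> / 36 * real m * min 1 (real n * p)"
  have fF: "finite ?F" by (rule finite_subset[of _ "Pow {1..n}"]) auto
  have "card ?F \<le> card (Pow {1..n})" by (rule card_mono) auto
  also have "\<dots> = 2 ^ n" by (simp add: card_Pow)
  finally have "real (card ?F) \<le> real (2 ^ n)" by (rule of_nat_mono)
  also have "\<dots> \<le> exp 1 ^ n" using exp_ge_add_one_self[of 1] by (simp add: power_mono)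
  also have "\<dots> = exp (real n)" by (simp flip: exp_of_nat_mult)
  finally have cF: "real (card ?F) \<le> exp (real n)" .
  have mp: "99 / 100 * 10 ^ 10 \<le> real m * p"
  proof -
    have "intensity n m p \<le> real m * p * 1" unfolding intensity_def using p by (intro mult_left_mono) auto
    then show ?thesis using \<rho>_ge L_ge by simp
  qed
  have "measure_pmf.prob (incidences n m p) {\<omega>. \<exists>U\<in>?F. ?Q U \<omega>} \<le> real (card ?F) * exp (- (2 * real n))"
  proof (rule prob_Bex_le_const[OF fF])
    fix U assume U: "U \<in> ?F"
    have "measure_pmf.prob (incidences n m p) {\<omega>. ?Q U \<omega>} \<le> exp (- (\<gamma> / 36 * real m * (real n * p)))"
      by (rule prob_few_features) (use p n5000 U in \<open>auto simp: \<gamma>_def\<close>)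
    also have "\<dots> \<le> exp (- (2 * real n))"
    proof -
      have "2 * real n \<le> \<gamma> / 36 * (99 / 100 * 10 ^ 10) * real n" by (simp add: \<gamma>_def)
      also have "\<dots> \<le> \<gamma> / 36 * (real m * p) * real n" using mp by (intro mult_right_mono mult_left_mono) (auto simp: \<gamma>_def)
      finally show ?thesis by (simp add: mult_ac)
    qed
    finally show "measure_pmf.prob (incidences n m p) {\<omega>. ?Q U \<omega>} \<le> exp (- (2 * real n))" .
  qed
  also have "\<dots> \<le> exp (real n) * exp (- (2 * real n))" using cF by (rule mult_right_mono) simp
  also have "\<dots> = exp (- real n)" by (simp add: mult_exp_exp)
  finally show ?thesis by (simp add: Bex_def conj_ac)
qed

end

section \<open>Sprinkling\<close>

lemma Pi_pmf_pair:
  assumes A: "finite A"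
  shows "map_pmf (\<lambda>h. (fst \<circ> h, snd \<circ> h)) (Pi_pmf A (d, e) (\<lambda>x. pair_pmf (f x) (g x))) =
    pair_pmf (Pi_pmf A d f) (Pi_pmf A e g)"
proof (rule pmf_eqI)
  fix uv :: "('a \<Rightarrow> 'b) \<times> ('a \<Rightarrow> 'c)"
  obtain u v where uv: "uv = (u, v)" by (cases uv)
  let ?F = "\<lambda>h :: 'a \<Rightarrow> 'b \<times> 'c. (fst \<circ> h, snd \<circ> h)" and ?h = "\<lambda>x. (u x, v x)"
  have inj: "inj ?F" by (intro injI ext) (auto simp: fun_eq_iff prod_eq_iff)
  have eq: "uv = ?F ?h" by (simp add: comp_def uv)
  have "pmf (map_pmf ?F (Pi_pmf A (d, e) (\<lambda>x. pair_pmf (f x) (g x)))) uv =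
      pmf (Pi_pmf A (d, e) (\<lambda>x. pair_pmf (f x) (g x))) ?h"
    unfolding eq by (rule pmf_map_inj'[OF inj])
  also have "\<dots> = pmf (Pi_pmf A d f) u * pmf (Pi_pmf A e g) v"
  proof (cases "(\<forall>x. x \<notin> A \<longrightarrow> u x = d) \<and> (\<forall>x. x \<notin> A \<longrightarrow> v x = e)")
    case True
    then show ?thesis using A by (simp add: pmf_Pi pmf_pair prod.distrib)
  next
    case False
    then have "\<not> (\<forall>x. x \<notin> A \<longrightarrow> ?h x = (d, e))" by auto
    then have "pmf (Pi_pmf A (d, e) (\<lambda>x. pair_pmf (f x) (g x))) ?h = 0" using A by (simp only: pmf_Pi if_False)
    moreover have "pmf (Pi_pmf A d f) u * pmf (Pi_pmf A e g) v = 0" using False A by (auto simp: pmf_Pi)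
    ultimately show ?thesis by simp
  qed
  finally show "pmf (map_pmf ?F (Pi_pmf A (d, e) (\<lambda>x. pair_pmf (f x) (g x)))) uv =
      pmf (pair_pmf (Pi_pmf A d f) (Pi_pmf A e g)) uv" by (simp add: uv pmf_pair)
qed

text \<open>The two descriptions of the colouring for one incidence: deleting with rate
  \<open>q\<close>, or adding independently to the thinned value. The sprinkling rate is determined
  by requiring that neither stage puts the incidence in with probability
  \<open>1 - p\<close>.\<close>

lemma bernoulli_thinning:
  assumes p: "0 < p" "p < 1" and q: "0 < q" "q < 1"
  shows "map_pmf (\<lambda>(b, k). (b \<and> \<not> k, b)) (pair_pmf (bernoulli_pmf p) (bernoulli_pmf q)) =
    map_pmf (\<lambda>(b1, b2). (b1, b1 \<or> b2)) (pair_pmf (bernoulli_pmf (p * (1 - q))) (bernoulli_pmf (p * q / (1 - p * (1 - q)))))"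
    (is "map_pmf ?f ?M = map_pmf ?g ?N")
proof (rule pmf_eqI)
  fix xy :: "bool \<times> bool"
  define p1 p2 where "p1 = p * (1 - q)" and "p2 = p * q / (1 - p * (1 - q))"
  have "p * (1 - q) < 1 * 1" using p q by (intro mult_strict_mono) auto
  then have p1: "0 \<le> p1" "p1 < 1" using p q by (auto simp: p1_def)
  have p2: "(1 - p1) * p2 = p * q" using p1 by (simp add: p2_def p1_def)
  have p2': "0 \<le> p2" using p q p1 by (simp add: p2_def p1_def)
  have "p * q \<le> 1 - p1" using p by (simp add: p1_def algebra_simps)
  then have p2'': "p2 \<le> 1" using p1 by (simp add: p2_def p1_def)
  have fM: "pmf (map_pmf ?f ?M) xy = (\<Sum>z\<in>?f -` {xy}. pmf ?M z)"
    by (simp add: pmf_map measure_measure_pmf_finite)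
  have gN: "pmf (map_pmf ?g ?N) xy = (\<Sum>z\<in>?g -` {xy}. pmf (pair_pmf (bernoulli_pmf p1) (bernoulli_pmf p2)) z)"
    by (simp add: pmf_map measure_measure_pmf_finite p1_def p2_def)
  consider "xy = (True, True)" | "xy = (True, False)" | "xy = (False, True)" | "xy = (False, False)"
    by (cases xy) auto
  then show "pmf (map_pmf ?f ?M) xy = pmf (map_pmf ?g ?N) xy"
  proof cases
    case 1
    have "?f -` {xy} = {(True, False)}" "?g -` {xy} = {(True, True), (True, False)}" unfolding 1 by auto
    then show ?thesis unfolding fM gN using p q p1 p2' p2'' by (simp add: pmf_pair p1_def algebra_simps)
  next
    case 2
    have "?f -` {xy} = {}" "?g -` {xy} = {}" unfolding 2 by auto
    then show ?thesis unfolding fM gN by simp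
  next
    case 3
    have "?f -` {xy} = {(True, True)}" "?g -` {xy} = {(False, True)}" unfolding 3 by auto
    then show ?thesis unfolding fM gN using p q p1 p2 p2' p2'' by (simp add: pmf_pair)
  next
    case 4
    have "?f -` {xy} = {(False, True), (False, False)}" "?g -` {xy} = {(False, False)}" unfolding 4 by auto
    moreover have "(1 - p1) * (1 - p2) = 1 - p"
      using p2 by (simp add: p1_def algebra_simps)
    ultimately show ?thesis unfolding fM gN using p q p1 p2' p2'' by (simp add: pmf_pair algebra_simps)
  qed
qed

lemma incidences_thinning:
  assumes "0 < p" "p < 1" "0 < q" "q < 1"
  defines "p1 \<equiv> p * (1 - q)" and "p2 \<equiv> p * q / (1 - p * (1 - q))"
  shows "map_pmf (\<lambda>(B, K). (\<lambda>x. B x \<and> \<not> K x, B)) (pair_pmf (incidences n m p) (incidences n m q)) =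
    map_pmf (\<lambda>(B1, B2). (B1, \<lambda>x. B1 x \<or> B2 x)) (pair_pmf (incidences n m p1) (incidences n m p2))"
proof -
  let ?A = "{1..n} \<times> {1..m}"
  let ?sp = "\<lambda>h :: nat \<times> nat \<Rightarrow> bool \<times> bool. (fst \<circ> h, snd \<circ> h)"
  have gen: "map_pmf (\<lambda>(B, K). (\<lambda>x. fst (\<phi> (B x, K x)), \<lambda>x. snd (\<phi> (B x, K x)))) (pair_pmf (incidences n m a) (incidences n m b)) =
     map_pmf ?sp (Pi_pmf ?A (False, False) (\<lambda>_. map_pmf \<phi> (pair_pmf (bernoulli_pmf a) (bernoulli_pmf b))))"
    if "\<phi> (False, False) = (False, False)" for \<phi> :: "bool \<times> bool \<Rightarrow> bool \<times> bool" and a b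
    unfolding incidences_def
    by (subst Pi_pmf_pair[symmetric], simp, subst Pi_pmf_map[where dflt = "(False, False)"])
      (auto simp: that map_pmf_comp comp_def)
  have "map_pmf (\<lambda>(B, K). (\<lambda>x. B x \<and> \<not> K x, B)) (pair_pmf (incidences n m p) (incidences n m q)) =
     map_pmf ?sp (Pi_pmf ?A (False, False) (\<lambda>_. map_pmf (\<lambda>(b, k). (b \<and> \<not> k, b)) (pair_pmf (bernoulli_pmf p) (bernoulli_pmf q))))"
    by (subst gen[symmetric]) simp_all
  also have "\<dots> = map_pmf ?sp (Pi_pmf ?A (False, False) (\<lambda>_. map_pmf (\<lambda>(b1, b2). (b1, b1 \<or> b2)) (pair_pmf (bernoulli_pmf p1) (bernoulli_pmf p2))))"
    unfolding p1_def p2_def by (simp only: bernoulli_thinning[OF assms(1-4)])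
  also have "\<dots> = map_pmf (\<lambda>(B1, B2). (B1, \<lambda>x. B1 x \<or> B2 x)) (pair_pmf (incidences n m p1) (incidences n m p2))"
    by (subst gen[symmetric]) simp_all
  finally show ?thesis .
qed

lemma prob_pair_le:
  assumes "finite (set_pmf M)" "finite (set_pmf N)"
    and le: "\<And>x. x \<in> set_pmf M \<Longrightarrow> measure_pmf.prob N {y. (x, y) \<in> S} \<le> b"
  shows "measure_pmf.prob (pair_pmf M N) S \<le> b"
proof -
  have pm: "pair_pmf M N = bind_pmf M (\<lambda>x. map_pmf (Pair x) N)"
    by (simp add: pair_pmf_def map_pmf_def)
  have "measure_pmf.prob (pair_pmf M N) S = measure_pmf.expectation (pair_pmf M N) (indicator S)" by simp
  also have "\<dots> = (\<Sum>x\<in>set_pmf M. pmf M x *\<^sub>R measure_pmf.expectation (map_pmf (Pair x) N) (indicator S))"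
    unfolding pm by (rule pmf_expectation_bind) (use assms in auto)
  also have "\<dots> = (\<Sum>x\<in>set_pmf M. pmf M x * measure_pmf.prob N {y. (x, y) \<in> S})"
    by (intro sum.cong refl) (simp add: vimage_def)
  also have "\<dots> \<le> (\<Sum>x\<in>set_pmf M. pmf M x * b)" using le by (intro sum_mono mult_left_mono) auto
  also have "\<dots> = b" using sum_pmf_eq_1[OF assms(1) order_refl] by (simp flip: sum_distrib_right)
  finally show ?thesis .
qed

lemma prob_incidences_avoid:
  assumes "H \<subseteq> {1..n} \<times> {1..m}" "0 \<le> p" "p \<le> 1"
  shows "measure_pmf.prob (incidences n m p) {\<omega>. \<forall>x\<in>H. \<not> \<omega> x} = (1 - p) ^ card H"
proof -
  let ?A = "{1..n} \<times> {1..m}"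
  have "measure_pmf.prob (incidences n m p) {\<omega>. \<forall>x\<in>H. \<not> \<omega> x} =
      measure_pmf.prob (incidences n m p) (Pi ?A (\<lambda>x. if x \<in> H then {False} else UNIV))"
    by (rule arg_cong[where f = "measure_pmf.prob _"]) (use assms(1) in \<open>auto simp: Pi_def split: if_splits\<close>)
  also have "\<dots> = (\<Prod>x\<in>?A. measure_pmf.prob (bernoulli_pmf p) (if x \<in> H then {False} else UNIV))"
    unfolding incidences_def by (rule measure_Pi_pmf_Pi) simp
  also have "\<dots> = (\<Prod>x\<in>?A. if x \<in> H then 1 - p else 1)"
    using assms(2,3) by (intro prod.cong) (auto simp: measure_pmf_single)
  also have "\<dots> = (1 - p) ^ card H"
    using assms(1) by (subst prod.If_cases) (auto simp: Int_absorb1)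
  finally show ?thesis .
qed

lemma prob_incidence:
  assumes "0 \<le> p" "p \<le> 1"
  shows "measure_pmf.prob (incidences n m p) {\<omega>. \<omega> x} \<le> p"
proof -
  have "measure_pmf.prob (incidences n m p) {\<omega>. \<omega> x} = measure_pmf.prob (map_pmf (\<lambda>\<omega>. \<omega> x) (incidences n m p)) {True}"
    by (simp add: vimage_def)
  also have "\<dots> \<le> p"
    unfolding incidences_def using assms by (subst Pi_pmf_component) (auto simp: measure_pmf_single)
  finally show ?thesis .
qed

section \<open>Failure of HAM\<close>

lemma degree_eq:
  assumes "graph_on n E"
  shows "degree E v = card (nbhd E {v})"
proof -
  have "{e \<in> E. v \<in> e} = (\<lambda>u. {v, u}) ` nbhd E {v}"
  proof
    show "{e \<in> E. v \<in> e} \<subseteq> (\<lambda>u. {v, u}) ` nbhd E {v}"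
    proof
      fix e assume e: "e \<in> {e \<in> E. v \<in> e}"
      then obtain a b where ab: "e = {a, b}" "a \<noteq> b" using assms unfolding graph_on_def by blast
      then obtain u where "e = {v, u}" "u \<noteq> v" using e by auto
      then show "e \<in> (\<lambda>u. {v, u}) ` nbhd E {v}" using e by (auto simp: nbhd_def)
    qed
  qed (auto simp: nbhd_def)
  moreover have "inj_on (\<lambda>u. {v, u}) (nbhd E {v})" by (auto simp: inj_on_def doubleton_eq_iff)
  ultimately show ?thesis by (simp add: degree_def card_image)
qed

lemma min_degree_ge_iff:
  assumes "graph_on n E" "n \<ge> 1"
  shows "2 \<le> min_degree n E \<longleftrightarrow> (\<forall>v\<in>{1..n}. 2 \<le> card (nbhd E {v}))"
proof -
  have "2 \<le> min_degree n E \<longleftrightarrow> (\<forall>x\<in>degree E ` {1..n}. 2 \<le> x)"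
    unfolding min_degree_def using assms(2) by (intro Min_ge_iff) auto
  then show ?thesis using degree_eq[OF assms(1)] by simp
qed

text \<open>An edge is witnessed by two incidences, those of its endpoints with a common feature.
  The run needs at most \<open>n * (D + 2)\<close> edges, and two more per vertex preserve minimum
  degree 2.\<close>

lemma used_incidences:
  fixes n m :: nat and \<omega> :: "nat \<times> nat \<Rightarrow> bool"
  defines "E \<equiv> rig_edges n m \<omega>"
  assumes n: "n \<ge> 1" and deg2: "\<forall>v\<in>{1..n}. 2 \<le> card (nbhd E {v})"
    and path: "ham_path n E D k P"
  shows "\<exists>I. finite I \<and> card I \<le> 2 * (n * (D + 4)) \<and>
    (\<forall>\<omega>1. (\<forall>x. \<omega>1 x \<longrightarrow> \<omega> x) \<longrightarrow> (\<forall>x\<in>I. \<omega>1 x) \<longrightarrow>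
       (\<forall>v\<in>{1..n}. 2 \<le> card (nbhd (rig_edges n m \<omega>1) {v})) \<and> ham_path n (rig_edges n m \<omega>1) D k P) \<and>
    (\<forall>x\<in>I. \<omega> x)"
proof -
  have G: "graph_on n E" unfolding E_def by (rule graph_on_rig_edges)
  from ham_path_robust[OF G path] obtain U where U: "U \<subseteq> E" "finite U" "card U \<le> k * (D + 2)"
    "\<And>H. U \<subseteq> H \<Longrightarrow> H \<subseteq> E \<Longrightarrow> ham_path n H D k P" by blast
  have "k \<le> n" using ham_path_is_path[OF G n path] is_path_length_le[of n E P] by simp
  then have cU: "card U \<le> n * (D + 2)" using U(3) mult_le_mono1[of k n "D + 2"] by linarith
  have "\<exists>N. N \<subseteq> nbhd E {v} \<and> card N = 2" if "v \<in> {1..n}" for v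
    using deg2 that by (meson obtain_subset_with_card_n)
  then obtain N where N: "\<And>v. v \<in> {1..n} \<Longrightarrow> N v \<subseteq> nbhd E {v} \<and> card (N v) = 2" by metis
  define U' where "U' = U \<union> (\<Union>v\<in>{1..n}. (\<lambda>u. {v, u}) ` N v)"
  have fN: "finite (N v)" if "v \<in> {1..n}" for v using N[OF that] by (metis card.infinite zero_neq_numeral)
  have fU': "finite U'" unfolding U'_def using U(2) fN by auto
  have U'E: "U' \<subseteq> E" 
  proof -
    have "{v, u} \<in> E" if "v \<in> {1..n}" "u \<in> N v" for u v
      using N[OF that(1)] that(2) unfolding nbhd_def by blast
    then show ?thesis unfolding U'_def using U(1) by blast
  qed
  have cU': "card U' \<le> n * (D + 4)"
  proof -
    have "card (\<Union>v\<in>{1..n}. (\<lambda>u. {v, u}) ` N v) \<le> (\<Sum>v\<in>{1..n}. card ((\<lambda>u. {v, u}) ` N v))"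
      by (rule card_UN_le) simp
    also have "\<dots> \<le> (\<Sum>v\<in>{1..n}. 2)"
    proof (rule sum_mono)
      fix v assume v: "v \<in> {1..n}"
      then show "card ((\<lambda>u. {v, u}) ` N v) \<le> 2" using card_image_le[OF fN[OF v], of "\<lambda>u. {v, u}"] N[OF v] by simp
    qed
    also have "\<dots> = n * 2" by simp
    finally have "card U' \<le> n * (D + 2) + n * 2"
      unfolding U'_def using cU card_Un_le[of U "\<Union>v\<in>{1..n}. (\<lambda>u. {v, u}) ` N v"] by linarith
    then show ?thesis by (simp add: algebra_simps)
  qed
  have "\<exists>J. finite J \<and> card J \<le> 2 \<and> (\<forall>x\<in>J. \<omega> x) \<and> (\<forall>\<omega>1. (\<forall>x\<in>J. \<omega>1 x) \<longrightarrow> e \<in> rig_edges n m \<omega>1)" if "e \<in> U'" for e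
  proof -
    have eE: "e \<in> E" using that U'E by blast
    then obtain u v where e: "e = {u, v}" using G unfolding graph_on_def by blast
    then obtain w where w: "u \<noteq> v" "u \<in> {1..n}" "v \<in> {1..n}" "w \<in> {1..m}" "\<omega> (u, w)" "\<omega> (v, w)"
      using eE unfolding E_def e rig_edges_iff by blast
    have "e \<in> rig_edges n m \<omega>1" if "\<omega>1 (u, w)" "\<omega>1 (v, w)" for \<omega>1
      unfolding e rig_edges_iff using w that by blast
    then show ?thesis using w by (intro exI[of _ "{(u, w), (v, w)}"]) (simp add: card_insert_if)
  qed
  then obtain J where J: "\<And>e. e \<in> U' \<Longrightarrow> finite (J e) \<and> card (J e) \<le> 2 \<and> (\<forall>x\<in>J e. \<omega> x) \<and>
      (\<forall>\<omega>1. (\<forall>x\<in>J e. \<omega>1 x) \<longrightarrow> e \<in> rig_edges n m \<omega>1)" by metis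
  define I where "I = (\<Union>e\<in>U'. J e)"
  have fI: "finite I" unfolding I_def using fU' J by blast
  have "card I \<le> (\<Sum>e\<in>U'. card (J e))" unfolding I_def by (rule card_UN_le[OF fU'])
  also have "\<dots> \<le> (\<Sum>e\<in>U'. 2)" using J by (intro sum_mono) blast
  also have "\<dots> \<le> 2 * (n * (D + 4))" using cU' by simp
  finally have cI: "card I \<le> 2 * (n * (D + 4))" .
  have main: "(\<forall>v\<in>{1..n}. 2 \<le> card (nbhd (rig_edges n m \<omega>1) {v})) \<and> ham_path n (rig_edges n m \<omega>1) D k P"
    if \<omega>1: "\<forall>x. \<omega>1 x \<longrightarrow> \<omega> x" "\<forall>x\<in>I. \<omega>1 x" for \<omega>1
  proof -
    have sub: "rig_edges n m \<omega>1 \<subseteq> E" unfolding E_def by (rule rig_edges_mono) (use \<omega>1(1) in blast)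
    have U'1: "U' \<subseteq> rig_edges n m \<omega>1"
    proof
      fix e assume e: "e \<in> U'"
      then have "\<forall>x\<in>J e. \<omega>1 x" using \<omega>1(2) unfolding I_def by blast
      then show "e \<in> rig_edges n m \<omega>1" using J[OF e] by blast
    qed
    have "2 \<le> card (nbhd (rig_edges n m \<omega>1) {v})" if v: "v \<in> {1..n}" for v
    proof -
      have "N v \<subseteq> nbhd (rig_edges n m \<omega>1) {v}"
      proof
        fix u assume u: "u \<in> N v"
        then have "{v, u} \<in> U'" unfolding U'_def using v by blast
        moreover have "u \<noteq> v" using N[OF v] u by (auto simp: nbhd_def)
        ultimately show "u \<in> nbhd (rig_edges n m \<omega>1) {v}" using U'1 by (auto simp: nbhd_def)
      qed
      then have "card (N v) \<le> card (nbhd (rig_edges n m \<omega>1) {v})"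
        by (rule card_mono[OF finite_nbhd[OF graph_on_rig_edges]])
      then show ?thesis using N[OF v] by simp
    qed
    moreover have "ham_path n (rig_edges n m \<omega>1) D k P" using U(4)[OF _ sub] U'1 unfolding U'_def by blast
    ultimately show ?thesis by blast
  qed
  show ?thesis using fI cI main J unfolding I_def by blast
qed

text \<open>For a pair of endpoints \<open>a\<close> and \<open>b\<close> and a feature
  \<open>w\<close> that already contains \<open>b\<close>, restoring the incidence of
  \<open>a\<close> with \<open>w\<close> joins the ends of a path in the search, which cannot be
  stuck then. \<open>Z\<close> depends on \<open>\<omega>1\<close> only, so it can be fixed before
  the sprinkling is exposed.\<close>

lemma closing_incidences:
  fixes n m :: nat and \<omega>1 :: "nat \<times> nat \<Rightarrow> bool" and c d \<kappa> :: real
  defines "H \<equiv> rig_edges n m \<omega>1"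
  assumes n: "n \<ge> 1" and ex: "expander n H X s0 c d"
    and path: "ham_path n H D k P" "ham_stage n H D P = Stuck"
    and T: "T \<ge> 1" "real n \<le> (c * d / 6) ^ (T - 1)" "2 * T \<le> D"
    and feat: "\<And>U. U \<subseteq> {1..n} \<Longrightarrow> c / 12 * real n \<le> real (card U) \<Longrightarrow>
        \<kappa> \<le> real (card {w\<in>{1..m}. \<exists>u\<in>U. \<omega>1 (u, w)})" and \<kappa>: "\<kappa> \<ge> 0"
  shows "\<exists>Z\<subseteq>{1..n} \<times> {1..m}. c / 12 * real n * \<kappa> \<le> real (card Z) \<and>
    (\<forall>\<omega>2. ham_stage n (rig_edges n m (\<lambda>x. \<omega>1 x \<or> \<omega>2 x)) D P = Stuck \<longrightarrow> (\<forall>x\<in>Z. \<not> \<omega>2 x))"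
proof -
  interpret expander n H X s0 c d by (rule ex)
  have P: "is_path n H P" using ham_path_is_path[OF graph n path(1)] by blast
  have st: "try_extend n H Q = Stuck" if "Q \<in> set (bfs_paths H D P)" for Q
    using path(2) that unfolding ham_stage_Stuck_iff by blast
  from stuck_pairs[OF P st T] obtain A where A: "A \<subseteq> {1..n}" "c / 12 * real n \<le> real (card A)"
    "\<forall>a\<in>A. \<exists>B\<subseteq>{1..n}. c / 12 * real n \<le> real (card B) \<and>
       (\<forall>b\<in>B. \<exists>Q\<in>set (bfs_paths H D P). {hd Q, last Q} = {a, b})" by blast
  from bchoice[OF A(3)] obtain B where B: "\<forall>a\<in>A. B a \<subseteq> {1..n} \<and> c / 12 * real n \<le> real (card (B a)) \<and>
       (\<forall>b\<in>B a. \<exists>Q\<in>set (bfs_paths H D P). {hd Q, last Q} = {a, b})" by blast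
  have fA: "finite A" using A(1) by (rule finite_subset) simp
  define W where "W a = {w\<in>{1..m}. \<exists>b\<in>B a. \<omega>1 (b, w)}" for a
  define Z where "Z = (SIGMA a:A. W a)"
  have Zsub: "Z \<subseteq> {1..n} \<times> {1..m}" unfolding Z_def W_def using A(1) by auto
  have "c / 12 * real n * \<kappa> \<le> real (card A) * \<kappa>" using A(2) \<kappa> by (rule mult_right_mono)
  also have "\<dots> = (\<Sum>a\<in>A. \<kappa>)" by simp
  also have "\<dots> \<le> (\<Sum>a\<in>A. real (card (W a)))" unfolding W_def using feat B by (intro sum_mono) blast
  also have "\<dots> = real (card Z)" unfolding Z_def using fA by (subst card_SigmaI) (auto simp: W_def)
  finally have cZ: "c / 12 * real n * \<kappa> \<le> real (card Z)" .
  have "\<not> \<omega>2 (a, w)" if stuck: "ham_stage n (rig_edges n m (\<lambda>x. \<omega>1 x \<or> \<omega>2 x)) D P = Stuck"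
    and aw: "(a, w) \<in> Z" for \<omega>2 a w
  proof
    assume \<omega>2: "\<omega>2 (a, w)"
    define F where "F = rig_edges n m (\<lambda>x. \<omega>1 x \<or> \<omega>2 x)"
    have HF: "H \<subseteq> F" unfolding H_def F_def by (rule rig_edges_mono) blast
    have GF: "graph_on n F" unfolding F_def by (rule graph_on_rig_edges)
    from aw obtain b where b: "a \<in> A" "w \<in> {1..m}" "b \<in> B a" "\<omega>1 (b, w)" unfolding Z_def W_def by blast
    then obtain Q where Q: "Q \<in> set (bfs_paths H D P)" "{hd Q, last Q} = {a, b}" using B by blast
    have Qp: "is_path n H Q" using bfs_paths_is_path[OF P Q(1)] by blast
    \<comment> \<open>Further restored incidences do no harm: the search in the larger graph still
      contains \<open>Q\<close>.\<close>
    have "Q \<in> set (bfs_paths F D P)" using Q(1) bfs_paths_mono[OF HF] by blast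
    then have "try_extend n F Q = Stuck" using stuck unfolding F_def ham_stage_Stuck_iff by blast
    from stuck_ends(1,4)[OF HF GF Qp this] have "{a, b} \<notin> F" "a \<noteq> b" using Q(2) by (auto simp: doubleton_eq_iff)
    moreover have "{a, b} \<in> F" if "a \<noteq> b"
      unfolding F_def rig_edges_iff using that b \<omega>2 A(1) B by blast
    ultimately show False by blast
  qed
  then show ?thesis using Zsub cZ by (intro exI[of _ Z]) auto
qed


section \<open>The two regimes\<close>

text \<open>Jensen's inequality for the \<open>k\<close>-th power and the variable taking the value
  1 with probability \<open>q\<close> and \<open>a\<close> otherwise.\<close>

lemma power_mix_le:
  fixes a q :: real
  assumes "0 \<le> a" "a \<le> 1" "0 \<le> q" "q \<le> 1"
  shows "(q + (1 - q) * a) ^ k \<le> q + (1 - q) * a ^ k"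
proof (induction k)
  case (Suc k)
  have "(q + (1 - q) * a) ^ Suc k \<le> (q + (1 - q) * a) * (q + (1 - q) * a ^ k)"
    using Suc assms by (simp add: mult_left_mono)
  also have "\<dots> = q + (1 - q) * a ^ Suc k - q * (1 - q) * ((1 - a) * (1 - a ^ k))"
    by (simp add: algebra_simps)
  also have "\<dots> \<le> q + (1 - q) * a ^ Suc k" using assms by (simp add: power_le_one)
  finally show ?case .
qed simp

text \<open>One factor \<open>1 - q\<close> comes from \<open>m * p\<close>, the other from the
  second factor of the intensity by \<open>power_mix_le\<close>.\<close>

lemma intensity_thinning:
  assumes "0 \<le> p" "p \<le> 1" "0 \<le> q" "q \<le> 1"
  shows "(1 - q)\<^sup>2 * intensity n m p \<le> intensity n m (p * (1 - q))"
proof -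
  have eq: "1 - p * (1 - q) = q + (1 - q) * (1 - p)" by (simp add: algebra_simps)
  have "(1 - q) * (1 - (1 - p) ^ (n - 1)) \<le> 1 - (1 - p * (1 - q)) ^ (n - 1)"
    unfolding eq using power_mix_le[of "1 - p" q "n - 1"] assms by (simp add: algebra_simps)
  then have "real m * p * (1 - q) * ((1 - q) * (1 - (1 - p) ^ (n - 1))) \<le>
      real m * p * (1 - q) * (1 - (1 - p * (1 - q)) ^ (n - 1))"
    using assms by (intro mult_left_mono) auto
  then show ?thesis by (simp only: intensity_def power2_eq_square mult_ac)
qed

text \<open>\<open>T - 1\<close> is at least \<open>L\<close> divided by
  \<open>ln d - ln (ln d)\<close>, and \<open>ln d\<close> is at least 12 times 10^6, so that
  denominator is at most the logarithm of the growth factor. The constant combines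
  \<open>c = 1 / 10 ^ 6\<close>, the 6 in \<open>c * d / 6\<close>, and a factor 2 for passing from
  \<open>d\<close> to the thinned graph.\<close>

lemma ham_T_bounds:
  fixes d L :: real
  assumes n: "n \<ge> 1" and L: "L = ln (real n)" "0 < L" and d: "L / 2 \<le> d"
    and big: "12 * 10 ^ 6 \<le> ln (L / 2)"
  shows "real n \<le> (d / (12 * 10 ^ 6)) ^ (ham_T n d - 1)"
    and "real (ham_T n d) \<le> 2 * L / ln (L / 2) + 2" and "ham_T n d \<ge> 1"
proof -
  have d0: "0 < d" using d L(2) by linarith
  have ld: "ln (L / 2) \<le> ln d" using d L(2) by simp
  then have ld0: "12 * 10 ^ 6 \<le> ln d" using big by linarith
  have "ln (ln d / 2) \<le> ln d / 2 - 1" using ld0 by (intro ln_le_minus_one) auto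
  moreover have "ln (ln d / 2) = ln (ln d) - ln 2" using ld0 by (simp add: ln_div)
  moreover have "ln (2 :: real) \<le> 1" using ln_le_minus_one[of 2] by simp
  ultimately have lld: "ln (ln d) \<le> ln d / 2" by linarith
  define y where "y = ln d - ln (ln d)"
  have y: "ln d / 2 \<le> y" "0 < y" using lld ld0 by (auto simp: y_def)
  have Tdef: "ham_T n d = nat \<lceil>L / y\<rceil> + 1" by (simp add: ham_T_def y_def L(1))
  have Ly: "0 \<le> L / y" using L(2) y(2) by simp
  then have T: "L / y \<le> real (ham_T n d - 1)" "real (ham_T n d) \<le> L / y + 2" unfolding Tdef by linarith+
  show "ham_T n d \<ge> 1" by (simp add: Tdef)
  have "ln (12 * 10 ^ 6) \<le> ln (ln d)" using ld0 by simp
  then have "y \<le> ln (d / (12 * 10 ^ 6))" using d0 by (simp add: y_def ln_div)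
  then have "L / y * y \<le> real (ham_T n d - 1) * ln (d / (12 * 10 ^ 6))"
    using T(1) y(2) Ly by (intro mult_mono) auto
  then have "L \<le> real (ham_T n d - 1) * ln (d / (12 * 10 ^ 6))" using y(2) by simp
  then have "exp L \<le> exp (real (ham_T n d - 1) * ln (d / (12 * 10 ^ 6)))" by simp
  also have "\<dots> = (d / (12 * 10 ^ 6)) ^ (ham_T n d - 1)" using d0 by (simp only: exp_of_nat_mult) simp
  finally show "real n \<le> (d / (12 * 10 ^ 6)) ^ (ham_T n d - 1)" using n by (simp add: L(1))
  have "0 < y * (ln (L / 2) / 2)" using y(2) big by (intro mult_pos_pos) auto
  then have "L / y \<le> L / (ln (L / 2) / 2)" using ld y(1) L(2) by (intro divide_left_mono) auto
  then have "L / y \<le> 2 * L / ln (L / 2)" by (simp add: mult.commute)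
  then have "L / y + 2 \<le> 2 * L / ln (L / 2) + 2" by (rule add_right_mono)
  then show "real (ham_T n d) \<le> 2 * L / ln (L / 2) + 2" by (rule order_trans[OF T(2)])
qed

definition deletion_rate :: "nat \<Rightarrow> real" where
  "deletion_rate n = sqrt (ln (ln (real n))) / (real n * ln (real n))"

text \<open>In order: some used incidence is deleted, the thinned graph does not expand, a large set
  meets few features, and the sprinkling avoids all closing incidences. The first term is
  \<open>2 * (2 * T + 5)\<close> times \<open>n * q\<close>, with \<open>T\<close> bounded by
  \<open>ham_T_bounds\<close>.\<close>

definition failure_bound :: "nat \<Rightarrow> real" where
  "failure_bound n =
     2 * (4 * ln (real n) / ln (ln (real n) / 2) + 9) * (sqrt (ln (ln (real n))) / ln (real n))
     + (expansion_error n + exp (- real n) + exp (- ((1 / 10 ^ 6 / 12)\<^sup>2 / 72 * sqrt (ln (ln (real n))))))"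

lemma prob_failure_high:
  assumes p: "0 < p" "p < 1" and ample: "ample n"
    and \<rho>: "995 / 1000 * ln (real n) \<le> intensity n m p"
    and q: "0 < deletion_rate n" "deletion_rate n \<le> 1 / 1000"
    and big: "12 * 10 ^ 6 \<le> ln (ln (real n) / 2)"
  shows "measure_pmf.prob (incidences n m p)
     {\<omega>. 2 \<le> min_degree n (rig_edges n m \<omega>) \<and> ham_fails n (rig_edges n m \<omega>) (eff_degree n m p)} \<le> failure_bound n"
proof -
  define c \<gamma> :: real where "c = 1 / 10 ^ 6" and "\<gamma> = c / 12"
  define q where "q = deletion_rate n"
  define L where "L = ln (real n)"
  define p1 p2 where "p1 = p * (1 - q)" and "p2 = p * q / (1 - p1)"
  define d d1 where "d = eff_degree n m p" and "d1 = eff_degree n m p1"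
  define T where "T = ham_T n d"
  define D where "D = 2 * T + 1"
  define \<kappa> where "\<kappa> = \<gamma> / 36 * real m * min 1 (real n * p1)"
  define E where "E \<omega> = rig_edges n m \<omega>" for \<omega>
  define deg2 where "deg2 \<omega> \<longleftrightarrow> (\<forall>v\<in>{1..n}. 2 \<le> card (nbhd (E \<omega>) {v}))" for \<omega>
  \<comment> \<open>The path is read off the thinned configuration and the failure off the full one;
    in this form the path is independent of the sprinkling.\<close>
  define \<Psi> where "\<Psi> \<omega>1 \<omega> \<longleftrightarrow> deg2 \<omega>1 \<and> (\<exists>k P. ham_path n (E \<omega>1) D k P \<and> ham_stage n (E \<omega>) D P = Stuck)" for \<omega>1 \<omega>
  have n: "n \<ge> 5000" "10 ^ 10 \<le> L" using ample by (auto simp: ample_def L_def)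
  have n0: "0 < real n" and n1: "n \<ge> 1" using n by auto
  have q: "0 < q" "q \<le> 1 / 1000" using assms by (auto simp: q_def)
  have "p * (1 - q) < 1 * 1" using p q by (intro mult_strict_mono) auto
  then have p1: "0 < p1" "p1 < 1" using p q by (auto simp: p1_def)
  have p2: "p1 * q \<le> p2" "0 \<le> p2" "p2 \<le> 1"
  proof -
    show "0 \<le> p2" using p q p1 by (simp add: p2_def)
    have "p * q \<le> 1 - p1" using p by (simp add: p1_def algebra_simps)
    then show "p2 \<le> 1" using p1 by (simp add: p2_def)
    have "p1 * q \<le> p * q" using p q by (simp add: p1_def mult_left_le)
    also have "\<dots> \<le> p * q / (1 - p1)" using p1 p q by (simp add: le_divide_eq mult_left_le)
    finally show "p1 * q \<le> p2" by (simp add: p2_def)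
  qed
  have sq: "998 / 1000 \<le> (1 - q)\<^sup>2"
  proof -
    have "(1 - q)\<^sup>2 = 1 - 2 * q + q * q" by (simp add: power2_eq_square algebra_simps)
    moreover have "0 \<le> q * q" by simp
    ultimately show ?thesis using q(2) by linarith
  qed
  have \<rho>1: "99 / 100 * ln (real n) \<le> intensity n m p1"
  proof -
    have "998 / 1000 * (995 / 1000 * L) \<le> (1 - q)\<^sup>2 * intensity n m p"
      using sq \<rho> n by (intro mult_mono) (auto simp: L_def)
    also have "\<dots> \<le> intensity n m p1" unfolding p1_def using p q by (intro intensity_thinning) auto
    finally show ?thesis using n(2) unfolding L_def[symmetric] by simp
  qed
  \<comment> \<open>HAM computes \<open>T\<close> from \<open>d\<close>, but the endpoints grow in
    the thinned graph at the rate given by \<open>d1\<close>.\<close>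
  have dd: "d / 2 \<le> d1"
  proof -
    have "1 / 2 * d \<le> (1 - q)\<^sup>2 * d" using sq p by (intro mult_right_mono) (auto simp: d_def eff_degree_def)
    also have "\<dots> = d1" by (simp add: d_def d1_def eff_degree_def p1_def power_mult_distrib)
    finally show ?thesis by simp
  qed
  have "99 / 100 * ln (real n) \<le> intensity n m p" using \<rho> n(2) unfolding L_def[symmetric] by simp
  from d_ge[OF p ample this] have dL: "L / 2 \<le> d" using \<rho> n(2) by (simp add: d_def L_def)
  note T = ham_T_bounds[OF n1 L_def _ dL, folded T_def]
  have L0: "0 < L" and bigL: "12 * 10 ^ 6 \<le> ln (L / 2)" using n(2) big by (auto simp: L_def)
  note T = T[OF L0 bigL]
  have grow: "real n \<le> (c * d1 / 6) ^ (T - 1)"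
  proof -
    have "real n \<le> (d / (12 * 10 ^ 6)) ^ (T - 1)" by (rule T(1))
    also have "\<dots> \<le> (c * d1 / 6) ^ (T - 1)" using dd dL n(2) by (intro power_mono) (auto simp: c_def)
    finally show ?thesis .
  qed
  define \<Phi> where "\<Phi> = {\<omega>. 2 \<le> min_degree n (rig_edges n m \<omega>) \<and> ham_fails n (rig_edges n m \<omega>) d}"
  define N where "N = 2 * (n * (D + 4))"
  have "\<exists>I. finite I \<and> card I \<le> N \<and> (\<forall>\<omega>1. (\<forall>x. \<omega>1 x \<longrightarrow> \<omega> x) \<longrightarrow> (\<forall>x\<in>I. \<omega>1 x) \<longrightarrow> \<Psi> \<omega>1 \<omega>) \<and> (\<forall>x\<in>I. \<omega> x)"
    if "\<omega> \<in> \<Phi>" for \<omega>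
  proof -
    from that obtain k P where kP: "ham_path n (rig_edges n m \<omega>) D k P" "ham_stage n (rig_edges n m \<omega>) D P = Stuck"
      unfolding \<Phi>_def ham_fails_def ham_fails_at_def Let_def D_def T_def by blast
    have "\<forall>v\<in>{1..n}. 2 \<le> card (nbhd (rig_edges n m \<omega>) {v})"
      using that min_degree_ge_iff[OF graph_on_rig_edges n1] unfolding \<Phi>_def by blast
    from used_incidences[OF n1 this kP(1)] obtain I where I: "finite I" "card I \<le> N"
      "\<forall>\<omega>1. (\<forall>x. \<omega>1 x \<longrightarrow> \<omega> x) \<longrightarrow> (\<forall>x\<in>I. \<omega>1 x) \<longrightarrow>
       (\<forall>v\<in>{1..n}. 2 \<le> card (nbhd (rig_edges n m \<omega>1) {v})) \<and> ham_path n (rig_edges n m \<omega>1) D k P"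
      "\<forall>x\<in>I. \<omega> x" unfolding N_def by blast
    have "\<forall>\<omega>1. (\<forall>x. \<omega>1 x \<longrightarrow> \<omega> x) \<longrightarrow> (\<forall>x\<in>I. \<omega>1 x) \<longrightarrow> \<Psi> \<omega>1 \<omega>"
      using I(3) kP(2) unfolding \<Psi>_def deg2_def E_def by blast
    then show ?thesis using I by blast
  qed
  then obtain I where I: "\<And>\<omega>. \<omega> \<in> \<Phi> \<Longrightarrow> finite (I \<omega>) \<and> card (I \<omega>) \<le> N \<and>
     (\<forall>\<omega>1. (\<forall>x. \<omega>1 x \<longrightarrow> \<omega> x) \<longrightarrow> (\<forall>x\<in>I \<omega>. \<omega>1 x) \<longrightarrow> \<Psi> \<omega>1 \<omega>) \<and> (\<forall>x\<in>I \<omega>. \<omega> x)" by metis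
  define J where "J = pair_pmf (incidences n m p) (incidences n m q)"
  define J1 where "J1 = pair_pmf (incidences n m p1) (incidences n m p2)"
  define Lost where "Lost = {(B, K). B \<in> \<Phi> \<and> (\<exists>x\<in>I B. K x)}"
  define Kept where "Kept = {(B, K). \<Psi> (\<lambda>x. B x \<and> \<not> K x) B}"
  have Un: "measure_pmf.prob M (A \<union> B) \<le> measure_pmf.prob M A + measure_pmf.prob M B" for M :: "'x pmf" and A B
    by (rule measure_Un_le) auto
  have "measure_pmf.prob (incidences n m p) \<Phi> = measure_pmf.prob (map_pmf fst J) \<Phi>"
    unfolding J_def map_fst_pair_pmf ..
  also have "\<dots> = measure_pmf.prob J (fst -` \<Phi>)" by simp
  also have "\<dots> \<le> measure_pmf.prob J (Lost \<union> Kept)"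
  proof (rule measure_pmf.finite_measure_mono)
    show "fst -` \<Phi> \<subseteq> Lost \<union> Kept"
    proof
      fix x :: "(nat \<times> nat \<Rightarrow> bool) \<times> (nat \<times> nat \<Rightarrow> bool)" assume "x \<in> fst -` \<Phi>"
      then obtain B K where x: "x = (B, K)" "B \<in> \<Phi>" by (cases x) auto
      show "x \<in> Lost \<union> Kept"
      proof (cases "\<exists>x\<in>I B. K x")
        case False
        have al: "\<forall>\<omega>1. (\<forall>x. \<omega>1 x \<longrightarrow> B x) \<longrightarrow> (\<forall>x\<in>I B. \<omega>1 x) \<longrightarrow> \<Psi> \<omega>1 B"
          using I[OF x(2)] by (elim conjE)
        have "\<forall>x\<in>I B. B x" using I[OF x(2)] by (elim conjE)
        then have "\<Psi> (\<lambda>x. B x \<and> \<not> K x) B"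
          using False by (intro al[rule_format, of "\<lambda>x. B x \<and> \<not> K x"]) simp_all
        then show ?thesis using x by (simp add: Kept_def)
      qed (use x in \<open>simp add: Lost_def\<close>)
    qed
  qed simp
  also have "\<dots> \<le> measure_pmf.prob J Lost + measure_pmf.prob J Kept" by (rule Un)
  also have "measure_pmf.prob J Lost \<le> real N * q"
    unfolding J_def
  proof (rule prob_pair_le[OF finite_incidences finite_incidences])
    fix B
    show "measure_pmf.prob (incidences n m q) {K. (B, K) \<in> Lost} \<le> real N * q"
    proof (cases "B \<in> \<Phi>")
      case True
      have "measure_pmf.prob (incidences n m q) {K. \<exists>x\<in>I B. K x} \<le> real (card (I B)) * q"
      proof (rule prob_Bex_le_const)
        show "finite (I B)" using I[OF True] by (elim conjE)
        show "measure_pmf.prob (incidences n m q) {K. K x} \<le> q" for x by (rule prob_incidence) (use q in auto)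
      qed
      also have "\<dots> \<le> real N * q"
      proof (rule mult_right_mono)
        have "card (I B) \<le> N" using I[OF True] by (elim conjE)
        then show "real (card (I B)) \<le> real N" by simp
      qed (use q in simp)
      finally show ?thesis using True by (simp add: Lost_def)
    qed (use q in \<open>simp add: Lost_def\<close>)
  qed
  also have "real N * q \<le> 2 * (4 * L / ln (L / 2) + 9) * (sqrt (ln L) / L)"
  proof -
    have nq: "real n * q = sqrt (ln L) / L" using n0 by (simp add: q_def deletion_rate_def L_def)
    have "real N * q = 2 * (2 * real T + 5) * (real n * q)" by (simp add: N_def D_def algebra_simps)
    also have "\<dots> \<le> 2 * (4 * L / ln (L / 2) + 9) * (real n * q)"
      using T(2) q n0 by (intro mult_right_mono) auto
    finally show ?thesis unfolding nq .
  qed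
  \<comment> \<open>Here the description changes: the deleted incidences become an independent
    sprinkling on top of \<open>B1\<close>.\<close>
  also have "measure_pmf.prob J Kept = measure_pmf.prob J1 {(B1, B2). \<Psi> B1 (\<lambda>x. B1 x \<or> B2 x)}"
  proof -
    have "measure_pmf.prob J Kept = measure_pmf.prob (map_pmf (\<lambda>(B, K). (\<lambda>x. B x \<and> \<not> K x, B)) J) {(\<omega>1, \<omega>). \<Psi> \<omega>1 \<omega>}"
      unfolding measure_map_pmf by (rule arg_cong[where f = "measure_pmf.prob J"]) (auto simp: Kept_def)
    also have "map_pmf (\<lambda>(B, K). (\<lambda>x. B x \<and> \<not> K x, B)) J = map_pmf (\<lambda>(B1, B2). (B1, \<lambda>x. B1 x \<or> B2 x)) J1"
      unfolding J_def J1_def p2_def p1_def by (rule incidences_thinning) (use p q in auto)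
    also have "measure_pmf.prob \<dots> {(\<omega>1, \<omega>). \<Psi> \<omega>1 \<omega>} = measure_pmf.prob J1 {(B1, B2). \<Psi> B1 (\<lambda>x. B1 x \<or> B2 x)}"
      unfolding measure_map_pmf by (rule arg_cong[where f = "measure_pmf.prob J1"]) auto
    finally show ?thesis .
  qed
  also have "\<dots> \<le> expansion_error n + exp (- real n) + exp (- (\<gamma>\<^sup>2 / 72 * sqrt (ln L)))"
  proof -
    define NE where "NE = {\<omega>. deg2 \<omega> \<and> \<not> (\<exists>X s0. expander n (E \<omega>) X s0 c d1)}"
    define NF where "NF = {\<omega>. \<exists>U\<subseteq>{1..n}. \<gamma> * real n \<le> real (card U) \<and>
       real (card {w\<in>{1..m}. \<exists>u\<in>U. \<omega> (u, w)}) \<le> \<kappa>}"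
    define S where "S = {(B1, B2). \<Psi> B1 (\<lambda>x. B1 x \<or> B2 x) \<and> B1 \<notin> NE \<and> B1 \<notin> NF}"
    have PNE: "measure_pmf.prob (incidences n m p1) NE \<le> expansion_error n"
      unfolding NE_def deg2_def E_def c_def d1_def by (rule prob_not_expander[OF p1 ample \<rho>1])
    have PNF: "measure_pmf.prob (incidences n m p1) NF \<le> exp (- real n)"
      unfolding NF_def \<kappa>_def \<gamma>_def c_def by (rule prob_few_features_union[OF p1 ample \<rho>1])
    have "measure_pmf.prob J1 {(B1, B2). \<Psi> B1 (\<lambda>x. B1 x \<or> B2 x)} \<le> measure_pmf.prob J1 ((fst -` NE \<union> fst -` NF) \<union> S)"
      by (rule measure_pmf.finite_measure_mono) (auto simp: S_def)
    also have "\<dots> \<le> (measure_pmf.prob J1 (fst -` NE) + measure_pmf.prob J1 (fst -` NF)) + measure_pmf.prob J1 S"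
      by (intro order_trans[OF Un] add_right_mono Un)
    also have "measure_pmf.prob J1 (fst -` NE) = measure_pmf.prob (incidences n m p1) NE"
      using measure_map_pmf[of fst J1 NE] unfolding J1_def map_fst_pair_pmf by simp
    also have "measure_pmf.prob J1 (fst -` NF) = measure_pmf.prob (incidences n m p1) NF"
      using measure_map_pmf[of fst J1 NF] unfolding J1_def map_fst_pair_pmf by simp
    also have "measure_pmf.prob J1 S \<le> exp (- (\<gamma>\<^sup>2 / 72 * sqrt (ln L)))"
      unfolding J1_def
    proof (rule prob_pair_le[OF finite_incidences finite_incidences])
      fix B1
      show "measure_pmf.prob (incidences n m p2) {B2. (B1, B2) \<in> S} \<le> exp (- (\<gamma>\<^sup>2 / 72 * sqrt (ln L)))"
      \<comment> \<open>A single \<open>B2\<close> in the event suffices to show that the graph of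
        \<open>B1\<close> expands and fails; these properties no longer refer to
        \<open>B2\<close>.\<close>
      proof (cases "\<exists>B2. (B1, B2) \<in> S")
        case False
        then show ?thesis by simp
      next
        case True
        then obtain B0 where B0: "\<Psi> B1 (\<lambda>x. B1 x \<or> B0 x)" "B1 \<notin> NE" "B1 \<notin> NF" by (auto simp: S_def)
        have subE: "E B1 \<subseteq> E (\<lambda>x. B1 x \<or> B2 x)" for B2 unfolding E_def by (rule rig_edges_mono) blast
        from B0(1) obtain k P where kP: "ham_path n (E B1) D k P" "ham_stage n (E B1) D P = Stuck"
          unfolding \<Psi>_def using ham_stage_Stuck_mono[OF subE] by blast
        from B0 obtain X s0 where ex: "expander n (E B1) X s0 c d1" unfolding NE_def \<Psi>_def by blast
        have \<kappa>0: "0 \<le> \<kappa>" using p1 by (simp add: \<kappa>_def \<gamma>_def c_def)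
        have feat: "\<kappa> \<le> real (card {w\<in>{1..m}. \<exists>u\<in>U. B1 (u, w)})"
          if "U \<subseteq> {1..n}" "c / 12 * real n \<le> real (card U)" for U
        proof (rule ccontr)
          assume "\<not> ?thesis"
          then have "real (card {w\<in>{1..m}. \<exists>u\<in>U. B1 (u, w)}) \<le> \<kappa>" by simp
          then show False using B0(3) that unfolding NF_def \<gamma>_def by blast
        qed
        have TD: "2 * T \<le> D" by (simp add: D_def)
        from closing_incidences[OF n1 ex[unfolded E_def] kP[unfolded E_def] T(3) grow TD feat \<kappa>0]
        obtain Z where Z: "Z \<subseteq> {1..n} \<times> {1..m}" "c / 12 * real n * \<kappa> \<le> real (card Z)"
          "\<forall>\<omega>2. ham_stage n (E (\<lambda>x. B1 x \<or> \<omega>2 x)) D P = Stuck \<longrightarrow> (\<forall>x\<in>Z. \<not> \<omega>2 x)" unfolding E_def by blast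
        have "{B2. (B1, B2) \<in> S} \<subseteq> {B2. \<forall>x\<in>Z. \<not> B2 x}"
        proof
          fix B2 assume "B2 \<in> {B2. (B1, B2) \<in> S}"
          then obtain k' P' where P': "ham_path n (E B1) D k' P'" "ham_stage n (E (\<lambda>x. B1 x \<or> B2 x)) D P' = Stuck"
            unfolding S_def \<Psi>_def by blast
          have "ham_stage n (E B1) D P' = Stuck" by (rule ham_stage_Stuck_mono[OF subE P'(2)])
          \<comment> \<open>Failure with \<open>B2\<close> is also failure on the graph of
            \<open>B1\<close>, where the failing path is unique; so the one set \<open>Z\<close>
            serves all \<open>B2\<close>.\<close>
          then have "P' = P" using ham_stuck_unique[OF P'(1) _ kP] by blast
          then show "B2 \<in> {B2. \<forall>x\<in>Z. \<not> B2 x}" using Z(3) P'(2) by blast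
        qed
        then have "measure_pmf.prob (incidences n m p2) {B2. (B1, B2) \<in> S} \<le>
            measure_pmf.prob (incidences n m p2) {B2. \<forall>x\<in>Z. \<not> B2 x}"
          by (rule measure_pmf.finite_measure_mono) simp
        also have "\<dots> = (1 - p2) ^ card Z" by (rule prob_incidences_avoid[OF Z(1) p2(2,3)])
        also have "\<dots> \<le> exp (- p2) ^ card Z"
          using exp_ge_add_one_self[of "- p2"] p2 by (intro power_mono) auto
        also have "\<dots> = exp (- (p2 * real (card Z)))" by (simp add: mult.commute flip: exp_of_nat_mult)
        also have "\<dots> \<le> exp (- (\<gamma>\<^sup>2 / 72 * sqrt (ln L)))"
        proof -
          \<comment> \<open>\<open>Z\<close> has at least \<open>\<gamma> * n * \<kappa>\<close>
            elements and \<open>p2\<close> is at least \<open>p1 * q\<close>. The product contains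
            \<open>m * p1 * min 1 (n * p1)\<close>, which dominates the intensity and hence
            \<open>L / 2\<close>; what remains is a multiple of
            \<open>n * q * L = sqrt (ln L)\<close>.\<close>
          have \<rho>min: "intensity n m p1 \<le> real m * p1 * min 1 (real n * p1)"
          proof -
            have "1 - (1 - p1) ^ (n - 1) \<le> real (n - 1) * p1"
              using Bernoulli_inequality[of "- p1" "n - 1"] p1 by simp
            also have "\<dots> \<le> real n * p1" using p1 by (intro mult_right_mono) auto
            finally have "1 - (1 - p1) ^ (n - 1) \<le> min 1 (real n * p1)" using p1 by simp
            then show ?thesis unfolding intensity_def using p1 by (intro mult_left_mono) auto
          qed
          have lnL: "0 \<le> sqrt (ln L)" using n(2) by simp
          have "1 / 2 * L \<le> intensity n m p1" using \<rho>1 L0 unfolding L_def[symmetric] by simp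
          then have "1 / 2 * L \<le> real m * p1 * min 1 (real n * p1)" using \<rho>min by (rule order_trans)
          then have f1: "\<gamma>\<^sup>2 / 36 * (sqrt (ln L) / L) * (1 / 2 * L) \<le> \<gamma>\<^sup>2 / 36 * (sqrt (ln L) / L) * (real m * p1 * min 1 (real n * p1))"
            using lnL L0 by (intro mult_left_mono) auto
          have f2: "\<gamma>\<^sup>2 / 36 * (sqrt (ln L) / L) * (1 / 2 * L) = \<gamma>\<^sup>2 / 72 * sqrt (ln L)" using L0 by simp
          have f3: "\<gamma>\<^sup>2 / 36 * (sqrt (ln L) / L) * (real m * p1 * min 1 (real n * p1)) = (p1 * q) * (\<gamma> * real n * \<kappa>)"
          proof -
            have nq: "sqrt (ln L) / L = real n * q" using n0 by (simp add: q_def deletion_rate_def L_def)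
            show ?thesis unfolding nq \<kappa>_def by (simp add: power2_eq_square)
          qed
          have f4: "(p1 * q) * (\<gamma> * real n * \<kappa>) \<le> p2 * real (card Z)"
            using p2 Z(2) p1 q \<kappa>0 by (intro mult_mono) (auto simp: \<gamma>_def c_def)
          have "\<gamma>\<^sup>2 / 72 * sqrt (ln L) \<le> p2 * real (card Z)" by (rule order_trans[OF f1[unfolded f2 f3] f4])
          then show ?thesis by (simp only: exp_le_cancel_iff neg_le_iff_le)
        qed
        finally show ?thesis .
      qed
    qed
    finally show ?thesis using PNE PNF by simp
  qed
  finally show ?thesis by (simp add: \<Phi>_def failure_bound_def L_def d_def \<gamma>_def c_def)
qed

lemma prob_failure_low:
  assumes p: "0 < p" "p \<le> 1 / 1000" and ample: "ample n" and ln16: "16 * ln (real n) / real n \<le> 1"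
    and \<rho>: "intensity n m p \<le> 995 / 1000 * ln (real n)"
  shows "measure_pmf.prob (incidences n m p) {\<omega>. 2 \<le> min_degree n (rig_edges n m \<omega>) \<and> Q \<omega>}
     \<le> real n powr (- 3 / 1000) + 32 * ln (real n) / real n"
proof -
  have n: "n \<ge> 5000" "10 ^ 10 \<le> ln (real n)" using ample by (auto simp: ample_def)
  have "measure_pmf.prob (incidences n m p) {\<omega>. 2 \<le> min_degree n (rig_edges n m \<omega>) \<and> Q \<omega>} \<le>
      measure_pmf.prob (incidences n m p) {\<omega>. \<forall>v\<in>{1..n}. nbhd (rig_edges n m \<omega>) {v} \<noteq> {}}"
  proof (rule measure_pmf.finite_measure_mono)
    show "{\<omega>. 2 \<le> min_degree n (rig_edges n m \<omega>) \<and> Q \<omega>} \<subseteq> {\<omega>. \<forall>v\<in>{1..n}. nbhd (rig_edges n m \<omega>) {v} \<noteq> {}}"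
    proof
      fix \<omega> assume "\<omega> \<in> {\<omega>. 2 \<le> min_degree n (rig_edges n m \<omega>) \<and> Q \<omega>}"
      then have "\<forall>v\<in>{1..n}. 2 \<le> card (nbhd (rig_edges n m \<omega>) {v})"
        using min_degree_ge_iff[OF graph_on_rig_edges, of n m \<omega>] n(1) by simp
      then show "\<omega> \<in> {\<omega>. \<forall>v\<in>{1..n}. nbhd (rig_edges n m \<omega>) {v} \<noteq> {}}" by fastforce
    qed
  qed simp
  also have "\<dots> \<le> real n powr (- 3 / 1000) + 32 * ln (real n) / real n"
    by (rule prob_no_isolated) (use p n ln16 \<rho> in auto)
  finally show ?thesis .
qed

lemma failure_bound_tendsto: "failure_bound \<longlonglongrightarrow> 0"
proof -
  have 1: "(\<lambda>n. 2 * (4 * ln (real n) / ln (ln (real n) / 2) + 9) * (sqrt (ln (ln (real n))) / ln (real n))) \<longlonglongrightarrow> 0"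
    by real_asymp
  have 2: "expansion_error \<longlonglongrightarrow> 0"
    unfolding expansion_error_def[abs_def] by real_asymp
  have 3: "(\<lambda>n. exp (- real n)) \<longlonglongrightarrow> 0" by real_asymp
  have 4: "(\<lambda>n. exp (- ((1 / 10 ^ 6 / 12)\<^sup>2 / 72 * sqrt (ln (ln (real n)))))) \<longlonglongrightarrow> 0" by real_asymp
  show ?thesis unfolding failure_bound_def[abs_def]
    using tendsto_add[OF 1 tendsto_add[OF tendsto_add[OF 2 3] 4]] by simp
qed

theorem theorem1:
  fixes m :: "nat \<Rightarrow> nat" and p :: "nat \<Rightarrow> real"
  assumes "\<And>n. n \<ge> 1 \<Longrightarrow> 0 < p n \<and> p n < 1"
    and "(\<lambda>n. ln (real n)) \<in> o(\<lambda>n. real (m n))"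
    and "\<And>n. n \<ge> 1 \<Longrightarrow> real (m n) * (p n)\<^sup>2 \<le> 1"
  shows "(\<lambda>n. measure_pmf.prob (rig n (m n) (p n))
            {E. min_degree n E \<ge> 2 \<and> ham_fails n E (real n * real (m n) * (p n)\<^sup>2)})
         \<longlonglongrightarrow> 0"
proof -
  define low where "low n = real n powr (- 3 / 1000) + 32 * ln (real n) / real n" for n :: nat
  have "low \<longlonglongrightarrow> 0" unfolding low_def by real_asymp
  then have "(\<lambda>n. \<bar>low n\<bar> + \<bar>failure_bound n\<bar>) \<longlonglongrightarrow> \<bar>0\<bar> + \<bar>0\<bar>"
    by (intro tendsto_add tendsto_rabs failure_bound_tendsto)
  then have lim: "(\<lambda>n. \<bar>low n\<bar> + \<bar>failure_bound n\<bar>) \<longlonglongrightarrow> 0" by simp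
  have ev1: "eventually (\<lambda>n. norm (ln (real n)) \<le> 1 * norm (real (m n))) sequentially"
    using landau_o.smallD[OF assms(2), of 1] by simp
  have ev2: "eventually (\<lambda>n. 16 * ln (real n) / real n \<le> 1) sequentially" by real_asymp
  have ev3: "eventually (\<lambda>n. 0 < deletion_rate n) sequentially" unfolding deletion_rate_def by real_asymp
  have ev4: "eventually (\<lambda>n. deletion_rate n \<le> 1 / 1000) sequentially" unfolding deletion_rate_def by real_asymp
  have ev5: "eventually (\<lambda>n. 12 * 10 ^ 6 \<le> ln (ln (real n) / 2)) sequentially" by real_asymp
  have le: "eventually (\<lambda>n. measure_pmf.prob (rig n (m n) (p n))
            {E. min_degree n E \<ge> 2 \<and> ham_fails n E (real n * real (m n) * (p n)\<^sup>2)} \<le> \<bar>low n\<bar> + \<bar>failure_bound n\<bar>) sequentially"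
    using ev1 ev2 ev3 ev4 ev5 eventually_ample
  proof eventually_elim
    case (elim n)
    have n: "n \<ge> 5000" "10 ^ 10 \<le> ln (real n)" using elim(6) by (auto simp: ample_def)
    have p: "0 < p n" "p n < 1" using assms(1)[of n] n by auto
    have m: "10 ^ 10 \<le> real (m n)" using elim(1) n(2) by simp
    \<comment> \<open>This is where ln n = o(m) enters: \<open>m\<close> is large, so
      \<open>m * p\<^sup>2 <= 1\<close> makes \<open>p\<close> small, as the second moment argument
      requires.\<close>
    have p1000: "p n \<le> 1 / 1000"
    proof (rule ccontr)
      assume "\<not> p n \<le> 1 / 1000"
      then have "(1 / 1000)\<^sup>2 \<le> (p n)\<^sup>2" by (intro power_mono) auto
      then have "10 ^ 10 * (1 / 1000)\<^sup>2 \<le> real (m n) * (p n)\<^sup>2" using m by (intro mult_mono) auto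
      then show False using assms(3)[of n] n(1) by (simp add: power2_eq_square)
    qed
    have eq: "measure_pmf.prob (rig n (m n) (p n))
            {E. min_degree n E \<ge> 2 \<and> ham_fails n E (real n * real (m n) * (p n)\<^sup>2)} =
        measure_pmf.prob (incidences n (m n) (p n)) {\<omega>. 2 \<le> min_degree n (rig_edges n (m n) \<omega>) \<and>
          ham_fails n (rig_edges n (m n) \<omega>) (eff_degree n (m n) (p n))}"
      unfolding rig_eq measure_map_pmf eff_degree_def by (simp add: vimage_def)
    show ?case
    proof (cases "intensity n (m n) (p n) \<le> 995 / 1000 * ln (real n)")
      case True
      then show ?thesis unfolding eq low_def
        using prob_failure_low[OF p(1) p1000 elim(6,2) True, of "\<lambda>\<omega>. ham_fails n (rig_edges n (m n) \<omega>) (eff_degree n (m n) (p n))"]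
        by linarith
    next
      case False
      then show ?thesis unfolding eq
        using prob_failure_high[OF p elim(6) _ elim(3,4,5), of "m n"] by linarith
    qed
  qed
  show ?thesis
    by (rule tendsto_sandwich[OF _ le tendsto_const lim]) (simp add: measure_nonneg)
qed

end
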